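(* Let $p$ be a prime, let $\mathcal{F}$ be a saturated fusion system on a finite $p$-group $S$, and let $U\le S$ be a subgroup. Then the following are equivalent. (1) $\mathcal{F}=N_{\mathcal{F}}(U)$. (2) For every $P\le S$ and every homomorphism $\varphi\colon P\to S$, $\chi_{[P,\varphi]}(\omega_{\mathcal{F}}) = 0$ unless $P\geq U$ and $\varphi$ belongs to $N_{\mathcal{F}}(U)$.
   Context: Fusion systems and saturation are in the standard sense of Broto--Levi--Oliver. For a subgroup $U\le S$, $N_{\mathcal{F}}(U)$ is the normalizer fusion system: the fusion system on $N_S(U)$ whose morphisms $P\to Q$ (for $P,Q\le N_S(U)$) are those $\varphi\in\mathrm{Hom}_{\mathcal{F}}(P,Q)$ that extend to some $\bar\varphi\in\mathrm{Hom}_{\mathcal{F}}(PU,QU)$ with $\bar\varphi(U)=U$. The equality $\mathcal{F}=N_{\mathcal{F}}(U)$ includes $N_S(U)=S$. Burnside modules. For finite groups $G,H$, a $(G,H)$-biset is a set with commuting left $H$-action and right $G$-action. $A(G,H)$ is the Grothendieck group (under disjoint union) of isomorphism classes of finite $(G,H)$-bisets whose left $H$-action is free; $A(G,H)_{(p)}$ is its $p$-localization. For $K\le G$ and a homomorphism $\varphi\colon K\to H$, $[K,\varphi]_G^H$ (or $[K,\varphi]$) is the class of $H\times_{K,\varphi}G=(H\times G)/\sim$, where $(h,kg)\sim(h\varphi(k),g)$ for $k\in K$. These classes, over conjugacy classes of pairs $(K,\varphi)$ (conjugacy in both $G$ and $H$), form a $\mathbb{Z}_{(p)}$-basis of $A(G,H)_{(p)}$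 (the standard basis), and $\chi_{[K,\varphi]}(X)\in\mathbb{Z}_{(p)}$ denotes the coefficient of $[K,\varphi]$ in $X\in A(G,H)_{(p)}$. The bilinear composition $A(H,K)\times A(G,H)\to A(G,K)$ is given on bisets by $X\circ Y=X\times_H Y$. The map $\mathrm{incl}$ denotes the relevant inclusion of subgroups. Characteristic idempotents. Let $\mathcal{F}$ be a fusion system on $S$. An element $X\in A(S,S)_{(p)}$ is $\mathcal{F}$-generated if it is a linear combination of basis elements $[P,\varphi]$ with $\varphi$ in $\mathcal{F}$. For a finite group $H$, $X\in A(S,H)_{(p)}$ is right $\mathcal{F}$-stable if $X\circ[P,\varphi]_P^S=X\circ[P,\mathrm{incl}]_P^S$ for all $P\le S$, $\varphi\in\mathrm{Hom}_{\mathcal{F}}(P,S)$; $X\in A(H,S)_{(p)}$ is left $\mathcal{F}$-stable if $[\varphi(P),\varphi^{-1}]_S^P\circ X=[P,\mathrm{id}]_S^P\circ X$ for all such $P,\varphi$. The augmentation $\epsilon\colon A(S,S)_{(p)}\to\mathbb{Z}_{(p)}$ is the linear map with $\epsilon([P,\varphi]_S^S)=|S/P|$. For $\mathcal{F}$ saturated, a characteristic idempotent for $\mathcal{F}$ is an idempotent of the ring $A(S,S)_{(p)}$ that is $\mathcal{F}$-generated, left and right $\mathcal{F}$-stable, and of augmentation prime to $p$. It is known that every saturated fusion system $\mathcal{F}$ has exactly one characteristic idempotent; it is denoted $\omega_{\mathcal{F}}$. *)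

theory Defs
  imports Complex_Main "HOL-Algebra.Sylow" "HOL-Algebra.Group_Action" "HOL-Library.Poly_Mapping"
begin

section \<open>Fusion systems\<close>

abbreviation sub_group :: "('a, 'm) monoid_scheme \<Rightarrow> 'a set \<Rightarrow> ('a, 'm) monoid_scheme"
  where "sub_group S P \<equiv> S\<lparr>carrier := P\<rparr>"

definition p_group :: "nat \<Rightarrow> ('a, 'm) monoid_scheme \<Rightarrow> bool"
  where "p_group p S \<longleftrightarrow> group S \<and> finite (carrier S) \<and> (\<exists>n. order S = p ^ n)"

definition sylow_subgroup :: "nat \<Rightarrow> ('a, 'm) monoid_scheme \<Rightarrow> 'a set \<Rightarrow> bool"
  where "sylow_subgroup p G H \<longleftrightarrow> subgroup H G \<and> card H = p ^ multiplicity p (order G)"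

definition centralizer :: "('a, 'm) monoid_scheme \<Rightarrow> 'a set \<Rightarrow> 'a set"
  where "centralizer S P = {g \<in> carrier S. \<forall>x\<in>P. g \<otimes>\<^bsub>S\<^esub> x = x \<otimes>\<^bsub>S\<^esub> g}"

text \<open>Maps between subgroups \<open>P\<close>, \<open>Q\<close> are represented as functions that are extensional on \<open>P\<close>,
  so that equality of maps is equality of functions.\<close>

definition Homs :: "('a, 'm) monoid_scheme \<Rightarrow> 'a set \<Rightarrow> 'a set \<Rightarrow> ('a \<Rightarrow> 'a) set"
  where "Homs S P Q = hom (sub_group S P) (sub_group S Q) \<inter> extensional P"

definition Inj :: "('a, 'm) monoid_scheme \<Rightarrow> 'a set \<Rightarrow> 'a set \<Rightarrow> ('a \<Rightarrow> 'a) set"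
  where "Inj S P Q = mon (sub_group S P) (sub_group S Q) \<inter> extensional P"

definition conj_map :: "('a, 'm) monoid_scheme \<Rightarrow> 'a set \<Rightarrow> 'a \<Rightarrow> 'a \<Rightarrow> 'a"
  where "conj_map S P g = (\<lambda>x\<in>P. g \<otimes>\<^bsub>S\<^esub> x \<otimes>\<^bsub>S\<^esub> inv\<^bsub>S\<^esub> g)"

definition Hom_conj :: "('a, 'm) monoid_scheme \<Rightarrow> 'a set \<Rightarrow> 'a set \<Rightarrow> ('a \<Rightarrow> 'a) set"
  where "Hom_conj S P Q = {conj_map S P g | g. g \<in> carrier S \<and> conj_map S P g ` P \<subseteq> Q}"

definition inv_map :: "'a set \<Rightarrow> ('a \<Rightarrow> 'b) \<Rightarrow> 'b \<Rightarrow> 'a"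
  where "inv_map P \<phi> = (\<lambda>y\<in>\<phi> ` P. inv_into P \<phi> y)"

text \<open>A fusion system is given by its morphism sets \<open>F P Q\<close>; by convention these are empty
  unless \<open>P\<close> and \<open>Q\<close> are objects.\<close>

type_synonym 'a homsets = "'a set \<Rightarrow> 'a set \<Rightarrow> ('a \<Rightarrow> 'a) set"

definition fusion_system :: "('a, 'm) monoid_scheme \<Rightarrow> 'a homsets \<Rightarrow> bool"
  where "fusion_system S F \<longleftrightarrow>
    (\<forall>P Q. \<not> (subgroup P S \<and> subgroup Q S) \<longrightarrow> F P Q = {}) \<and>
    (\<forall>P Q. subgroup P S \<and> subgroup Q S \<longrightarrow> Hom_conj S P Q \<subseteq> F P Q \<and> F P Q \<subseteq> Inj S P Q) \<and>
    (\<forall>P Q R \<phi> \<psi>. \<phi> \<in> F P Q \<and> \<psi> \<in> F Q R \<longrightarrow> compose P \<psi> \<phi> \<in> F P R) \<and>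
    (\<forall>P Q \<phi>. \<phi> \<in> F P Q \<longrightarrow> \<phi> \<in> F P (\<phi> ` P) \<and> inv_map P \<phi> \<in> F (\<phi> ` P) P)"

definition fconj :: "'a homsets \<Rightarrow> 'a set \<Rightarrow> 'a set \<Rightarrow> bool"
  where "fconj F P Q \<longleftrightarrow> (\<exists>\<phi>\<in>F P Q. \<phi> ` P = Q)"

definition fully_centralized :: "('a, 'm) monoid_scheme \<Rightarrow> 'a homsets \<Rightarrow> 'a set \<Rightarrow> bool"
  where "fully_centralized S F P \<longleftrightarrow>
    (\<forall>Q. fconj F P Q \<longrightarrow> card (centralizer S Q) \<le> card (centralizer S P))"

definition fully_normalized :: "('a, 'm) monoid_scheme \<Rightarrow> 'a homsets \<Rightarrow> 'a set \<Rightarrow> bool"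
  where "fully_normalized S F P \<longleftrightarrow>
    (\<forall>Q. fconj F P Q \<longrightarrow> card (normalizer S Q) \<le> card (normalizer S P))"

definition Aut_grp :: "'a homsets \<Rightarrow> 'a set \<Rightarrow> ('a \<Rightarrow> 'a) monoid"
  where "Aut_grp F P = (BijGroup P)\<lparr>carrier := F P P\<rparr>"

text \<open>\<open>N\<^sub>\<phi>\<close>: the \<open>g\<close> in \<open>N\<^sub>S(P)\<close> for which \<open>\<phi> \<circ> c\<^sub>g \<circ> \<phi>\<inverse>\<close> lies in \<open>Aut\<^sub>S(\<phi>(P))\<close>.\<close>

definition N_phi :: "('a, 'm) monoid_scheme \<Rightarrow> 'a set \<Rightarrow> ('a \<Rightarrow> 'a) \<Rightarrow> 'a set"
  where "N_phi S P \<phi> = {g \<in> normalizer S P.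
    compose (\<phi> ` P) \<phi> (compose (\<phi> ` P) (conj_map S P g) (inv_map P \<phi>))
      \<in> Hom_conj S (\<phi> ` P) (\<phi> ` P)}"

definition saturated :: "nat \<Rightarrow> ('a, 'm) monoid_scheme \<Rightarrow> 'a homsets \<Rightarrow> bool"
  where "saturated p S F \<longleftrightarrow>
    (\<forall>P. subgroup P S \<and> fully_normalized S F P \<longrightarrow>
      fully_centralized S F P \<and> sylow_subgroup p (Aut_grp F P) (Hom_conj S P P)) \<and>
    (\<forall>P \<phi>. subgroup P S \<and> \<phi> \<in> F P (carrier S) \<and> fully_centralized S F (\<phi> ` P) \<longrightarrow>
      (\<exists>\<psi>\<in>F (N_phi S P \<phi>) (carrier S). restrict \<psi> P = \<phi>))"

definition normalizer_system ::
    "('a, 'm) monoid_scheme \<Rightarrow> 'a homsets \<Rightarrow> 'a set \<Rightarrow> 'a homsets"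
  where "normalizer_system S F U P Q =
    (if subgroup P (sub_group S (normalizer S U)) \<and> subgroup Q (sub_group S (normalizer S U))
     then {\<phi> \<in> F P Q. \<exists>\<psi>\<in>F (P <#>\<^bsub>S\<^esub> U) (Q <#>\<^bsub>S\<^esub> U). restrict \<psi> P = \<phi> \<and> \<psi> ` U = U}
     else {})"

section \<open>Bisets\<close>

text \<open>In \<open>('g, 'h, 'x) biset\<close> the group acting on the right lives in \<open>'g\<close> and the group acting
  on the left in \<open>'h\<close>, as in the convention for \<open>(G, H)\<close>-bisets.\<close>

record ('g, 'h, 'x) biset =
  points :: "'x set"
  lact :: "'h \<Rightarrow> 'x \<Rightarrow> 'x"
  ract :: "'x \<Rightarrow> 'g \<Rightarrow> 'x"

definition is_biset ::
    "('g, 'm) monoid_scheme \<Rightarrow> ('h, 'n) monoid_scheme \<Rightarrow> ('g, 'h, 'x) biset \<Rightarrow> bool"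
  where "is_biset G H X \<longleftrightarrow>
    (\<forall>x\<in>points X.
      (\<forall>h\<in>carrier H. lact X h x \<in> points X) \<and>
      lact X \<one>\<^bsub>H\<^esub> x = x \<and>
      (\<forall>h\<in>carrier H. \<forall>h'\<in>carrier H. lact X (h \<otimes>\<^bsub>H\<^esub> h') x = lact X h (lact X h' x)) \<and>
      (\<forall>g\<in>carrier G. ract X x g \<in> points X) \<and>
      ract X x \<one>\<^bsub>G\<^esub> = x \<and>
      (\<forall>g\<in>carrier G. \<forall>g'\<in>carrier G. ract X x (g \<otimes>\<^bsub>G\<^esub> g') = ract X (ract X x g) g') \<and>
      (\<forall>h\<in>carrier H. \<forall>g\<in>carrier G. ract X (lact X h x) g = lact X h (ract X x g)))"

definition fin_free_biset ::
    "('g, 'm) monoid_scheme \<Rightarrow> ('h, 'n) monoid_scheme \<Rightarrow> ('g, 'h, 'x) biset \<Rightarrow> bool"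
  where "fin_free_biset G H X \<longleftrightarrow> is_biset G H X \<and> finite (points X) \<and>
    (\<forall>x\<in>points X. \<forall>h\<in>carrier H. lact X h x = x \<longrightarrow> h = \<one>\<^bsub>H\<^esub>)"

definition biset_isomorphic :: "('g, 'm) monoid_scheme \<Rightarrow> ('h, 'n) monoid_scheme \<Rightarrow>
    ('g, 'h, 'x) biset \<Rightarrow> ('g, 'h, 'y) biset \<Rightarrow> bool"
  where "biset_isomorphic G H X Y \<longleftrightarrow> (\<exists>f. bij_betw f (points X) (points Y) \<and>
    (\<forall>x\<in>points X. (\<forall>h\<in>carrier H. f (lact X h x) = lact Y h (f x)) \<and>
                  (\<forall>g\<in>carrier G. f (ract X x g) = ract Y (f x) g)))"

definition biset_sum :: "('g, 'h, 'x) biset \<Rightarrow> ('g, 'h, 'y) biset \<Rightarrow> ('g, 'h, 'x + 'y) biset"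
  where "biset_sum X Y = \<lparr>points = points X <+> points Y,
    lact = (\<lambda>h. map_sum (lact X h) (lact Y h)),
    ract = (\<lambda>z g. map_sum (\<lambda>x. ract X x g) (\<lambda>y. ract Y y g) z)\<rparr>"

text \<open>\<open>X \<times>\<^sub>H Y\<close>, the quotient of \<open>X \<times> Y\<close> by \<open>(x h, y) \<sim> (x, h y)\<close>. Since \<open>H\<close> is a group, these
  generating pairs already form an equivalence relation.\<close>

definition biset_prod :: "('h, 'm) monoid_scheme \<Rightarrow> ('h, 'k, 'x) biset \<Rightarrow> ('g, 'h, 'y) biset \<Rightarrow>
    ('g, 'k, ('x \<times> 'y) set) biset"
  where "biset_prod H X Y = \<lparr>
    points = (points X \<times> points Y) //
      {((ract X x h, y), (x, lact Y h y)) | x h y. x \<in> points X \<and> h \<in> carrier H \<and> y \<in> points Y},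
    lact = (\<lambda>k. image (\<lambda>(x, y). (lact X k x, y))),
    ract = (\<lambda>C g. (\<lambda>(x, y). (x, ract Y y g)) ` C)\<rparr>"

text \<open>\<open>H \<times>\<^bsub>K,\<phi>\<^esub> G\<close>, the quotient of \<open>H \<times> G\<close> by \<open>(h, k g) \<sim> (h \<phi>(k), g)\<close>; again the generating
  pairs already form an equivalence relation.\<close>

definition std_biset :: "('g, 'm) monoid_scheme \<Rightarrow> ('h, 'n) monoid_scheme \<Rightarrow>
    'g set \<Rightarrow> ('g \<Rightarrow> 'h) \<Rightarrow> ('g, 'h, ('h \<times> 'g) set) biset"
  where "std_biset G H K \<phi> = \<lparr>
    points = (carrier H \<times> carrier G) //
      {((h, k \<otimes>\<^bsub>G\<^esub> g), (h \<otimes>\<^bsub>H\<^esub> \<phi> k, g)) | h k g. h \<in> carrier H \<and> k \<in> K \<and> g \<in> carrier G},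
    lact = (\<lambda>h'. image (\<lambda>(h, g). (h' \<otimes>\<^bsub>H\<^esub> h, g))),
    ract = (\<lambda>C g'. (\<lambda>(h, g). (h, g \<otimes>\<^bsub>G\<^esub> g')) ` C)\<rparr>"

section \<open>Burnside modules\<close>

text \<open>Every finite biset is isomorphic to one whose points are natural numbers, so isomorphism
  classes are represented as sets of bisets on \<open>nat\<close>; the biset \<open>X\<close> itself may live on any type.\<close>

type_synonym ('g, 'h) biset_class = "('g, 'h, nat) biset set"

definition iso_class :: "('g, 'm) monoid_scheme \<Rightarrow> ('h, 'n) monoid_scheme \<Rightarrow>
    ('g, 'h, 'x) biset \<Rightarrow> ('g, 'h) biset_class"
  where "iso_class G H X = {Y. fin_free_biset G H Y \<and> biset_isomorphic G H X Y}"

definition iso_classes ::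
    "('g, 'm) monoid_scheme \<Rightarrow> ('h, 'n) monoid_scheme \<Rightarrow> ('g, 'h) biset_class set"
  where "iso_classes G H = {iso_class G H X | X :: ('g, 'h, nat) biset. fin_free_biset G H X}"

definition Z_loc :: "nat \<Rightarrow> rat set"
  where "Z_loc p = {of_int a / of_int b | a b. \<not> int p dvd b}"

text \<open>The \<open>p\<close>-localized Grothendieck group is presented as the free \<open>\<int>\<^sub>(\<^sub>p\<^sub>)\<close>-module on isomorphism
  classes modulo the \<open>\<int>\<^sub>(\<^sub>p\<^sub>)\<close>-submodule generated by all \<open>[X \<squnion> Y] - [X] - [Y]\<close>.\<close>

definition formal_combs :: "nat \<Rightarrow> ('g, 'm) monoid_scheme \<Rightarrow> ('h, 'n) monoid_scheme \<Rightarrow>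
    (('g, 'h) biset_class \<Rightarrow>\<^sub>0 rat) set"
  where "formal_combs p G H =
    {x. Poly_Mapping.keys x \<subseteq> iso_classes G H \<and> (\<forall>c. Poly_Mapping.lookup x c \<in> Z_loc p)}"

inductive_set sum_relations :: "nat \<Rightarrow> ('g, 'm) monoid_scheme \<Rightarrow> ('h, 'n) monoid_scheme \<Rightarrow>
    (('g, 'h) biset_class \<Rightarrow>\<^sub>0 rat) set"
  for p :: nat and G :: "('g, 'm) monoid_scheme" and H :: "('h, 'n) monoid_scheme"
  where
    zero: "0 \<in> sum_relations p G H"
  | add: "\<lbrakk>z \<in> sum_relations p G H; r \<in> Z_loc p;
        fin_free_biset G H (X :: ('g, 'h, nat) biset);
        fin_free_biset G H (Y :: ('g, 'h, nat) biset)\<rbrakk> \<Longrightarrow>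
      z + (Poly_Mapping.single (iso_class G H (biset_sum X Y)) r
           - Poly_Mapping.single (iso_class G H X) r
           - Poly_Mapping.single (iso_class G H Y) r) \<in> sum_relations p G H"

definition burnside_rel :: "nat \<Rightarrow> ('g, 'm) monoid_scheme \<Rightarrow> ('h, 'n) monoid_scheme \<Rightarrow>
    (('g, 'h) biset_class \<Rightarrow>\<^sub>0 rat) rel"
  where "burnside_rel p G H =
    {(x, y). x \<in> formal_combs p G H \<and> y \<in> formal_combs p G H \<and> x - y \<in> sum_relations p G H}"

type_synonym ('g, 'h) burnside_elt = "(('g, 'h) biset_class \<Rightarrow>\<^sub>0 rat) set"

definition burnside :: "nat \<Rightarrow> ('g, 'm) monoid_scheme \<Rightarrow> ('h, 'n) monoid_scheme \<Rightarrow>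
    ('g, 'h) burnside_elt set"
  where "burnside p G H = formal_combs p G H // burnside_rel p G H"

definition b_class :: "nat \<Rightarrow> ('g, 'm) monoid_scheme \<Rightarrow> ('h, 'n) monoid_scheme \<Rightarrow>
    (('g, 'h) biset_class \<Rightarrow>\<^sub>0 rat) \<Rightarrow> ('g, 'h) burnside_elt"
  where "b_class p G H x = burnside_rel p G H `` {x}"

definition b_add :: "nat \<Rightarrow> ('g, 'm) monoid_scheme \<Rightarrow> ('h, 'n) monoid_scheme \<Rightarrow>
    ('g, 'h) burnside_elt \<Rightarrow> ('g, 'h) burnside_elt \<Rightarrow> ('g, 'h) burnside_elt"
  where "b_add p G H X Y = (\<Union>x\<in>X. \<Union>y\<in>Y. b_class p G H (x + y))"

definition b_smult :: "nat \<Rightarrow> ('g, 'm) monoid_scheme \<Rightarrow> ('h, 'n) monoid_scheme \<Rightarrow>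
    rat \<Rightarrow> ('g, 'h) burnside_elt \<Rightarrow> ('g, 'h) burnside_elt"
  where "b_smult p G H r X = (\<Union>x\<in>X. b_class p G H (Poly_Mapping.map ((*) r) x))"

definition class_prod :: "('g, 'm) monoid_scheme \<Rightarrow> ('h, 'n) monoid_scheme \<Rightarrow>
    ('k, 'l) monoid_scheme \<Rightarrow> ('h, 'k) biset_class \<Rightarrow> ('g, 'h) biset_class \<Rightarrow> ('g, 'k) biset_class"
  where "class_prod G H K c d = (\<Union>X\<in>c. \<Union>Y\<in>d. iso_class G K (biset_prod H X Y))"

text \<open>Composition \<open>A(H,K) \<times> A(G,H) \<rightarrow> A(G,K)\<close>, the bilinear extension of \<open>X \<times>\<^sub>H Y\<close>.\<close>

definition b_comp :: "nat \<Rightarrow> ('g, 'm) monoid_scheme \<Rightarrow> ('h, 'n) monoid_scheme \<Rightarrow>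
    ('k, 'l) monoid_scheme \<Rightarrow>
    ('h, 'k) burnside_elt \<Rightarrow> ('g, 'h) burnside_elt \<Rightarrow> ('g, 'k) burnside_elt"
  where "b_comp p G H K X Y = (\<Union>x\<in>X. \<Union>y\<in>Y. b_class p G K
    (\<Sum>c\<in>Poly_Mapping.keys x. \<Sum>d\<in>Poly_Mapping.keys y.
      Poly_Mapping.single (class_prod G H K c d)
        (Poly_Mapping.lookup x c * Poly_Mapping.lookup y d)))"

definition bracket :: "nat \<Rightarrow> ('g, 'm) monoid_scheme \<Rightarrow> ('h, 'n) monoid_scheme \<Rightarrow>
    'g set \<Rightarrow> ('g \<Rightarrow> 'h) \<Rightarrow> ('g, 'h) burnside_elt"
  where "bracket p G H K \<phi> =
    b_class p G H (Poly_Mapping.single (iso_class G H (std_biset G H K \<phi>)) 1)"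

definition std_classes ::
    "('g, 'm) monoid_scheme \<Rightarrow> ('h, 'n) monoid_scheme \<Rightarrow> ('g, 'h) biset_class set"
  where "std_classes G H =
    {iso_class G H (std_biset G H K \<phi>) | K \<phi>. subgroup K G \<and> \<phi> \<in> hom (sub_group G K) H}"

text \<open>\<open>\<chi>\<^bsub>[K,\<phi>]\<^esub>(X)\<close>: the standard basis expansion of \<open>X\<close> is the unique formal combination in the
  class \<open>X\<close> that is supported on the classes of the \<open>H \<times>\<^bsub>K,\<phi>\<^esub> G\<close>.\<close>

definition chi :: "('g, 'm) monoid_scheme \<Rightarrow> ('h, 'n) monoid_scheme \<Rightarrow>
    'g set \<Rightarrow> ('g \<Rightarrow> 'h) \<Rightarrow> ('g, 'h) burnside_elt \<Rightarrow> rat"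
  where "chi G H K \<phi> X =
    Poly_Mapping.lookup (THE x. x \<in> X \<and> Poly_Mapping.keys x \<subseteq> std_classes G H)
      (iso_class G H (std_biset G H K \<phi>))"

section \<open>Characteristic idempotents\<close>

definition generated :: "('a, 'm) monoid_scheme \<Rightarrow> 'a homsets \<Rightarrow> ('a, 'a) burnside_elt \<Rightarrow> bool"
  where "generated S F X \<longleftrightarrow> (\<exists>x\<in>X. Poly_Mapping.keys x \<subseteq>
    {iso_class S S (std_biset S S P \<phi>) | P \<phi>. subgroup P S \<and> \<phi> \<in> F P (carrier S)})"

definition right_stable :: "nat \<Rightarrow> ('a, 'm) monoid_scheme \<Rightarrow> 'a homsets \<Rightarrow>
    ('h, 'n) monoid_scheme \<Rightarrow> ('a, 'h) burnside_elt \<Rightarrow> bool"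
  where "right_stable p S F H X \<longleftrightarrow>
    (\<forall>P \<phi>. subgroup P S \<and> \<phi> \<in> F P (carrier S) \<longrightarrow>
      b_comp p (sub_group S P) S H X (bracket p (sub_group S P) S P \<phi>) =
      b_comp p (sub_group S P) S H X (bracket p (sub_group S P) S P (\<lambda>x\<in>P. x)))"

definition left_stable :: "nat \<Rightarrow> ('a, 'm) monoid_scheme \<Rightarrow> 'a homsets \<Rightarrow>
    ('h, 'n) monoid_scheme \<Rightarrow> ('h, 'a) burnside_elt \<Rightarrow> bool"
  where "left_stable p S F H X \<longleftrightarrow>
    (\<forall>P \<phi>. subgroup P S \<and> \<phi> \<in> F P (carrier S) \<longrightarrow>
      b_comp p H S (sub_group S P) (bracket p S (sub_group S P) (\<phi> ` P) (inv_map P \<phi>)) X =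
      b_comp p H S (sub_group S P) (bracket p S (sub_group S P) P (\<lambda>x\<in>P. x)) X)"

definition augmentation :: "nat \<Rightarrow> ('a, 'm) monoid_scheme \<Rightarrow> ('a, 'a) burnside_elt \<Rightarrow> rat"
  where "augmentation p S = (THE e. e \<in> burnside p S S \<rightarrow>\<^sub>E Z_loc p \<and>
    (\<forall>X\<in>burnside p S S. \<forall>Y\<in>burnside p S S. e (b_add p S S X Y) = e X + e Y) \<and>
    (\<forall>r\<in>Z_loc p. \<forall>X\<in>burnside p S S. e (b_smult p S S r X) = r * e X) \<and>
    (\<forall>P \<phi>. subgroup P S \<and> \<phi> \<in> hom (sub_group S P) S \<longrightarrow>
      e (bracket p S S P \<phi>) = of_nat (card (rcosets\<^bsub>S\<^esub> P))))"

definition characteristic_idempotent ::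
    "nat \<Rightarrow> ('a, 'm) monoid_scheme \<Rightarrow> 'a homsets \<Rightarrow> ('a, 'a) burnside_elt \<Rightarrow> bool"
  where "characteristic_idempotent p S F \<omega> \<longleftrightarrow>
    \<omega> \<in> burnside p S S \<and>
    b_comp p S S S \<omega> \<omega> = \<omega> \<and>
    generated S F \<omega> \<and>
    left_stable p S F S \<omega> \<and>
    right_stable p S F S \<omega> \<and>
    augmentation p S \<omega> \<notin> (*) (of_nat p) ` Z_loc p"

end

theory Submission
  imports Defs
begin

text \<open>
  The marks \<open>\<Phi>\<^bsub>P,\<phi>\<^esub>(X)\<close>, counting the \<open>x\<close> with \<open>x q = \<phi>(q) x\<close> for all \<open>q \<in> P\<close>, are linear in \<open>X\<close> and
  triangular on the standard basis. Stability makes \<open>\<Phi>\<^bsub>P,\<phi>\<^esub>(\<omega>)\<close> independent of \<open>\<phi> \<in> F(P,S)\<close>, and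
  \<open>F\<close>-generation makes it vanish for \<open>\<phi> \<notin> F(P,S)\<close>. Let \<open>T\<^sub>P\<close> be the sum over \<open>\<phi>\<close> of these marks, the number
  of points fixed by \<open>P\<close> up to the left action. Idempotence gives \<open>|S| \<Phi>\<^bsub>P,\<phi>\<^esub>(\<omega>) = \<Phi>\<^bsub>P,\<phi>\<^esub>(\<omega>) T\<^sub>P(\<omega>)\<close>, and
  \<open>T\<^sub>P(\<omega>) / |S|\<close> is congruent to the augmentation modulo \<open>p\<close>, hence nonzero. Therefore
  \<open>\<Phi>\<^bsub>P,\<phi>\<^esub>(\<omega>) = |S| / |F(P,S)|\<close> for \<open>\<phi> \<in> F(P,S)\<close>.

  These marks being nonzero, every morphism of \<open>F\<close> is, up to conjugation in \<open>S\<close>, a restriction of some \<open>\<psi>\<close>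
  with \<open>[Q,\<psi>]\<close> occurring in \<open>\<omega>\<close>, which gives one implication. Conversely, if \<open>F = N\<^sub>F(U)\<close>, then on the part of
  \<open>\<omega>\<close> supported on \<open>Q \<ge> U\<close> the mark at \<open>(P,\<phi>)\<close> is the sum of the marks at the extensions of \<open>\<phi>\<close> to
  \<open>PU\<close>. Every \<open>\<phi>\<close> has \<open>|F(PU,S)| / |F(P,S)|\<close> extensions, so this part already has all the marks of \<open>\<omega>\<close>, and by
  triangularity nothing else occurs.
\<close>

section \<open>Bisets\<close>

text \<open>Freeness of the left action drives the argument: if x q lies in the left orbit of x,
  then x q = h x for exactly one h. A point fixed by P up to the left action therefore carries
  exactly one homomorphism, and this is why T_P is a sum of marks. The factor |S| arises because
  every point of a product X \<times>_S Y is a class of |S| pairs. Counting pairs (x, y) and fixing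
  a y that carries \<psi> leaves the mark of X in which P acts on the right through \<psi>; right
  stability removes \<psi>, and the count factors. The congruence for T_P is the fixed point
  congruence for P acting on the left orbits, whose number is the augmentation. In the last argument
  the number of extensions of \<phi> to PU does not depend on \<phi>: U being preserved, every
  extension has image \<phi>(P)U, so two extensions differ by an automorphism of PU in F that is
  trivial on P. The obstacle is that coefficients of \<omega> are not visible from the marks one by
  one; only a subgroup of maximal order in the unwanted part of the support isolates a single
  coefficient.\<close>

text \<open>\<open>P\<close> is only an index set, and it acts through \<open>\<alpha>\<close> and
  \<open>\<beta>\<close>. The same count can thus be twisted on the right by a morphism, as right
  stability demands, and over an empty index set it counts all points.\<close>

definition fixpts :: "('g, 'h, 'x) biset \<Rightarrow> 'q set \<Rightarrow> ('q \<Rightarrow> 'g) \<Rightarrow> ('q \<Rightarrow> 'h) \<Rightarrow> 'x set"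
  where "fixpts X P \<alpha> \<beta> = {x \<in> points X. \<forall>q\<in>P. ract X x (\<alpha> q) = lact X (\<beta> q) x}"

lemma is_bisetD:
  assumes "is_biset G H X" and "x \<in> points X"
  shows "h \<in> carrier H \<Longrightarrow> lact X h x \<in> points X"
    and "lact X \<one>\<^bsub>H\<^esub> x = x"
    and "h \<in> carrier H \<Longrightarrow> h' \<in> carrier H \<Longrightarrow> lact X (h \<otimes>\<^bsub>H\<^esub> h') x = lact X h (lact X h' x)"
    and "g \<in> carrier G \<Longrightarrow> ract X x g \<in> points X"
    and "ract X x \<one>\<^bsub>G\<^esub> = x"
    and "g \<in> carrier G \<Longrightarrow> g' \<in> carrier G \<Longrightarrow> ract X x (g \<otimes>\<^bsub>G\<^esub> g') = ract X (ract X x g) g'"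
    and "h \<in> carrier H \<Longrightarrow> g \<in> carrier G \<Longrightarrow> ract X (lact X h x) g = lact X h (ract X x g)"
  using assms unfolding is_biset_def by auto

lemma fin_free_bisetD:
  assumes "fin_free_biset G H X"
  shows "is_biset G H X" and "finite (points X)"
    and "x \<in> points X \<Longrightarrow> h \<in> carrier H \<Longrightarrow> lact X h x = x \<Longrightarrow> h = \<one>\<^bsub>H\<^esub>"
  using assms unfolding fin_free_biset_def by auto

lemma lact_inv_cancel:
  assumes "group H" "is_biset G H X" "x \<in> points X" "h \<in> carrier H"
  shows "lact X (inv\<^bsub>H\<^esub> h) (lact X h x) = x" and "lact X h (lact X (inv\<^bsub>H\<^esub> h) x) = x"
proof -
  interpret group H by fact
  show "lact X (inv\<^bsub>H\<^esub> h) (lact X h x) = x"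
    using is_bisetD(3)[OF assms(2,3), of "inv\<^bsub>H\<^esub> h" h] is_bisetD(2)[OF assms(2,3)] assms(4) by simp
  show "lact X h (lact X (inv\<^bsub>H\<^esub> h) x) = x"
    using is_bisetD(3)[OF assms(2,3), of h "inv\<^bsub>H\<^esub> h"] is_bisetD(2)[OF assms(2,3)] assms(4) by simp
qed

lemma ract_inv_cancel:
  assumes "group G" "is_biset G H X" "x \<in> points X" "g \<in> carrier G"
  shows "ract X (ract X x g) (inv\<^bsub>G\<^esub> g) = x" and "ract X (ract X x (inv\<^bsub>G\<^esub> g)) g = x"
proof -
  interpret group G by fact
  show "ract X (ract X x g) (inv\<^bsub>G\<^esub> g) = x"
    using is_bisetD(6)[OF assms(2,3), of g "inv\<^bsub>G\<^esub> g"] is_bisetD(5)[OF assms(2,3)] assms(4) by simp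
  show "ract X (ract X x (inv\<^bsub>G\<^esub> g)) g = x"
    using is_bisetD(6)[OF assms(2,3), of "inv\<^bsub>G\<^esub> g" g] is_bisetD(5)[OF assms(2,3)] assms(4) by simp
qed

text \<open>Freeness speaks of the identity only; dividing by h' gives the cancellation form, by
  which a point determines the homomorphism it carries.\<close>

lemma lact_inj:
  assumes "group H" "fin_free_biset G H X" "x \<in> points X" "h \<in> carrier H" "h' \<in> carrier H"
    and "lact X h x = lact X h' x"
  shows "h = h'"
proof -
  interpret group H by fact
  note b = fin_free_bisetD(1)[OF assms(2)]
  have "lact X (inv\<^bsub>H\<^esub> h' \<otimes>\<^bsub>H\<^esub> h) x = x"
    using is_bisetD(3)[OF b assms(3), of "inv\<^bsub>H\<^esub> h'" h] lact_inv_cancel(1)[OF assms(1) b assms(3,5)] assms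
    by simp
  then have "inv\<^bsub>H\<^esub> h' \<otimes>\<^bsub>H\<^esub> h = \<one>\<^bsub>H\<^esub>"
    using fin_free_bisetD(3)[OF assms(2,3)] assms by simp
  then show ?thesis using assms(4,5) by (metis inv_closed inv_equality inv_inv)
qed

subsection \<open>Isomorphisms\<close>

lemma biset_isomorphic_trans:
  assumes "biset_isomorphic G H X Y" "biset_isomorphic G H Y Z"
  shows "biset_isomorphic G H X Z"
proof -
  obtain f g where f: "bij_betw f (points X) (points Y)"
    "\<And>x h. x \<in> points X \<Longrightarrow> h \<in> carrier H \<Longrightarrow> f (lact X h x) = lact Y h (f x)"
    "\<And>x g. x \<in> points X \<Longrightarrow> g \<in> carrier G \<Longrightarrow> f (ract X x g) = ract Y (f x) g"
    and g: "bij_betw g (points Y) (points Z)"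
    "\<And>x h. x \<in> points Y \<Longrightarrow> h \<in> carrier H \<Longrightarrow> g (lact Y h x) = lact Z h (g x)"
    "\<And>x k. x \<in> points Y \<Longrightarrow> k \<in> carrier G \<Longrightarrow> g (ract Y x k) = ract Z (g x) k"
    using assms unfolding biset_isomorphic_def by blast
  have "f x \<in> points Y" if "x \<in> points X" for x using f(1) that by (rule bij_betwE[THEN bspec])
  then show ?thesis unfolding biset_isomorphic_def
    by (intro exI[of _ "g \<circ> f"]) (auto simp: f g intro: bij_betw_trans[OF f(1) g(1)])
qed

lemma biset_isomorphic_sym:
  assumes "is_biset G H X" "biset_isomorphic G H X Y"
  shows "biset_isomorphic G H Y X"
proof -
  obtain f where f: "bij_betw f (points X) (points Y)"
    "\<And>x h. x \<in> points X \<Longrightarrow> h \<in> carrier H \<Longrightarrow> f (lact X h x) = lact Y h (f x)"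
    "\<And>x g. x \<in> points X \<Longrightarrow> g \<in> carrier G \<Longrightarrow> f (ract X x g) = ract Y (f x) g"
    using assms unfolding biset_isomorphic_def by blast
  define k where "k = inv_into (points X) f"
  have k: "bij_betw k (points Y) (points X)" unfolding k_def using f(1) by (rule bij_betw_inv_into)
  have kf: "k (f x) = x" if "x \<in> points X" for x
    unfolding k_def using f(1) that by (simp add: bij_betw_def)
  have ex: "\<exists>x\<in>points X. y = f x" if "y \<in> points Y" for y using f(1) that by (auto simp: bij_betw_def)
  have 1: "k (lact Y h y) = lact X h (k y)" if "y \<in> points Y" "h \<in> carrier H" for y h
    using ex[OF that(1)] that(2) f(2) kf is_bisetD(1)[OF assms(1)] by metis
  have 2: "k (ract Y y g) = ract X (k y) g" if "y \<in> points Y" "g \<in> carrier G" for y g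
    using ex[OF that(1)] that(2) f(3) kf is_bisetD(4)[OF assms(1)] by metis
  show ?thesis unfolding biset_isomorphic_def using k 1 2 by (intro exI[of _ k]) auto
qed

lemma fin_free_biset_transport:
  assumes X: "fin_free_biset G H X" and bij: "bij_betw f (points X) (points Y)"
    and l: "\<And>x h. x \<in> points X \<Longrightarrow> h \<in> carrier H \<Longrightarrow> f (lact X h x) = lact Y h (f x)"
    and r: "\<And>x g. x \<in> points X \<Longrightarrow> g \<in> carrier G \<Longrightarrow> f (ract X x g) = ract Y (f x) g"
    and grp: "group G" "group H"
  shows "fin_free_biset G H Y"
proof -
  interpret G: group G by fact
  interpret H: group H by fact
  have im: "points Y = f ` points X" and inj: "inj_on f (points X)" using bij by (auto simp: bij_betw_def)
  note b = is_bisetD[OF fin_free_bisetD(1)[OF X]]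
  have 1: "is_biset G H Y" unfolding is_biset_def im
    using b
    by (simp add: l[symmetric] r[symmetric])
  have "h = \<one>\<^bsub>H\<^esub>" if y: "y \<in> points Y" and "h \<in> carrier H" "lact Y h y = y" for y h
  proof -
    obtain x where x: "x \<in> points X" "y = f x" using y im by auto
    then have "f (lact X h x) = f x" using l that by simp
    then have "lact X h x = x" using inj x b(1) that by (meson inj_onD)
    then show ?thesis using fin_free_bisetD(3)[OF X] x that by blast
  qed
  then show ?thesis using 1 fin_free_bisetD(2)[OF X] im unfolding fin_free_biset_def by auto
qed

text \<open>Isomorphism classes collect only bisets on natural numbers, so this is what makes the
  class of a biset on any other type nonempty. The points are numbered and both actions are
  transported.\<close>

lemma ex_nat_biset:
  fixes X :: "('g, 'h, 'x) biset"
  assumes X: "fin_free_biset G H X" and grp: "group G" "group H"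
  shows "\<exists>Y :: ('g, 'h, nat) biset. fin_free_biset G H Y \<and> biset_isomorphic G H X Y"
proof -
  obtain f :: "'x \<Rightarrow> nat" where f: "bij_betw f (points X) {0..<card (points X)}"
    using ex_bij_betw_finite_nat[OF fin_free_bisetD(2)[OF X]] by blast
  define k where "k = inv_into (points X) f"
  have kf: "k (f x) = x" if "x \<in> points X" for x
    unfolding k_def using f that by (simp add: bij_betw_def)
  define Y :: "('g, 'h, nat) biset" where "Y = \<lparr>points = f ` points X,
    lact = (\<lambda>h y. f (lact X h (k y))), ract = (\<lambda>y g. f (ract X (k y) g))\<rparr>"
  have bij: "bij_betw f (points X) (points Y)" using f by (auto simp: Y_def bij_betw_def)
  have l: "f (lact X h x) = lact Y h (f x)" if "x \<in> points X" for x h using that by (simp add: Y_def kf)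
  have r: "f (ract X x g) = ract Y (f x) g" if "x \<in> points X" for x g using that by (simp add: Y_def kf)
  show ?thesis
    using fin_free_biset_transport[OF X bij l r grp] bij l r unfolding biset_isomorphic_def by blast
qed

lemma iso_class_eq:
  assumes "is_biset G H X" "biset_isomorphic G H X Y"
  shows "iso_class G H X = iso_class G H Y"
  using biset_isomorphic_trans[OF biset_isomorphic_sym[OF assms]] biset_isomorphic_trans[OF assms(2)]
  unfolding iso_class_def by blast

lemma iso_class_in_iso_classes:
  assumes "fin_free_biset G H X" "group G" "group H"
  shows "iso_class G H X \<in> iso_classes G H"
proof -
  obtain Y :: "('a, 'c, nat) biset" where "fin_free_biset G H Y" "biset_isomorphic G H X Y"
    using ex_nat_biset[OF assms] by blast
  then show ?thesis unfolding iso_classes_def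
    using iso_class_eq[OF fin_free_bisetD(1)[OF assms(1)]] by blast
qed

lemma card_fixpts_iso:
  assumes "biset_isomorphic G H X Y" "is_biset G H X"
    and "\<alpha> \<in> P \<rightarrow> carrier G" "\<beta> \<in> P \<rightarrow> carrier H"
  shows "card (fixpts X P \<alpha> \<beta>) = card (fixpts Y P \<alpha> \<beta>)"
proof -
  obtain f where f: "bij_betw f (points X) (points Y)"
    "\<And>x h. x \<in> points X \<Longrightarrow> h \<in> carrier H \<Longrightarrow> f (lact X h x) = lact Y h (f x)"
    "\<And>x g. x \<in> points X \<Longrightarrow> g \<in> carrier G \<Longrightarrow> f (ract X x g) = ract Y (f x) g"
    using assms unfolding biset_isomorphic_def by blast
  have inj: "inj_on f (points X)" and im: "points Y = f ` points X" using f(1) by (auto simp: bij_betw_def)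
  have fix_iff: "f x \<in> fixpts Y P \<alpha> \<beta> \<longleftrightarrow> x \<in> fixpts X P \<alpha> \<beta>" if x: "x \<in> points X" for x
  proof -
    have "(ract Y (f x) (\<alpha> q) = lact Y (\<beta> q) (f x)) = (ract X x (\<alpha> q) = lact X (\<beta> q) x)" if "q \<in> P" for q
    proof -
      have "\<alpha> q \<in> carrier G" "\<beta> q \<in> carrier H" using assms(3,4) that by auto
      then show ?thesis
        using f(2)[OF x, of "\<beta> q"] f(3)[OF x, of "\<alpha> q"] inj is_bisetD(1,4)[OF assms(2) x]
        by (metis inj_on_eq_iff)
    qed
    then show ?thesis using x im by (auto simp: fixpts_def)
  qed
  have "fixpts Y P \<alpha> \<beta> = f ` fixpts X P \<alpha> \<beta>"
  proof -
    have "y \<in> f ` fixpts X P \<alpha> \<beta>" if "y \<in> fixpts Y P \<alpha> \<beta>" for y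
      using that fix_iff im by (auto simp: fixpts_def image_iff)
    moreover have "f x \<in> fixpts Y P \<alpha> \<beta>" if "x \<in> fixpts X P \<alpha> \<beta>" for x
      using fix_iff[of x] that by (auto simp: fixpts_def)
    ultimately show ?thesis by auto
  qed
  moreover have "inj_on f (fixpts X P \<alpha> \<beta>)" using inj by (rule inj_on_subset) (auto simp: fixpts_def)
  ultimately show ?thesis by (simp add: card_image)
qed

lemma fin_free_biset_sum:
  assumes "fin_free_biset G H X" "fin_free_biset G H Y"
  shows "fin_free_biset G H (biset_sum X Y)"
  using assms unfolding fin_free_biset_def is_biset_def biset_sum_def by auto

lemma card_fixpts_sum:
  assumes "finite (points X)" "finite (points Y)"
  shows "card (fixpts (biset_sum X Y) P \<alpha> \<beta>) = card (fixpts X P \<alpha> \<beta>) + card (fixpts Y P \<alpha> \<beta>)"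
proof -
  have "fixpts (biset_sum X Y) P \<alpha> \<beta> = fixpts X P \<alpha> \<beta> <+> fixpts Y P \<alpha> \<beta>"
    by (auto simp: fixpts_def biset_sum_def)
  moreover have "finite (fixpts X P \<alpha> \<beta>)" "finite (fixpts Y P \<alpha> \<beta>)"
    using assms by (auto simp: fixpts_def)
  ultimately show ?thesis by (simp add: card_Plus)
qed

subsection \<open>Products\<close>

lemma card_quotient_classes:
  assumes "equiv A r" "finite A" "\<And>a. a \<in> A \<Longrightarrow> card (r `` {a}) = n"
  shows "card {a \<in> A. Q (r `` {a})} = n * card {C \<in> A // r. Q C}"
proof -
  let ?C = "{C \<in> A // r. Q C}"
  have U: "{a \<in> A. Q (r `` {a})} = \<Union> ?C"
  proof
    show "{a \<in> A. Q (r `` {a})} \<subseteq> \<Union> ?C"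
      using assms(1) by (auto intro!: quotientI dest: equiv_class_self)
    show "\<Union> ?C \<subseteq> {a \<in> A. Q (r `` {a})}"
    proof
      fix a assume "a \<in> \<Union> ?C"
      then obtain C where C: "C \<in> A // r" "Q C" "a \<in> C" by auto
      then have "a \<in> A" using in_quotient_imp_subset[OF assms(1) C(1)] by auto
      moreover have "C = r `` {a}" using C assms(1)
        by (metis Image_singleton_iff equiv_class_eq_iff quotientE)
      ultimately show "a \<in> {a \<in> A. Q (r `` {a})}" using C by auto
    qed
  qed
  have fin: "finite (A // r)" using assms(1,2) by (simp add: finite_quotient equiv_def refl_on_def)
  have c: "card C = n" if "C \<in> A // r" for C using that assms(3) by (auto elim: quotientE)
  have "n * card ?C = card (\<Union> ?C)"
  proof (rule card_partition)
    show "finite ?C" using fin by simp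
    show "finite (\<Union> ?C)" unfolding U[symmetric] using assms(2) by simp
    show "card C = n" if "C \<in> ?C" for C using c that by simp
    show "c1 \<inter> c2 = {}" if "c1 \<in> ?C" "c2 \<in> ?C" "c1 \<noteq> c2" for c1 c2
      using that quotient_disj[OF assms(1)] by auto
  qed
  then show ?thesis using U by simp
qed

definition prod_rel :: "('h, 'm) monoid_scheme \<Rightarrow> ('h, 'k, 'x) biset \<Rightarrow> ('g, 'h, 'y) biset \<Rightarrow> ('x \<times> 'y) rel"
  where "prod_rel H X Y =
    {((ract X x h, y), (x, lact Y h y)) | x h y. x \<in> points X \<and> h \<in> carrier H \<and> y \<in> points Y}"

text \<open>The tensor x \<otimes> y of a point of X and a point of Y.\<close>

definition pair_cls :: "('h, 'm) monoid_scheme \<Rightarrow> ('h, 'k, 'x) biset \<Rightarrow> ('g, 'h, 'y) biset \<Rightarrow>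
    'x \<Rightarrow> 'y \<Rightarrow> ('x \<times> 'y) set"
  where "pair_cls H X Y x y = prod_rel H X Y `` {(x, y)}"

locale biset_product =
  fixes G :: "('g, 'm) monoid_scheme" and H :: "('h, 'n) monoid_scheme" and K :: "('k, 'l) monoid_scheme"
    and X :: "('h, 'k, 'x) biset" and Y :: "('g, 'h, 'y) biset"
  assumes grpG: "group G" and grpH: "group H" and grpK: "group K"
    and X: "fin_free_biset H K X" and Y: "fin_free_biset G H Y" and finH: "finite (carrier H)"
begin

interpretation G: group G by (rule grpG)
interpretation H: group H by (rule grpH)
interpretation K: group K by (rule grpK)

lemmas bX = is_bisetD[OF fin_free_bisetD(1)[OF X]]
lemmas bY = is_bisetD[OF fin_free_bisetD(1)[OF Y]]
lemmas fX = fin_free_bisetD[OF X]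
lemmas fY = fin_free_bisetD[OF Y]

lemma prod_rel_iff:
  "((x, y), (x', y')) \<in> prod_rel H X Y \<longleftrightarrow>
    x' \<in> points X \<and> y \<in> points Y \<and> (\<exists>h\<in>carrier H. x = ract X x' h \<and> y' = lact Y h y)"
  unfolding prod_rel_def by auto

lemma equiv_prod_rel: "equiv (points X \<times> points Y) (prod_rel H X Y)"
proof (rule equivI)
  show "prod_rel H X Y \<subseteq> (points X \<times> points Y) \<times> (points X \<times> points Y)"
    unfolding prod_rel_def by (auto simp: bX bY)
  show "refl_on (points X \<times> points Y) (prod_rel H X Y)"
    by (rule refl_onI) (auto simp: prod_rel_iff bX bY intro!: bexI[of _ "\<one>\<^bsub>H\<^esub>"])
  show "sym (prod_rel H X Y)"
  proof (rule symI, clarify)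
    fix x y x' y' assume "((x, y), x', y') \<in> prod_rel H X Y"
    then obtain h where h: "x' \<in> points X" "y \<in> points Y" "h \<in> carrier H" "x = ract X x' h" "y' = lact Y h y"
      by (auto simp: prod_rel_iff)
    then show "((x', y'), x, y) \<in> prod_rel H X Y"
      using ract_inv_cancel[OF grpH fX(1)] lact_inv_cancel[OF grpH fY(1)]
      by (auto simp: prod_rel_iff bX bY intro!: bexI[of _ "inv\<^bsub>H\<^esub> h"])
  qed
  show "trans (prod_rel H X Y)"
  proof (rule transI, clarify)
    fix x y x' y' x'' y''
    assume "((x, y), x', y') \<in> prod_rel H X Y" "((x', y'), x'', y'') \<in> prod_rel H X Y"
    then obtain h k where h: "y \<in> points Y" "h \<in> carrier H" "x = ract X x' h" "y' = lact Y h y"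
      and k: "x'' \<in> points X" "k \<in> carrier H" "x' = ract X x'' k" "y'' = lact Y k y'"
      by (auto simp: prod_rel_iff)
    then show "((x, y), x'', y'') \<in> prod_rel H X Y"
      by (auto simp: prod_rel_iff bX bY intro!: bexI[of _ "k \<otimes>\<^bsub>H\<^esub> h"])
  qed
qed

lemma points_prod: "points (biset_prod H X Y) = (points X \<times> points Y) // prod_rel H X Y"
  unfolding biset_prod_def prod_rel_def by simp

lemma pair_cls_in: "x \<in> points X \<Longrightarrow> y \<in> points Y \<Longrightarrow> pair_cls H X Y x y \<in> points (biset_prod H X Y)"
  unfolding points_prod pair_cls_def by (auto intro: quotientI)

lemma points_prodE:
  assumes "C \<in> points (biset_prod H X Y)"
  obtains x y where "x \<in> points X" "y \<in> points Y" "C = pair_cls H X Y x y"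
  using assms unfolding points_prod pair_cls_def by (auto elim!: quotientE)

lemma pair_cls_eq_iff:
  assumes "x \<in> points X" "y \<in> points Y" "x' \<in> points X" "y' \<in> points Y"
  shows "pair_cls H X Y x y = pair_cls H X Y x' y' \<longleftrightarrow> (\<exists>h\<in>carrier H. x = ract X x' h \<and> y' = lact Y h y)"
  unfolding pair_cls_def
  using eq_equiv_class_iff[OF equiv_prod_rel, of "(x, y)" "(x', y')"] assms by (auto simp: prod_rel_iff)

lemma mem_pair_cls:
  "(a, b) \<in> pair_cls H X Y x y \<longleftrightarrow> a \<in> points X \<and> y \<in> points Y \<and> (\<exists>h\<in>carrier H. x = ract X a h \<and> b = lact Y h y)"
  unfolding pair_cls_def by (auto simp: prod_rel_iff)

lemma pair_cls_explicit:
  assumes "x \<in> points X" "y \<in> points Y"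
  shows "pair_cls H X Y x y = (\<lambda>h. (ract X x (inv\<^bsub>H\<^esub> h), lact Y h y)) ` carrier H"
proof -
  have "(a, b) \<in> pair_cls H X Y x y \<longleftrightarrow> (a, b) \<in> (\<lambda>h. (ract X x (inv\<^bsub>H\<^esub> h), lact Y h y)) ` carrier H" for a b
  proof
    assume "(a, b) \<in> pair_cls H X Y x y"
    then obtain h where "a \<in> points X" "h \<in> carrier H" "x = ract X a h" "b = lact Y h y"
      by (auto simp: mem_pair_cls)
    then show "(a, b) \<in> (\<lambda>h. (ract X x (inv\<^bsub>H\<^esub> h), lact Y h y)) ` carrier H"
      using ract_inv_cancel[OF grpH fX(1)] by (auto intro!: image_eqI[of _ _ h])
  next
    assume "(a, b) \<in> (\<lambda>h. (ract X x (inv\<^bsub>H\<^esub> h), lact Y h y)) ` carrier H"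
    then obtain h where "h \<in> carrier H" "a = ract X x (inv\<^bsub>H\<^esub> h)" "b = lact Y h y" by auto
    then show "(a, b) \<in> pair_cls H X Y x y"
      using assms ract_inv_cancel[OF grpH fX(1)] by (auto simp: mem_pair_cls bX intro!: bexI[of _ h])
  qed
  then show ?thesis by auto
qed

text \<open>The class is parametrized by h -> (x h^-1, h y), and freeness on Y makes already the
  second coordinate injective in h.\<close>

lemma card_pair_cls:
  assumes "x \<in> points X" "y \<in> points Y"
  shows "card (pair_cls H X Y x y) = card (carrier H)"
  unfolding pair_cls_explicit[OF assms]
  by (rule card_image) (auto simp: inj_on_def intro: lact_inj[OF grpH Y assms(2)])

lemma lact_pair_cls:
  assumes "x \<in> points X" "y \<in> points Y" "k \<in> carrier K"
  shows "lact (biset_prod H X Y) k (pair_cls H X Y x y) = pair_cls H X Y (lact X k x) y"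
  using assms bX(1)[OF assms(1,3)]
  by (simp add: biset_prod_def pair_cls_explicit image_image bX)

lemma ract_pair_cls:
  assumes "x \<in> points X" "y \<in> points Y" "g \<in> carrier G"
  shows "ract (biset_prod H X Y) (pair_cls H X Y x y) g = pair_cls H X Y x (ract Y y g)"
  using assms bY(4)[OF assms(2,3)]
  by (simp add: biset_prod_def pair_cls_explicit image_image bY)

text \<open>Freeness passes to the product in two stages: if k fixes x \<otimes> y, then k x = x h
  and y = h y for some h; freeness on Y gives h = 1, and then freeness on X gives k = 1.\<close>

lemma fin_free_biset_prod: "fin_free_biset G K (biset_prod H X Y)"
proof -
  have fin: "finite (points (biset_prod H X Y))"
    unfolding points_prod using equiv_prod_rel fX(2) fY(2)
    by (intro finite_quotient) (auto simp: equiv_def)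
  have "is_biset G K (biset_prod H X Y)"
    unfolding is_biset_def
  proof (rule ballI)
    fix C assume "C \<in> points (biset_prod H X Y)"
    then obtain x y where [simp]: "x \<in> points X" "y \<in> points Y" "C = pair_cls H X Y x y"
      by (rule points_prodE)
    show "(\<forall>h\<in>carrier K. lact (biset_prod H X Y) h C \<in> points (biset_prod H X Y)) \<and>
      lact (biset_prod H X Y) \<one>\<^bsub>K\<^esub> C = C \<and>
      (\<forall>h\<in>carrier K. \<forall>h'\<in>carrier K. lact (biset_prod H X Y) (h \<otimes>\<^bsub>K\<^esub> h') C =
         lact (biset_prod H X Y) h (lact (biset_prod H X Y) h' C)) \<and>
      (\<forall>g\<in>carrier G. ract (biset_prod H X Y) C g \<in> points (biset_prod H X Y)) \<and>
      ract (biset_prod H X Y) C \<one>\<^bsub>G\<^esub> = C \<and>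
      (\<forall>g\<in>carrier G. \<forall>g'\<in>carrier G. ract (biset_prod H X Y) C (g \<otimes>\<^bsub>G\<^esub> g') =
        ract (biset_prod H X Y) (ract (biset_prod H X Y) C g) g') \<and>
      (\<forall>h\<in>carrier K. \<forall>g\<in>carrier G. ract (biset_prod H X Y) (lact (biset_prod H X Y) h C) g =
        lact (biset_prod H X Y) h (ract (biset_prod H X Y) C g))"
      by (simp add: lact_pair_cls ract_pair_cls bX bY pair_cls_in)
  qed
  moreover have "k = \<one>\<^bsub>K\<^esub>" if C: "C \<in> points (biset_prod H X Y)" and k: "k \<in> carrier K"
    and e: "lact (biset_prod H X Y) k C = C" for C k
  proof -
    obtain x y where xy: "x \<in> points X" "y \<in> points Y" "C = pair_cls H X Y x y"
      using C by (rule points_prodE)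
    then have "pair_cls H X Y (lact X k x) y = pair_cls H X Y x y" using e k by (simp add: lact_pair_cls)
    then obtain h where h: "h \<in> carrier H" "lact X k x = ract X x h" "y = lact Y h y"
      using pair_cls_eq_iff[of "lact X k x" y x y] xy k by (auto simp: bX)
    then have "h = \<one>\<^bsub>H\<^esub>" using fY(3)[OF xy(2)] by simp
    then have "lact X k x = x" using h bX(5)[OF xy(1)] by simp
    then show ?thesis using fX(3)[OF xy(1) k] by simp
  qed
  ultimately show ?thesis using fin unfolding fin_free_biset_def by blast
qed

end

section \<open>Fixed points of a product, counted on pairs\<close>

definition pairset :: "('h, 'm) monoid_scheme \<Rightarrow> ('h, 'k, 'x) biset \<Rightarrow> ('g, 'h, 'y) biset \<Rightarrow>
    'q set \<Rightarrow> ('q \<Rightarrow> 'g) \<Rightarrow> ('q \<Rightarrow> 'k) \<Rightarrow> ('x \<times> 'y) set"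
  where "pairset H X Y P \<alpha> \<beta> = {(x, y). x \<in> points X \<and> y \<in> points Y \<and>
    (\<forall>q\<in>P. \<exists>h\<in>carrier H. ract Y y (\<alpha> q) = lact Y h y \<and> ract X x h = lact X (\<beta> q) x)}"

context biset_product
begin

lemma pair_cls_fixed_iff:
  assumes "x \<in> points X" "y \<in> points Y" "\<alpha> \<in> P \<rightarrow> carrier G" "\<beta> \<in> P \<rightarrow> carrier K"
  shows "pair_cls H X Y x y \<in> fixpts (biset_prod H X Y) P \<alpha> \<beta> \<longleftrightarrow> (x, y) \<in> pairset H X Y P \<alpha> \<beta>"
proof -
  interpret H: group H by (rule grpH)
  have "ract (biset_prod H X Y) (pair_cls H X Y x y) (\<alpha> q) = lact (biset_prod H X Y) (\<beta> q) (pair_cls H X Y x y)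
    \<longleftrightarrow> (\<exists>h\<in>carrier H. ract Y y (\<alpha> q) = lact Y h y \<and> ract X x h = lact X (\<beta> q) x)" if "q \<in> P" for q
  proof -
    have q: "\<alpha> q \<in> carrier G" "\<beta> q \<in> carrier K" using assms that by auto
    have 1: "ract Y y (\<alpha> q) \<in> points Y" "lact X (\<beta> q) x \<in> points X" using q assms bX bY by auto
    have "ract (biset_prod H X Y) (pair_cls H X Y x y) (\<alpha> q) = lact (biset_prod H X Y) (\<beta> q) (pair_cls H X Y x y)
      \<longleftrightarrow> pair_cls H X Y (lact X (\<beta> q) x) y = pair_cls H X Y x (ract Y y (\<alpha> q))"
      using q assms by (auto simp: lact_pair_cls ract_pair_cls)
    also have "\<dots> \<longleftrightarrow> (\<exists>h\<in>carrier H. lact X (\<beta> q) x = ract X x h \<and> ract Y y (\<alpha> q) = lact Y h y)"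
      using pair_cls_eq_iff 1 assms by blast
    finally show ?thesis by metis
  qed
  then show ?thesis using assms pair_cls_in by (simp add: fixpts_def pairset_def)
qed

text \<open>Being fixed is a property of the class, and each class consists of |H| pairs. Up to this
  factor the count takes place on plain pairs, where it can be organized by fibres over either
  coordinate.\<close>

lemma card_fixpts_prod:
  assumes "\<alpha> \<in> P \<rightarrow> carrier G" "\<beta> \<in> P \<rightarrow> carrier K"
  shows "card (pairset H X Y P \<alpha> \<beta>) = card (carrier H) * card (fixpts (biset_prod H X Y) P \<alpha> \<beta>)"
proof -
  let ?Q = "\<lambda>C. C \<in> fixpts (biset_prod H X Y) P \<alpha> \<beta>"
  have "card {a \<in> points X \<times> points Y. ?Q (prod_rel H X Y `` {a})} =
      card (carrier H) * card {C \<in> (points X \<times> points Y) // prod_rel H X Y. ?Q C}"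
    using card_pair_cls fX(2) fY(2)
    by (intro card_quotient_classes equiv_prod_rel) (auto simp: pair_cls_def)
  moreover have "{C \<in> (points X \<times> points Y) // prod_rel H X Y. ?Q C} = fixpts (biset_prod H X Y) P \<alpha> \<beta>"
    by (auto simp: fixpts_def points_prod[symmetric])
  moreover have "{a \<in> points X \<times> points Y. ?Q (prod_rel H X Y `` {a})} = pairset H X Y P \<alpha> \<beta>"
    using pair_cls_fixed_iff[OF _ _ assms] by (auto simp: pair_cls_def pairset_def)
  ultimately show ?thesis by simp
qed

end

lemma biset_prod_iso:
  assumes "biset_product G H K X Y" "biset_product G H K X' Y'"
    and "biset_isomorphic H K X X'" "biset_isomorphic G H Y Y'"
  shows "biset_isomorphic G K (biset_prod H X Y) (biset_prod H X' Y')"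
proof -
  interpret A: biset_product G H K X Y by fact
  interpret B: biset_product G H K X' Y' by fact
  interpret H: group H by (rule A.grpH)
  obtain f where f: "bij_betw f (points X) (points X')"
    "\<And>x h. x \<in> points X \<Longrightarrow> h \<in> carrier K \<Longrightarrow> f (lact X h x) = lact X' h (f x)"
    "\<And>x g. x \<in> points X \<Longrightarrow> g \<in> carrier H \<Longrightarrow> f (ract X x g) = ract X' (f x) g"
    using assms(3) unfolding biset_isomorphic_def by blast
  obtain k where k: "bij_betw k (points Y) (points Y')"
    "\<And>x h. x \<in> points Y \<Longrightarrow> h \<in> carrier H \<Longrightarrow> k (lact Y h x) = lact Y' h (k x)"
    "\<And>x g. x \<in> points Y \<Longrightarrow> g \<in> carrier G \<Longrightarrow> k (ract Y x g) = ract Y' (k x) g"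
    using assms(4) unfolding biset_isomorphic_def by blast
  have fi: "inj_on f (points X)" "points X' = f ` points X" and ki: "inj_on k (points Y)" "points Y' = k ` points Y"
    using f(1) k(1) by (auto simp: bij_betw_def)
  \<comment> \<open>Taking images of classes as sets of pairs avoids a choice of
    representatives.\<close>
  define \<Theta> where "\<Theta> C = (\<lambda>(x, y). (f x, k y)) ` C" for C
  have \<Theta>: "\<Theta> (pair_cls H X Y x y) = pair_cls H X' Y' (f x) (k y)" if "x \<in> points X" "y \<in> points Y" for x y
    using that fi ki by (simp add: \<Theta>_def A.pair_cls_explicit B.pair_cls_explicit image_image f k)
  have "inj_on \<Theta> (points (biset_prod H X Y))"
  proof (rule inj_onI)
    fix C D assume C: "C \<in> points (biset_prod H X Y)" and D: "D \<in> points (biset_prod H X Y)" and e: "\<Theta> C = \<Theta> D"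
    obtain x y where xy: "x \<in> points X" "y \<in> points Y" "C = pair_cls H X Y x y"
      using C by (rule A.points_prodE)
    obtain x' y' where xy': "x' \<in> points X" "y' \<in> points Y" "D = pair_cls H X Y x' y'"
      using D by (rule A.points_prodE)
    have "pair_cls H X' Y' (f x) (k y) = pair_cls H X' Y' (f x') (k y')" using e \<Theta> xy xy' by simp
    then obtain h where h: "h \<in> carrier H" "f x = ract X' (f x') h" "k y' = lact Y' h (k y)"
      using B.pair_cls_eq_iff[of "f x" "k y" "f x'" "k y'"] xy xy' fi(2) ki(2) by auto
    have "x = ract X x' h" using h xy xy' f(3) fi(1) A.bX(4) by (metis inj_onD)
    moreover have "y' = lact Y h y" using h xy xy' k(2) ki(1) A.bY(1) by (metis inj_onD)
    ultimately show "C = D" using A.pair_cls_eq_iff[of x y x' y'] h(1) xy xy' by blast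
  qed
  moreover have "\<Theta> ` points (biset_prod H X Y) = points (biset_prod H X' Y')"
  proof -
    have "\<Theta> C \<in> points (biset_prod H X' Y')" if C: "C \<in> points (biset_prod H X Y)" for C
    proof -
      obtain x y where xy: "x \<in> points X" "y \<in> points Y" "C = pair_cls H X Y x y"
        using C by (rule A.points_prodE)
      then show ?thesis using \<Theta> B.pair_cls_in fi ki by simp
    qed
    moreover have "D \<in> \<Theta> ` points (biset_prod H X Y)" if D: "D \<in> points (biset_prod H X' Y')" for D
    proof -
      obtain x' y' where xy': "x' \<in> points X'" "y' \<in> points Y'" "D = pair_cls H X' Y' x' y'"
        using D by (rule B.points_prodE)
      then obtain x y where "x \<in> points X" "y \<in> points Y" "x' = f x" "y' = k y" using fi ki by auto
      then show ?thesis using \<Theta> xy'(3) A.pair_cls_in by (metis imageI)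
    qed
    ultimately show ?thesis by auto
  qed
  moreover have "\<Theta> (lact (biset_prod H X Y) u C) = lact (biset_prod H X' Y') u (\<Theta> C)"
    if C: "C \<in> points (biset_prod H X Y)" and u: "u \<in> carrier K" for C u
  proof -
    obtain x y where xy: "x \<in> points X" "y \<in> points Y" "C = pair_cls H X Y x y"
      using C by (rule A.points_prodE)
    then show ?thesis using u fi ki by (simp add: \<Theta> A.lact_pair_cls B.lact_pair_cls A.bX f)
  qed
  moreover have "\<Theta> (ract (biset_prod H X Y) C u) = ract (biset_prod H X' Y') (\<Theta> C) u"
    if C: "C \<in> points (biset_prod H X Y)" and u: "u \<in> carrier G" for C u
  proof -
    obtain x y where xy: "x \<in> points X" "y \<in> points Y" "C = pair_cls H X Y x y"
      using C by (rule A.points_prodE)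
    then show ?thesis using u fi ki by (simp add: \<Theta> A.ract_pair_cls B.ract_pair_cls A.bY k)
  qed
  ultimately show ?thesis unfolding biset_isomorphic_def bij_betw_def by (intro exI[of _ \<Theta>]) simp
qed

text \<open>Once y carries \<open>\<eta>\<close>, freeness forces the element h in
  \<open>pairset\<close> to be \<eta>(q). The fibre over y is then a fixed point set of X alone,
  with the right action pulled back along \<open>\<eta>\<close>.\<close>

lemma pairset_fibre:
  assumes "group H" "fin_free_biset G H Y" "x \<in> points X" "y \<in> points Y"
    and "\<And>q. q \<in> P \<Longrightarrow> \<eta> q \<in> carrier H" "\<And>q. q \<in> P \<Longrightarrow> ract Y y (\<alpha> q) = lact Y (\<eta> q) y"
  shows "(x, y) \<in> pairset H X Y P \<alpha> \<beta> \<longleftrightarrow> x \<in> fixpts X P \<eta> \<beta>"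
proof -
  have "(\<exists>h\<in>carrier H. ract Y y (\<alpha> q) = lact Y h y \<and> ract X x h = lact X (\<beta> q) x) \<longleftrightarrow>
    ract X x (\<eta> q) = lact X (\<beta> q) x" if "q \<in> P" for q
    using lact_inj[OF assms(1,2,4)] assms(5,6)[OF that] by metis
  then show ?thesis using assms(3,4) by (simp add: pairset_def fixpts_def)
qed

text \<open>Right translation by g is the bijection. The points of a transitive biset carry
  conjugates of one homomorphism, and this lemma removes the conjugation from the fibres in the
  first factor of a product.\<close>

lemma card_fixpts_conj_right:
  assumes "group G" "is_biset G H X" "\<eta> \<in> P \<rightarrow> carrier G" "\<beta> \<in> P \<rightarrow> carrier H" "g \<in> carrier G"
  shows "card (fixpts X P (\<lambda>q. g \<otimes>\<^bsub>G\<^esub> \<eta> q \<otimes>\<^bsub>G\<^esub> inv\<^bsub>G\<^esub> g) \<beta>) = card (fixpts X P \<eta> \<beta>)"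
proof -
  interpret G: group G by fact
  note b = is_bisetD[OF assms(2)] and c = ract_inv_cancel[OF assms(1,2)]
  have "bij_betw (\<lambda>x. ract X x g) (fixpts X P (\<lambda>q. g \<otimes>\<^bsub>G\<^esub> \<eta> q \<otimes>\<^bsub>G\<^esub> inv\<^bsub>G\<^esub> g) \<beta>) (fixpts X P \<eta> \<beta>)"
  proof (rule bij_betw_byWitness[of _ "\<lambda>x. ract X x (inv\<^bsub>G\<^esub> g)"])
    show "(\<lambda>x. ract X x g) ` fixpts X P (\<lambda>q. g \<otimes>\<^bsub>G\<^esub> \<eta> q \<otimes>\<^bsub>G\<^esub> inv\<^bsub>G\<^esub> g) \<beta> \<subseteq> fixpts X P \<eta> \<beta>"
    proof clarsimp
      fix x assume x: "x \<in> fixpts X P (\<lambda>q. g \<otimes>\<^bsub>G\<^esub> \<eta> q \<otimes>\<^bsub>G\<^esub> inv\<^bsub>G\<^esub> g) \<beta>"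
      then have xp: "x \<in> points X" by (simp add: fixpts_def)
      have "ract X (ract X x g) (\<eta> q) = lact X (\<beta> q) (ract X x g)" if q: "q \<in> P" for q
      proof -
        have m: "\<eta> q \<in> carrier G" "\<beta> q \<in> carrier H" using assms q by auto
        have "ract X (ract X x g) (\<eta> q) = ract X x (g \<otimes>\<^bsub>G\<^esub> \<eta> q \<otimes>\<^bsub>G\<^esub> inv\<^bsub>G\<^esub> g \<otimes>\<^bsub>G\<^esub> g)"
          using b(6)[OF xp] m assms(5) by (simp add: G.m_assoc)
        also have "\<dots> = ract X (ract X x (g \<otimes>\<^bsub>G\<^esub> \<eta> q \<otimes>\<^bsub>G\<^esub> inv\<^bsub>G\<^esub> g)) g"
          using b(6)[OF xp] m assms(5) by simp
        also have "\<dots> = ract X (lact X (\<beta> q) x) g" using x q by (simp add: fixpts_def)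
        finally show ?thesis using b(7)[OF xp] m assms(5) by simp
      qed
      then show "ract X x g \<in> fixpts X P \<eta> \<beta>" using b(4)[OF xp assms(5)] by (simp add: fixpts_def)
    qed
    show "(\<lambda>x. ract X x (inv\<^bsub>G\<^esub> g)) ` fixpts X P \<eta> \<beta> \<subseteq> fixpts X P (\<lambda>q. g \<otimes>\<^bsub>G\<^esub> \<eta> q \<otimes>\<^bsub>G\<^esub> inv\<^bsub>G\<^esub> g) \<beta>"
    proof clarsimp
      fix x assume x: "x \<in> fixpts X P \<eta> \<beta>"
      then have xp: "x \<in> points X" by (simp add: fixpts_def)
      have "ract X (ract X x (inv\<^bsub>G\<^esub> g)) (g \<otimes>\<^bsub>G\<^esub> \<eta> q \<otimes>\<^bsub>G\<^esub> inv\<^bsub>G\<^esub> g) = lact X (\<beta> q) (ract X x (inv\<^bsub>G\<^esub> g))"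
        if q: "q \<in> P" for q
      proof -
        have m: "\<eta> q \<in> carrier G" "\<beta> q \<in> carrier H" using assms q by auto
        have "ract X (ract X x (inv\<^bsub>G\<^esub> g)) (g \<otimes>\<^bsub>G\<^esub> \<eta> q \<otimes>\<^bsub>G\<^esub> inv\<^bsub>G\<^esub> g)
            = ract X x (inv\<^bsub>G\<^esub> g \<otimes>\<^bsub>G\<^esub> (g \<otimes>\<^bsub>G\<^esub> \<eta> q \<otimes>\<^bsub>G\<^esub> inv\<^bsub>G\<^esub> g))"
          using b(6)[OF xp] m assms(5) by simp
        also have "\<dots> = ract X x (\<eta> q \<otimes>\<^bsub>G\<^esub> inv\<^bsub>G\<^esub> g)"
          using m assms(5) by (simp add: G.m_assoc[symmetric])
        also have "\<dots> = ract X (ract X x (\<eta> q)) (inv\<^bsub>G\<^esub> g)"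
          using b(6)[OF xp] m assms(5) by simp
        also have "\<dots> = ract X (lact X (\<beta> q) x) (inv\<^bsub>G\<^esub> g)" using x q by (simp add: fixpts_def)
        finally show ?thesis using b(7)[OF xp] m assms(5) by simp
      qed
      then show "ract X x (inv\<^bsub>G\<^esub> g) \<in> fixpts X P (\<lambda>q. g \<otimes>\<^bsub>G\<^esub> \<eta> q \<otimes>\<^bsub>G\<^esub> inv\<^bsub>G\<^esub> g) \<beta>"
        using b(4)[OF xp, of "inv\<^bsub>G\<^esub> g"] assms(5) by (simp add: fixpts_def)
    qed
  qed (auto simp: fixpts_def c assms(5))
  then show ?thesis by (rule bij_betw_same_card)
qed

text \<open>Left translation by h is the bijection; it serves the fibres in the second factor of a
  product.\<close>

lemma card_fixpts_conj_left:
  assumes "group H" "is_biset G H X" "\<alpha> \<in> P \<rightarrow> carrier G" "\<beta> \<in> P \<rightarrow> carrier H" "h \<in> carrier H"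
  shows "card (fixpts X P \<alpha> (\<lambda>q. h \<otimes>\<^bsub>H\<^esub> \<beta> q \<otimes>\<^bsub>H\<^esub> inv\<^bsub>H\<^esub> h)) = card (fixpts X P \<alpha> \<beta>)"
proof -
  interpret H: group H by fact
  note b = is_bisetD[OF assms(2)] and c = lact_inv_cancel[OF assms(1,2)]
  have "bij_betw (lact X h) (fixpts X P \<alpha> \<beta>) (fixpts X P \<alpha> (\<lambda>q. h \<otimes>\<^bsub>H\<^esub> \<beta> q \<otimes>\<^bsub>H\<^esub> inv\<^bsub>H\<^esub> h))"
  proof (rule bij_betw_byWitness[of _ "lact X (inv\<^bsub>H\<^esub> h)"])
    show "lact X h ` fixpts X P \<alpha> \<beta> \<subseteq> fixpts X P \<alpha> (\<lambda>q. h \<otimes>\<^bsub>H\<^esub> \<beta> q \<otimes>\<^bsub>H\<^esub> inv\<^bsub>H\<^esub> h)"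
    proof clarsimp
      fix x assume x: "x \<in> fixpts X P \<alpha> \<beta>"
      then have xp: "x \<in> points X" by (simp add: fixpts_def)
      have "ract X (lact X h x) (\<alpha> q) = lact X (h \<otimes>\<^bsub>H\<^esub> \<beta> q \<otimes>\<^bsub>H\<^esub> inv\<^bsub>H\<^esub> h) (lact X h x)" if q: "q \<in> P" for q
      proof -
        have m: "\<alpha> q \<in> carrier G" "\<beta> q \<in> carrier H" using assms q by auto
        have "ract X (lact X h x) (\<alpha> q) = lact X h (lact X (\<beta> q) x)"
          using b(7)[OF xp] m assms(5) x q by (simp add: fixpts_def)
        also have "\<dots> = lact X (h \<otimes>\<^bsub>H\<^esub> \<beta> q \<otimes>\<^bsub>H\<^esub> inv\<^bsub>H\<^esub> h \<otimes>\<^bsub>H\<^esub> h) x"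
          using b(3)[OF xp] m assms(5) by (simp add: H.m_assoc)
        also have "\<dots> = lact X (h \<otimes>\<^bsub>H\<^esub> \<beta> q \<otimes>\<^bsub>H\<^esub> inv\<^bsub>H\<^esub> h) (lact X h x)"
          using b(3)[OF xp, of "h \<otimes>\<^bsub>H\<^esub> \<beta> q \<otimes>\<^bsub>H\<^esub> inv\<^bsub>H\<^esub> h" h] m assms(5) by simp
        finally show ?thesis .
      qed
      then show "lact X h x \<in> fixpts X P \<alpha> (\<lambda>q. h \<otimes>\<^bsub>H\<^esub> \<beta> q \<otimes>\<^bsub>H\<^esub> inv\<^bsub>H\<^esub> h)"
        using b(1)[OF xp assms(5)] by (simp add: fixpts_def)
    qed
    show "lact X (inv\<^bsub>H\<^esub> h) ` fixpts X P \<alpha> (\<lambda>q. h \<otimes>\<^bsub>H\<^esub> \<beta> q \<otimes>\<^bsub>H\<^esub> inv\<^bsub>H\<^esub> h) \<subseteq> fixpts X P \<alpha> \<beta>"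
    proof clarsimp
      fix x assume x: "x \<in> fixpts X P \<alpha> (\<lambda>q. h \<otimes>\<^bsub>H\<^esub> \<beta> q \<otimes>\<^bsub>H\<^esub> inv\<^bsub>H\<^esub> h)"
      then have xp: "x \<in> points X" by (simp add: fixpts_def)
      have "ract X (lact X (inv\<^bsub>H\<^esub> h) x) (\<alpha> q) = lact X (\<beta> q) (lact X (inv\<^bsub>H\<^esub> h) x)" if q: "q \<in> P" for q
      proof -
        have m: "\<alpha> q \<in> carrier G" "\<beta> q \<in> carrier H" using assms q by auto
        have "ract X (lact X (inv\<^bsub>H\<^esub> h) x) (\<alpha> q) = lact X (inv\<^bsub>H\<^esub> h) (lact X (h \<otimes>\<^bsub>H\<^esub> \<beta> q \<otimes>\<^bsub>H\<^esub> inv\<^bsub>H\<^esub> h) x)"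
          using b(7)[OF xp] m assms(5) x q by (simp add: fixpts_def)
        also have "\<dots> = lact X (inv\<^bsub>H\<^esub> h \<otimes>\<^bsub>H\<^esub> (h \<otimes>\<^bsub>H\<^esub> \<beta> q \<otimes>\<^bsub>H\<^esub> inv\<^bsub>H\<^esub> h)) x"
          using b(3)[OF xp, of "inv\<^bsub>H\<^esub> h" "h \<otimes>\<^bsub>H\<^esub> \<beta> q \<otimes>\<^bsub>H\<^esub> inv\<^bsub>H\<^esub> h"] m assms(5) by simp
        also have "\<dots> = lact X (\<beta> q \<otimes>\<^bsub>H\<^esub> inv\<^bsub>H\<^esub> h) x"
          using m assms(5) by (simp add: H.m_assoc[symmetric])
        also have "\<dots> = lact X (\<beta> q) (lact X (inv\<^bsub>H\<^esub> h) x)"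
          using b(3)[OF xp] m assms(5) by simp
        finally show ?thesis .
      qed
      then show "lact X (inv\<^bsub>H\<^esub> h) x \<in> fixpts X P \<alpha> \<beta>"
        using b(1)[OF xp, of "inv\<^bsub>H\<^esub> h"] assms(5) by (simp add: fixpts_def)
    qed
  qed (auto simp: fixpts_def c assms(5))
  then show ?thesis by (rule bij_betw_same_card[symmetric])
qed

subsection \<open>Transitive bisets\<close>

text \<open>The group H with right action through \<open>\<phi>\<close>. Over K, the product of this
  biset with G itself, twisted by the identity, is H \<times>_{K,\<phi>} G, so the standard bisets
  inherit everything shown for products.\<close>

definition twisted_biset :: "('h, 'n) monoid_scheme \<Rightarrow> ('g \<Rightarrow> 'h) \<Rightarrow> ('g, 'h, 'h) biset"
  where "twisted_biset H \<phi> = \<lparr>points = carrier H, lact = (\<lambda>h x. h \<otimes>\<^bsub>H\<^esub> x), ract = (\<lambda>x k. x \<otimes>\<^bsub>H\<^esub> \<phi> k)\<rparr>"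

definition std_pt :: "('g, 'm) monoid_scheme \<Rightarrow> ('h, 'n) monoid_scheme \<Rightarrow> 'g set \<Rightarrow> ('g \<Rightarrow> 'h) \<Rightarrow>
    'h \<Rightarrow> 'g \<Rightarrow> ('h \<times> 'g) set"
  where "std_pt G H K \<phi> h g = pair_cls (sub_group G K) (twisted_biset H \<phi>) (twisted_biset G (\<lambda>x. x)) h g"

locale standard_biset =
  fixes G :: "('g, 'm) monoid_scheme" and H :: "('h, 'n) monoid_scheme" and K :: "'g set" and \<phi> :: "'g \<Rightarrow> 'h"
  assumes grpG: "group G" and grpH: "group H" and finG: "finite (carrier G)" and finH: "finite (carrier H)"
    and K: "subgroup K G" and \<phi>: "\<phi> \<in> hom (sub_group G K) H"
begin

interpretation G: group G by (rule grpG)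
interpretation H: group H by (rule grpH)

lemma K_sub: "k \<in> K \<Longrightarrow> k \<in> carrier G" using K by (rule subgroup.mem_carrier)
lemma \<phi>_closed: "k \<in> K \<Longrightarrow> \<phi> k \<in> carrier H" using \<phi> by (auto simp: hom_def)
lemma \<phi>_mult: "k \<in> K \<Longrightarrow> l \<in> K \<Longrightarrow> \<phi> (k \<otimes>\<^bsub>G\<^esub> l) = \<phi> k \<otimes>\<^bsub>H\<^esub> \<phi> l" using \<phi> by (auto simp: hom_def)
lemma grpK: "group (sub_group G K)" using K grpG by (rule subgroup.subgroup_is_group)
lemma \<phi>_one: "\<phi> \<one>\<^bsub>G\<^esub> = \<one>\<^bsub>H\<^esub>"
  using group_hom.hom_one[of "sub_group G K" H \<phi>] grpK grpH \<phi>
  by (simp add: group_hom_def group_hom_axioms_def)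
lemma \<phi>_inv: "k \<in> K \<Longrightarrow> \<phi> (inv\<^bsub>G\<^esub> k) = inv\<^bsub>H\<^esub> \<phi> k"
  using group_hom.hom_inv[of "sub_group G K" H \<phi> k] grpK grpH \<phi> K
  by (simp add: group_hom_def group_hom_axioms_def G.m_inv_consistent)
lemma finK: "finite K" using K finG subgroup.subset finite_subset by blast

sublocale P: biset_product G "sub_group G K" H "twisted_biset H \<phi>" "twisted_biset G (\<lambda>x. x)"
proof (rule biset_product.intro)
  show "fin_free_biset (sub_group G K) H (twisted_biset H \<phi>)"
    unfolding fin_free_biset_def is_biset_def twisted_biset_def
    using finH by (auto simp: \<phi>_closed \<phi>_mult \<phi>_one H.m_assoc)
  show "fin_free_biset G (sub_group G K) (twisted_biset G (\<lambda>x. x))"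
    unfolding fin_free_biset_def is_biset_def twisted_biset_def
    using finG by (auto simp: K_sub G.m_assoc)
qed (use grpK grpG grpH finK in simp_all)

text \<open>The two quotient relations list their generating pairs in opposite order. Both are the
  same relation because it is symmetric.\<close>

lemma std_biset_eq_prod:
  "std_biset G H K \<phi> = biset_prod (sub_group G K) (twisted_biset H \<phi>) (twisted_biset G (\<lambda>x. x))"
proof -
  have "{((h, k \<otimes>\<^bsub>G\<^esub> g), (h \<otimes>\<^bsub>H\<^esub> \<phi> k, g)) | h k g. h \<in> carrier H \<and> k \<in> K \<and> g \<in> carrier G} =
    (prod_rel (sub_group G K) (twisted_biset H \<phi>) (twisted_biset G (\<lambda>x. x)))\<inverse>"
    by (auto simp: prod_rel_def twisted_biset_def)
  also have "\<dots> = prod_rel (sub_group G K) (twisted_biset H \<phi>) (twisted_biset G (\<lambda>x. x))"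
    using P.equiv_prod_rel by (simp add: equiv_def sym_conv_converse_eq)
  finally have r: "{((h, k \<otimes>\<^bsub>G\<^esub> g), (h \<otimes>\<^bsub>H\<^esub> \<phi> k, g)) | h k g. h \<in> carrier H \<and> k \<in> K \<and> g \<in> carrier G} =
     prod_rel (sub_group G K) (twisted_biset H \<phi>) (twisted_biset G (\<lambda>x. x))" .
  show ?thesis unfolding std_biset_def r by (simp add: biset_prod_def prod_rel_def twisted_biset_def)
qed

lemma fin_free_std: "fin_free_biset G H (std_biset G H K \<phi>)"
  unfolding std_biset_eq_prod by (rule P.fin_free_biset_prod)

lemma std_pt_in: "h \<in> carrier H \<Longrightarrow> g \<in> carrier G \<Longrightarrow> std_pt G H K \<phi> h g \<in> points (std_biset G H K \<phi>)"
  unfolding std_biset_eq_prod std_pt_def by (rule P.pair_cls_in) (simp_all add: twisted_biset_def)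

lemma std_ptE:
  assumes "x \<in> points (std_biset G H K \<phi>)"
  obtains h g where "h \<in> carrier H" "g \<in> carrier G" "x = std_pt G H K \<phi> h g"
  using assms unfolding std_biset_eq_prod std_pt_def by (elim P.points_prodE) (simp add: twisted_biset_def)

lemma std_pt_eq_iff:
  assumes "h \<in> carrier H" "g \<in> carrier G" "h' \<in> carrier H" "g' \<in> carrier G"
  shows "std_pt G H K \<phi> h g = std_pt G H K \<phi> h' g' \<longleftrightarrow> (\<exists>k\<in>K. h = h' \<otimes>\<^bsub>H\<^esub> \<phi> k \<and> g' = k \<otimes>\<^bsub>G\<^esub> g)"
  using P.pair_cls_eq_iff[of h g h' g'] assms unfolding std_pt_def by (simp add: twisted_biset_def)

lemma mem_std_pt:
  assumes "h \<in> carrier H" "g \<in> carrier G"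
  shows "(a, b) \<in> std_pt G H K \<phi> h g \<longleftrightarrow> a \<in> carrier H \<and> (\<exists>k\<in>K. h = a \<otimes>\<^bsub>H\<^esub> \<phi> k \<and> b = k \<otimes>\<^bsub>G\<^esub> g)"
  using P.mem_pair_cls[of a b h g] assms unfolding std_pt_def by (simp add: twisted_biset_def)

lemma lact_std_pt:
  assumes "h \<in> carrier H" "g \<in> carrier G" "u \<in> carrier H"
  shows "lact (std_biset G H K \<phi>) u (std_pt G H K \<phi> h g) = std_pt G H K \<phi> (u \<otimes>\<^bsub>H\<^esub> h) g"
  using P.lact_pair_cls[of h g u] assms unfolding std_pt_def std_biset_eq_prod by (simp add: twisted_biset_def)

lemma ract_std_pt:
  assumes "h \<in> carrier H" "g \<in> carrier G" "u \<in> carrier G"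
  shows "ract (std_biset G H K \<phi>) (std_pt G H K \<phi> h g) u = std_pt G H K \<phi> h (g \<otimes>\<^bsub>G\<^esub> u)"
  using P.ract_pair_cls[of h g u] assms unfolding std_pt_def std_biset_eq_prod by (simp add: twisted_biset_def)

text \<open>Over the empty index set every pair and every point counts as fixed, so the count of
  pairs in a product gives the size.\<close>

lemma card_points_std: "card K * card (points (std_biset G H K \<phi>)) = card (carrier H) * card (carrier G)"
proof -
  have "pairset (sub_group G K) (twisted_biset H \<phi>) (twisted_biset G (\<lambda>x. x)) ({} :: 'g set) undefined undefined
    = carrier H \<times> carrier G" by (auto simp: pairset_def twisted_biset_def)
  then show ?thesis
    using P.card_fixpts_prod[of "undefined :: 'g \<Rightarrow> 'g" "{}" "undefined :: 'g \<Rightarrow> 'h"]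
    by (simp add: std_biset_eq_prod fixpts_def card_cartesian_product)
qed

text \<open>The stabilizer of the class of (h, g) in both groups is the graph of
  \<open>c_h \<phi> c_g\<close>, with c_x denoting conjugation by x, on the conjugate g^-1 K g.
  Marks of basis elements are read off from this.\<close>

lemma std_pt_ract_eq_lact_iff:
  assumes "h \<in> carrier H" "g \<in> carrier G" "u \<in> carrier G" "v \<in> carrier H"
  shows "ract (std_biset G H K \<phi>) (std_pt G H K \<phi> h g) u = lact (std_biset G H K \<phi>) v (std_pt G H K \<phi> h g) \<longleftrightarrow>
    g \<otimes>\<^bsub>G\<^esub> u \<otimes>\<^bsub>G\<^esub> inv\<^bsub>G\<^esub> g \<in> K \<and> v = h \<otimes>\<^bsub>H\<^esub> \<phi> (g \<otimes>\<^bsub>G\<^esub> u \<otimes>\<^bsub>G\<^esub> inv\<^bsub>G\<^esub> g) \<otimes>\<^bsub>H\<^esub> inv\<^bsub>H\<^esub> h"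
proof -
  have a: "v \<otimes>\<^bsub>H\<^esub> h = h \<otimes>\<^bsub>H\<^esub> \<phi> k \<longleftrightarrow> v = h \<otimes>\<^bsub>H\<^esub> \<phi> k \<otimes>\<^bsub>H\<^esub> inv\<^bsub>H\<^esub> h" if "k \<in> K" for k
    using assms \<phi>_closed[OF that] by (metis H.inv_solve_right H.m_closed)
  have b: "g \<otimes>\<^bsub>G\<^esub> u = k \<otimes>\<^bsub>G\<^esub> g \<longleftrightarrow> k = g \<otimes>\<^bsub>G\<^esub> u \<otimes>\<^bsub>G\<^esub> inv\<^bsub>G\<^esub> g" if "k \<in> K" for k
    using assms K_sub[OF that] by (metis G.inv_solve_right G.m_closed)
  have "ract (std_biset G H K \<phi>) (std_pt G H K \<phi> h g) u = lact (std_biset G H K \<phi>) v (std_pt G H K \<phi> h g) \<longleftrightarrow>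
     std_pt G H K \<phi> (v \<otimes>\<^bsub>H\<^esub> h) g = std_pt G H K \<phi> h (g \<otimes>\<^bsub>G\<^esub> u)"
    using assms by (auto simp: lact_std_pt ract_std_pt)
  also have "\<dots> \<longleftrightarrow> (\<exists>k\<in>K. v \<otimes>\<^bsub>H\<^esub> h = h \<otimes>\<^bsub>H\<^esub> \<phi> k \<and> g \<otimes>\<^bsub>G\<^esub> u = k \<otimes>\<^bsub>G\<^esub> g)"
    using assms by (intro std_pt_eq_iff) auto
  also have "\<dots> \<longleftrightarrow> g \<otimes>\<^bsub>G\<^esub> u \<otimes>\<^bsub>G\<^esub> inv\<^bsub>G\<^esub> g \<in> K \<and> v = h \<otimes>\<^bsub>H\<^esub> \<phi> (g \<otimes>\<^bsub>G\<^esub> u \<otimes>\<^bsub>G\<^esub> inv\<^bsub>G\<^esub> g) \<otimes>\<^bsub>H\<^esub> inv\<^bsub>H\<^esub> h"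
    using a b by metis
  finally show ?thesis .
qed

lemma std_pt_fixed_iff:
  assumes "h \<in> carrier H" "g \<in> carrier G" "\<alpha> \<in> P \<rightarrow> carrier G" "\<beta> \<in> P \<rightarrow> carrier H"
  shows "std_pt G H K \<phi> h g \<in> fixpts (std_biset G H K \<phi>) P \<alpha> \<beta> \<longleftrightarrow>
    (\<forall>q\<in>P. g \<otimes>\<^bsub>G\<^esub> \<alpha> q \<otimes>\<^bsub>G\<^esub> inv\<^bsub>G\<^esub> g \<in> K \<and>
      \<beta> q = h \<otimes>\<^bsub>H\<^esub> \<phi> (g \<otimes>\<^bsub>G\<^esub> \<alpha> q \<otimes>\<^bsub>G\<^esub> inv\<^bsub>G\<^esub> g) \<otimes>\<^bsub>H\<^esub> inv\<^bsub>H\<^esub> h)"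
  using assms std_pt_in std_pt_ract_eq_lact_iff[OF assms(1,2)] by (auto simp: fixpts_def Pi_iff)

end

section \<open>Orbits and stabilizers of bisets\<close>

definition orbit_stab :: "('g, 'm) monoid_scheme \<Rightarrow> ('h, 'n) monoid_scheme \<Rightarrow> ('g, 'h, 'x) biset \<Rightarrow> 'x \<Rightarrow> 'g set"
  where "orbit_stab G H X x = {g \<in> carrier G. \<exists>h\<in>carrier H. ract X x g = lact X h x}"

text \<open>By freeness x g = h x determines h from g, so the stabilizer of the left orbit of x
  comes with a function to H. Evaluating x (k l) in two ways and cancelling shows that this function
  is multiplicative.\<close>

lemma
  assumes "group G" "group H" "fin_free_biset G H X" "x \<in> points X"
  shows orbit_stab_subgroup: "subgroup (orbit_stab G H X x) G"
    and orbit_stab_hom: "\<lbrakk>\<And>k. k \<in> orbit_stab G H X x \<Longrightarrow> \<phi> k \<in> carrier H \<and> ract X x k = lact X (\<phi> k) x\<rbrakk>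
      \<Longrightarrow> \<phi> \<in> hom (sub_group G (orbit_stab G H X x)) H"
proof -
  interpret G: group G by fact
  interpret H: group H by fact
  note b = is_bisetD[OF fin_free_bisetD(1)[OF assms(3)]]
  have mult: "ract X x (g \<otimes>\<^bsub>G\<^esub> g') = lact X (h \<otimes>\<^bsub>H\<^esub> h') x"
    if "g \<in> carrier G" "g' \<in> carrier G" "h \<in> carrier H" "h' \<in> carrier H"
      "ract X x g = lact X h x" "ract X x g' = lact X h' x" for g g' h h'
    using that assms(4) by (simp add: b)
  show sub: "subgroup (orbit_stab G H X x) G"
  proof (rule G.subgroupI)
    show "orbit_stab G H X x \<noteq> {}"
    proof -
      have "\<one>\<^bsub>G\<^esub> \<in> orbit_stab G H X x"
        unfolding orbit_stab_def using b(2,5)[OF assms(4)] H.one_closed by (metis (mono_tags, lifting) CollectI G.one_closed)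
      then show ?thesis by blast
    qed
    show "inv\<^bsub>G\<^esub> a \<in> orbit_stab G H X x" if a: "a \<in> orbit_stab G H X x" for a
    proof -
      obtain h where h: "a \<in> carrier G" "h \<in> carrier H" "ract X x a = lact X h x"
        using a by (auto simp: orbit_stab_def)
      have "x = ract X (ract X x a) (inv\<^bsub>G\<^esub> a)"
        using ract_inv_cancel(1)[OF assms(1) fin_free_bisetD(1)[OF assms(3)] assms(4) h(1)] by simp
      also have "\<dots> = lact X h (ract X x (inv\<^bsub>G\<^esub> a))" using h assms(4) by (simp add: b)
      finally have "lact X (inv\<^bsub>H\<^esub> h) x = ract X x (inv\<^bsub>G\<^esub> a)"
        using lact_inv_cancel(1)[OF assms(2) fin_free_bisetD(1)[OF assms(3)], of "ract X x (inv\<^bsub>G\<^esub> a)" h] h assms(4)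
        by (simp add: b)
      then show ?thesis using h by (auto simp: orbit_stab_def intro!: bexI[of _ "inv\<^bsub>H\<^esub> h"])
    qed
    show "a \<otimes>\<^bsub>G\<^esub> c \<in> orbit_stab G H X x" if a: "a \<in> orbit_stab G H X x" and c: "c \<in> orbit_stab G H X x" for a c
    proof -
      obtain h where h: "a \<in> carrier G" "h \<in> carrier H" "ract X x a = lact X h x"
        using a by (auto simp: orbit_stab_def)
      obtain k where k: "c \<in> carrier G" "k \<in> carrier H" "ract X x c = lact X k x"
        using c by (auto simp: orbit_stab_def)
      show ?thesis using mult[OF h(1) k(1) h(2) k(2) h(3) k(3)] h k by (auto simp: orbit_stab_def)
    qed
  qed (auto simp: orbit_stab_def)
  show "\<phi> \<in> hom (sub_group G (orbit_stab G H X x)) H"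
    if \<phi>: "\<And>k. k \<in> orbit_stab G H X x \<Longrightarrow> \<phi> k \<in> carrier H \<and> ract X x k = lact X (\<phi> k) x"
  proof -
    have "\<phi> (k \<otimes>\<^bsub>G\<^esub> l) = \<phi> k \<otimes>\<^bsub>H\<^esub> \<phi> l" if k: "k \<in> orbit_stab G H X x" and l: "l \<in> orbit_stab G H X x" for k l
    proof -
      have "k \<otimes>\<^bsub>G\<^esub> l \<in> orbit_stab G H X x" using subgroup.m_closed[OF sub k l] .
      then have 1: "\<phi> (k \<otimes>\<^bsub>G\<^esub> l) \<in> carrier H" "ract X x (k \<otimes>\<^bsub>G\<^esub> l) = lact X (\<phi> (k \<otimes>\<^bsub>G\<^esub> l)) x" using \<phi> by auto
      have 2: "ract X x (k \<otimes>\<^bsub>G\<^esub> l) = lact X (\<phi> k \<otimes>\<^bsub>H\<^esub> \<phi> l) x"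
        using mult \<phi>[OF k] \<phi>[OF l] k l by (simp add: orbit_stab_def)
      show ?thesis using lact_inj[OF assms(2,3,4)] 1 2 \<phi>[OF k] \<phi>[OF l] by simp
    qed
    then show ?thesis using \<phi> by (auto simp: hom_def)
  qed
qed

text \<open>The orbit-stabilizer theorem for bisets: the class of (h, g) goes to h x g, and two
  pairs have the same image exactly when they differ by an element of the stabilizer.\<close>

lemma transitive_biset_iso:
  assumes grp: "group G" "group H" and fin: "finite (carrier G)" "finite (carrier H)"
    and X: "fin_free_biset G H X" and x: "x \<in> points X"
    and trans: "\<And>y. y \<in> points X \<Longrightarrow> \<exists>h\<in>carrier H. \<exists>g\<in>carrier G. y = lact X h (ract X x g)"
    and Kdef: "K = orbit_stab G H X x"
    and st: "\<And>k. k \<in> K \<Longrightarrow> \<phi> k \<in> carrier H \<and> ract X x k = lact X (\<phi> k) x"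
  shows "biset_isomorphic G H (std_biset G H K \<phi>) X"
proof -
  interpret G: group G by fact
  interpret H: group H by fact
  interpret standard_biset G H K \<phi>
    using grp fin orbit_stab_subgroup[OF grp X x] orbit_stab_hom[OF grp X x, of \<phi>] st Kdef by (intro standard_biset.intro) simp_all
  note b = is_bisetD[OF fin_free_bisetD(1)[OF X]]
  \<comment> \<open>\<open>the_elem\<close> extracts the value that h x g takes on the class. It is
    constant there, since an element k of K moved across replaces x k by \<phi>(k) x.\<close>
  define f where "f C = the_elem ((\<lambda>(h, g). lact X h (ract X x g)) ` C)" for C
  have f: "f (std_pt G H K \<phi> h g) = lact X h (ract X x g)" if h: "h \<in> carrier H" and g: "g \<in> carrier G" for h g
  proof -
    have "lact X a (ract X x c) = lact X h (ract X x g)" if ac: "(a, c) \<in> std_pt G H K \<phi> h g" for a c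
    proof -
      obtain k where k: "a \<in> carrier H" "k \<in> K" "h = a \<otimes>\<^bsub>H\<^esub> \<phi> k" "c = k \<otimes>\<^bsub>G\<^esub> g"
        using ac h g by (auto simp: mem_std_pt)
      then show ?thesis using x g st[OF k(2)] K_sub[OF k(2)] by (simp add: b)
    qed
    then have "(\<lambda>(h, g). lact X h (ract X x g)) ` std_pt G H K \<phi> h g =
        (\<lambda>_. lact X h (ract X x g)) ` std_pt G H K \<phi> h g"
      by (intro image_cong) auto
    moreover have "(h, g) \<in> std_pt G H K \<phi> h g"
      using h g \<phi>_one subgroup.one_closed[OF K]
      by (auto simp: mem_std_pt intro!: bexI[of _ "\<one>\<^bsub>G\<^esub>"])
    ultimately have "(\<lambda>(h, g). lact X h (ract X x g)) ` std_pt G H K \<phi> h g = {lact X h (ract X x g)}"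
      by (simp only: image_constant)
    then show ?thesis by (simp add: f_def)
  qed
  have inj: "inj_on f (points (std_biset G H K \<phi>))"
  proof (rule inj_onI)
    fix C D assume C: "C \<in> points (std_biset G H K \<phi>)" and D: "D \<in> points (std_biset G H K \<phi>)" and e: "f C = f D"
    obtain h g where hg: "h \<in> carrier H" "g \<in> carrier G" "C = std_pt G H K \<phi> h g" using C by (rule std_ptE)
    obtain h' g' where hg': "h' \<in> carrier H" "g' \<in> carrier G" "D = std_pt G H K \<phi> h' g'" using D by (rule std_ptE)
    have eq: "lact X h (ract X x g) = lact X h' (ract X x g')" using e hg hg' f by simp
    have "ract X x (g' \<otimes>\<^bsub>G\<^esub> inv\<^bsub>G\<^esub> g) = ract X (lact X (inv\<^bsub>H\<^esub> h') (lact X h' (ract X x g'))) (inv\<^bsub>G\<^esub> g)"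
      using hg hg' x lact_inv_cancel(1)[OF grp(2) fin_free_bisetD(1)[OF X]] by (simp add: b)
    also have "\<dots> = ract X (lact X (inv\<^bsub>H\<^esub> h') (lact X h (ract X x g))) (inv\<^bsub>G\<^esub> g)" using eq by simp
    also have "\<dots> = lact X (inv\<^bsub>H\<^esub> h' \<otimes>\<^bsub>H\<^esub> h) (ract X (ract X x g) (inv\<^bsub>G\<^esub> g))"
      using hg hg' x by (simp add: b)
    also have "\<dots> = lact X (inv\<^bsub>H\<^esub> h' \<otimes>\<^bsub>H\<^esub> h) x"
      using ract_inv_cancel(1)[OF grp(1) fin_free_bisetD(1)[OF X] x hg(2)] by simp
    finally have m: "ract X x (g' \<otimes>\<^bsub>G\<^esub> inv\<^bsub>G\<^esub> g) = lact X (inv\<^bsub>H\<^esub> h' \<otimes>\<^bsub>H\<^esub> h) x" .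
    then have k: "g' \<otimes>\<^bsub>G\<^esub> inv\<^bsub>G\<^esub> g \<in> K" using hg hg' by (auto simp: Kdef orbit_stab_def)
    then have "\<phi> (g' \<otimes>\<^bsub>G\<^esub> inv\<^bsub>G\<^esub> g) = inv\<^bsub>H\<^esub> h' \<otimes>\<^bsub>H\<^esub> h"
      using m st[OF k] lact_inj[OF grp(2) X x] hg hg' by simp
    then have "h = h' \<otimes>\<^bsub>H\<^esub> \<phi> (g' \<otimes>\<^bsub>G\<^esub> inv\<^bsub>G\<^esub> g) \<and> g' = (g' \<otimes>\<^bsub>G\<^esub> inv\<^bsub>G\<^esub> g) \<otimes>\<^bsub>G\<^esub> g"
      using hg hg' by (simp add: H.m_assoc[symmetric] G.m_assoc)
    then show "C = D" using k hg hg' std_pt_eq_iff[of h g h' g'] by blast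
  qed
  moreover have "f ` points (std_biset G H K \<phi>) = points X"
  proof
    show "f ` points (std_biset G H K \<phi>) \<subseteq> points X"
      using x by (auto elim!: std_ptE simp: f b)
    show "points X \<subseteq> f ` points (std_biset G H K \<phi>)"
    proof
      fix y assume "y \<in> points X"
      then obtain h g where "h \<in> carrier H" "g \<in> carrier G" "y = lact X h (ract X x g)" using trans by blast
      then show "y \<in> f ` points (std_biset G H K \<phi>)"
        using f std_pt_in by (intro image_eqI[of _ _ "std_pt G H K \<phi> h g"]) simp_all
    qed
  qed
  moreover have "f (lact (std_biset G H K \<phi>) u C) = lact X u (f C)"
    if "C \<in> points (std_biset G H K \<phi>)" "u \<in> carrier H" for C u
    using that x by (auto elim!: std_ptE simp: f b lact_std_pt)
  moreover have "f (ract (std_biset G H K \<phi>) C u) = ract X (f C) u"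
    if "C \<in> points (std_biset G H K \<phi>)" "u \<in> carrier G" for C u
    using that x by (auto elim!: std_ptE simp: f b ract_std_pt)
  ultimately show ?thesis unfolding biset_isomorphic_def bij_betw_def by (intro exI[of _ f]) simp
qed

text \<open>By the size condition \<open>K\<close> is the whole stabilizer of the fixed point, which generates the transitive target.\<close>

lemma std_biset_iso_of_fixpt:
  assumes "standard_biset G H K \<phi>" "standard_biset G H K' \<phi>'"
    and "fixpts (std_biset G H K' \<phi>') K (\<lambda>x. x) \<phi> \<noteq> {}" and "card K' \<le> card K"
  shows "biset_isomorphic G H (std_biset G H K \<phi>) (std_biset G H K' \<phi>')"
proof -
  interpret A: standard_biset G H K \<phi> by fact
  interpret B: standard_biset G H K' \<phi>' by fact
  interpret G: group G by (rule A.grpG)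
  interpret H: group H by (rule A.grpH)
  let ?X = "std_biset G H K' \<phi>'"
  obtain x where x: "x \<in> fixpts ?X K (\<lambda>x. x) \<phi>" using assms(3) by auto
  then have xp: "x \<in> points ?X" by (simp add: fixpts_def)
  then obtain h g where hg: "h \<in> carrier H" "g \<in> carrier G" "x = std_pt G H K' \<phi>' h g" by (rule B.std_ptE)
  let ?c = "\<lambda>u. g \<otimes>\<^bsub>G\<^esub> u \<otimes>\<^bsub>G\<^esub> inv\<^bsub>G\<^esub> g"
  have sub: "K \<subseteq> orbit_stab G H ?X x"
    using x A.K_sub A.\<phi>_closed by (auto simp: orbit_stab_def fixpts_def)
  have inj: "inj_on ?c (carrier G)" using hg(2) by (auto simp: inj_on_def)
  \<comment> \<open>Conjugation by g embeds the stabilizer of x into K', so its order is at most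
    |K'|, which is at most |K|.\<close>
  have "?c ` orbit_stab G H ?X x \<subseteq> K'"
    using hg B.std_pt_ract_eq_lact_iff by (auto simp: orbit_stab_def)
  then have "card (?c ` orbit_stab G H ?X x) \<le> card K'" using B.finK card_mono by blast
  moreover have "card (?c ` orbit_stab G H ?X x) = card (orbit_stab G H ?X x)"
    by (rule card_image, rule inj_on_subset[OF inj]) (auto simp: orbit_stab_def)
  moreover have fin: "finite (orbit_stab G H ?X x)" using A.finG by (auto simp: orbit_stab_def)
  ultimately have K: "K = orbit_stab G H ?X x"
    using sub assms(4) by (intro card_subset_eq) (auto dest: card_mono[OF fin])
  show ?thesis
  proof (rule transitive_biset_iso[OF A.grpG A.grpH A.finG A.finH B.fin_free_std xp _ K])
    show "\<phi> k \<in> carrier H \<and> ract ?X x k = lact ?X (\<phi> k) x" if "k \<in> K" for k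
      using x that A.\<phi>_closed by (auto simp: fixpts_def)
    fix y assume "y \<in> points ?X"
    then obtain h' g' where hg': "h' \<in> carrier H" "g' \<in> carrier G" "y = std_pt G H K' \<phi>' h' g'" by (rule B.std_ptE)
    have "y = lact ?X (h' \<otimes>\<^bsub>H\<^esub> inv\<^bsub>H\<^esub> h) (ract ?X x (inv\<^bsub>G\<^esub> g \<otimes>\<^bsub>G\<^esub> g'))"
      using hg hg' by (simp add: B.lact_std_pt B.ract_std_pt H.m_assoc G.m_assoc[symmetric])
    then show "\<exists>h\<in>carrier H. \<exists>g\<in>carrier G. y = lact ?X h (ract ?X x g)"
      using hg hg' by (intro bexI[of _ "h' \<otimes>\<^bsub>H\<^esub> inv\<^bsub>H\<^esub> h"] bexI[of _ "inv\<^bsub>G\<^esub> g \<otimes>\<^bsub>G\<^esub> g'"]) auto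
  qed
qed

text \<open>The class of (1, 1) is such a point: the diagonal of the table of marks does not
  vanish.\<close>

lemma std_biset_fixpt_self:
  assumes "standard_biset G H K \<phi>"
  shows "fixpts (std_biset G H K \<phi>) K (\<lambda>x. x) \<phi> \<noteq> {}"
proof -
  interpret A: standard_biset G H K \<phi> by fact
  interpret G: group G by (rule A.grpG)
  interpret H: group H by (rule A.grpH)
  have "std_pt G H K \<phi> \<one>\<^bsub>H\<^esub> \<one>\<^bsub>G\<^esub> \<in> fixpts (std_biset G H K \<phi>) K (\<lambda>x. x) \<phi>"
    by (subst A.std_pt_fixed_iff) (auto simp: A.K_sub A.\<phi>_closed)
  then show ?thesis by auto
qed

text \<open>Triangularity of the table of marks: a fixed point conjugates K into K', and the bound
  on the orders then leaves only equality of the two classes.\<close>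

lemma iso_class_std_eq:
  assumes "standard_biset G H K \<phi>" "standard_biset G H K' \<phi>'"
    and "fixpts (std_biset G H K' \<phi>') K (\<lambda>x. x) \<phi> \<noteq> {}" and "card K' \<le> card K"
  shows "iso_class G H (std_biset G H K \<phi>) = iso_class G H (std_biset G H K' \<phi>')"
  using iso_class_eq[OF fin_free_bisetD(1)[OF standard_biset.fin_free_std[OF assms(1)]] std_biset_iso_of_fixpt[OF assms]] .

text \<open>The orbit of x is transitive, hence standard, and its complement is smaller. Both pieces
  keep the point type of \<open>X\<close>, so that for bisets on natural numbers the sum relations,
  which are stated for these, apply to the splitting.\<close>

lemma split_off_orbit:
  fixes X :: "('g, 'h, 'x) biset"
  assumes grp: "group G" "group H" and fin: "finite (carrier G)" "finite (carrier H)"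
    and X: "fin_free_biset G H X" and x: "x \<in> points X"
  obtains K \<phi> and Y :: "('g, 'h, 'x) biset" and O' :: "('g, 'h, 'x) biset"
  where "standard_biset G H K \<phi>" "fin_free_biset G H Y" "fin_free_biset G H O'"
    "card (points Y) < card (points X)"
    "biset_isomorphic G H (std_biset G H K \<phi>) O'"
    "biset_isomorphic G H X (biset_sum O' Y)"
proof -
  interpret G: group G by fact
  interpret H: group H by fact
  note b = is_bisetD[OF fin_free_bisetD(1)[OF X]]
  define Or where "Or = {lact X h (ract X x g) | h g. h \<in> carrier H \<and> g \<in> carrier G}"
  have Or: "Or \<subseteq> points X" unfolding Or_def using x by (auto simp: b)
  have Orl: "lact X u y \<in> Or" if "y \<in> Or" "u \<in> carrier H" for u y
  proof -
    obtain h g where "h \<in> carrier H" "g \<in> carrier G" "y = lact X h (ract X x g)" using \<open>y \<in> Or\<close> by (auto simp: Or_def)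
    then have "lact X u y = lact X (u \<otimes>\<^bsub>H\<^esub> h) (ract X x g)" "u \<otimes>\<^bsub>H\<^esub> h \<in> carrier H" using that x by (simp_all add: b)
    then show ?thesis using \<open>g \<in> carrier G\<close> unfolding Or_def by blast
  qed
  have Orr: "ract X y u \<in> Or" if "y \<in> Or" "u \<in> carrier G" for u y
  proof -
    obtain h g where "h \<in> carrier H" "g \<in> carrier G" "y = lact X h (ract X x g)" using \<open>y \<in> Or\<close> by (auto simp: Or_def)
    then have "ract X y u = lact X h (ract X x (g \<otimes>\<^bsub>G\<^esub> u))" "g \<otimes>\<^bsub>G\<^esub> u \<in> carrier G" using that x by (simp_all add: b)
    then show ?thesis using \<open>h \<in> carrier H\<close> unfolding Or_def by blast
  qed
  have xOr: "x \<in> Or" unfolding Or_def using b(2,5)[OF x]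
    by (intro CollectI exI[of _ "\<one>\<^bsub>H\<^esub>"] exI[of _ "\<one>\<^bsub>G\<^esub>"]) auto
  define O' where "O' = X\<lparr>points := Or\<rparr>"
  define Y where "Y = X\<lparr>points := points X - Or\<rparr>"
  have Yl: "lact X u y \<in> points X - Or" if "y \<in> points X - Or" "u \<in> carrier H" for u y
    using that Orl[of "lact X u y" "inv\<^bsub>H\<^esub> u"] lact_inv_cancel(1)[OF grp(2) fin_free_bisetD(1)[OF X], of y u]
    by (auto simp: b)
  have Yr: "ract X y u \<in> points X - Or" if "y \<in> points X - Or" "u \<in> carrier G" for u y
    using that Orr[of "ract X y u" "inv\<^bsub>G\<^esub> u"] ract_inv_cancel(1)[OF grp(1) fin_free_bisetD(1)[OF X], of y u]
    by (auto simp: b)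
  have fO: "fin_free_biset G H O'"
    using Or Orl Orr fin_free_bisetD(2)[OF X] fin_free_bisetD(3)[OF X] b
    unfolding fin_free_biset_def is_biset_def O'_def by (auto intro: finite_subset)
  have fY: "fin_free_biset G H Y"
    using Yl Yr fin_free_bisetD(2)[OF X] fin_free_bisetD(3)[OF X] b
    unfolding fin_free_biset_def is_biset_def Y_def by auto
  have lt: "card (points Y) < card (points X)"
    unfolding Y_def using xOr x fin_free_bisetD(2)[OF X] by (auto intro!: psubset_card_mono)
  define K where "K = orbit_stab G H O' x"
  define \<phi> where "\<phi> k = (SOME h. h \<in> carrier H \<and> ract X x k = lact X h x)" for k
  have \<phi>: "\<phi> k \<in> carrier H \<and> ract O' x k = lact O' (\<phi> k) x" if "k \<in> K" for k
  proof -
    have "\<exists>h. h \<in> carrier H \<and> ract X x k = lact X h x" using that by (auto simp: K_def orbit_stab_def O'_def)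
    then show ?thesis unfolding \<phi>_def O'_def using someI_ex by simp
  qed
  have xO: "x \<in> points O'" using xOr by (simp add: O'_def)
  have "biset_isomorphic G H (std_biset G H K \<phi>) O'"
    using transitive_biset_iso[OF grp fin fO xO _ K_def \<phi>] by (auto simp: O'_def Or_def)
  moreover have "standard_biset G H K \<phi>"
    using grp fin orbit_stab_subgroup[OF grp fO xO] orbit_stab_hom[OF grp fO xO, of \<phi>] \<phi> K_def
    by (intro standard_biset.intro) simp_all
  moreover have "biset_isomorphic G H X (biset_sum O' Y)"
    unfolding biset_isomorphic_def
  proof (intro exI[of _ "\<lambda>y. if y \<in> Or then Inl y else Inr y"] conjI ballI)
    show "bij_betw (\<lambda>y. if y \<in> Or then Inl y else Inr y) (points X) (points (biset_sum O' Y))"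
      using Or by (auto simp: bij_betw_def inj_on_def biset_sum_def O'_def Y_def image_iff split: if_splits)
  qed (use Orl Orr Yl Yr in \<open>auto simp: biset_sum_def O'_def Y_def\<close>)
  ultimately show ?thesis using that fO fY lt by blast
qed

section \<open>Burnside modules\<close>

subsection \<open>Linear functionals on formal combinations\<close>

text \<open>The linear extension of a function on isomorphism classes. Every invariant of a Burnside
  element below is some \<open>lin f\<close> evaluated on a representative.\<close>

definition lin :: "('c \<Rightarrow> rat) \<Rightarrow> ('c \<Rightarrow>\<^sub>0 rat) \<Rightarrow> rat"
  where "lin f x = (\<Sum>c\<in>Poly_Mapping.keys x. Poly_Mapping.lookup x c * f c)"

lemma lin_superset:
  assumes "finite A" "Poly_Mapping.keys x \<subseteq> A"
  shows "lin f x = (\<Sum>c\<in>A. Poly_Mapping.lookup x c * f c)"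
  unfolding lin_def using assms by (intro sum.mono_neutral_left) (auto simp: in_keys_iff)

lemma lin_zero [simp]: "lin f 0 = 0" by (simp add: lin_def)

lemma lin_single [simp]: "lin f (Poly_Mapping.single c r) = r * f c" by (simp add: lin_def)

lemma lin_add: "lin f (x + y) = lin f x + lin f y"
proof -
  let ?A = "Poly_Mapping.keys x \<union> Poly_Mapping.keys y"
  have "lin f (x + y) = (\<Sum>c\<in>?A. Poly_Mapping.lookup (x + y) c * f c)"
    using keys_add[of x y] by (intro lin_superset) auto
  then show ?thesis
    by (simp add: lin_superset[of ?A x] lin_superset[of ?A y] lookup_add distrib_right sum.distrib)
qed

lemma lin_uminus: "lin f (- x) = - lin f x"
  by (simp add: lin_def keys_def sum_negf)

lemma lin_diff: "lin f (x - y) = lin f x - lin f y"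
  using lin_add[of f x "- y"] by (simp add: lin_uminus)

lemma lin_sum: "lin f (\<Sum>i\<in>I. x i) = (\<Sum>i\<in>I. lin f (x i))"
  by (induction I rule: infinite_finite_induct) (auto simp: lin_add)

lemma lookup_scale: "Poly_Mapping.lookup (Poly_Mapping.map ((*) r) x) c = r * Poly_Mapping.lookup x c"
  for r :: rat
  by (cases "Poly_Mapping.lookup x c = 0") (simp_all add: Poly_Mapping.map.rep_eq)

lemma keys_scale: "Poly_Mapping.keys (Poly_Mapping.map ((*) r) x) \<subseteq> Poly_Mapping.keys x"
  for r :: rat
  by (auto simp: in_keys_iff lookup_scale)

lemma lin_scale: "lin f (Poly_Mapping.map ((*) r) x) = r * lin f x"
  using lin_superset[OF _ keys_scale, of x f r]
  by (simp add: lookup_scale sum_distrib_left mult.assoc lin_def)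

lemma lin_cong: "(\<And>c. c \<in> Poly_Mapping.keys x \<Longrightarrow> f c = g c) \<Longrightarrow> lin f x = lin g x"
  by (simp add: lin_def)

text \<open>Interchanging the two sums allows a bilinear expression to be varied in one argument at
  a time.\<close>

lemma lin_swap: "lin (\<lambda>c. lin (f c) y) x = lin (\<lambda>d. lin (\<lambda>c. f c d) x) y"
  unfolding lin_def sum_distrib_left by (subst sum.swap) (simp add: mult.left_commute)

lemma lin_sum_fun: "lin (\<lambda>c. \<Sum>i\<in>I. f i c) x = (\<Sum>i\<in>I. lin (f i) x)"
  unfolding lin_def sum_distrib_left by (rule sum.swap)

lemma lin_mult_const: "lin (\<lambda>c. f c * a) x = lin f x * a"
  by (simp add: lin_def sum_distrib_right mult.assoc)

subsection \<open>Local integers\<close>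

lemma Z_loc_0 [simp]: "prime p \<Longrightarrow> 0 \<in> Z_loc p"
  and Z_loc_1 [simp]: "prime p \<Longrightarrow> 1 \<in> Z_loc p"
  and Z_loc_of_int: "prime p \<Longrightarrow> of_int a \<in> Z_loc p"
proof -
  assume "prime p"
  then have "\<not> int p dvd 1" using not_prime_1 by auto
  then have "of_int a / of_int 1 \<in> Z_loc p" for a unfolding Z_loc_def by blast
  from this[of 0] this[of 1] this[of a] show "0 \<in> Z_loc p" "1 \<in> Z_loc p" "of_int a \<in> Z_loc p" by simp_all
qed

lemma Z_loc_of_nat: "prime p \<Longrightarrow> of_nat a \<in> Z_loc p"
  using Z_loc_of_int[of p "int a"] by simp

lemma Z_loc_add_mult:
  assumes "prime p" "x \<in> Z_loc p" "y \<in> Z_loc p"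
  shows "x + y \<in> Z_loc p" and "x * y \<in> Z_loc p"
proof -
  obtain a b c d where a: "x = of_int a / of_int b" "\<not> int p dvd b" and c: "y = of_int c / of_int d" "\<not> int p dvd d"
    using assms(2,3) unfolding Z_loc_def by auto
  have bd: "\<not> int p dvd b * d" using assms(1) a c by (simp add: prime_dvd_mult_iff)
  have "b \<noteq> 0" "d \<noteq> 0" using a c by auto
  then have "x + y = of_int (a * d + c * b) / of_int (b * d)" "x * y = of_int (a * c) / of_int (b * d)"
    using a c by (simp_all add: field_simps)
  then show "x + y \<in> Z_loc p" "x * y \<in> Z_loc p" using bd unfolding Z_loc_def by blast+
qed

lemma Z_loc_uminus: "prime p \<Longrightarrow> x \<in> Z_loc p \<Longrightarrow> - x \<in> Z_loc p"
  using Z_loc_add_mult(2)[of p "-1" x] Z_loc_of_int[of p "-1"] by simp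

lemma Z_loc_sum: "prime p \<Longrightarrow> (\<And>i. i \<in> I \<Longrightarrow> f i \<in> Z_loc p) \<Longrightarrow> sum f I \<in> Z_loc p"
  by (induction I rule: infinite_finite_induct) (auto intro: Z_loc_add_mult)

subsection \<open>Marks\<close>

text \<open>A representative is chosen so that the mark is a function of the isomorphism class and
  can be extended linearly; fixed point counts are isomorphism invariants, so the choice is
  immaterial.\<close>

definition mark :: "('g, 'h) biset_class \<Rightarrow> 'q set \<Rightarrow> ('q \<Rightarrow> 'g) \<Rightarrow> ('q \<Rightarrow> 'h) \<Rightarrow> rat"
  where "mark c P \<alpha> \<beta> = of_nat (card (fixpts (SOME Y. Y \<in> c) P \<alpha> \<beta>))"

lemma mark_iso_class:
  assumes "group G" "group H" "fin_free_biset G H X" "\<alpha> \<in> P \<rightarrow> carrier G" "\<beta> \<in> P \<rightarrow> carrier H"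
  shows "mark (iso_class G H X) P \<alpha> \<beta> = of_nat (card (fixpts X P \<alpha> \<beta>))"
proof -
  have "\<exists>Y. Y \<in> iso_class G H X" using ex_nat_biset[OF assms(3,1,2)] by (auto simp: iso_class_def)
  then have "(SOME Y. Y \<in> iso_class G H X) \<in> iso_class G H X" by (rule someI_ex)
  then show ?thesis unfolding mark_def
    using card_fixpts_iso[OF _ fin_free_bisetD(1)[OF assms(3)] assms(4,5)] by (metis (mono_tags, lifting) iso_class_def mem_Collect_eq)
qed

text \<open>This is the condition under which \<open>lin f\<close> kills the relations [X + Y] - [X]
  - [Y], so that it is well defined on Burnside elements.\<close>

definition additive_on :: "('g, 'm) monoid_scheme \<Rightarrow> ('h, 'n) monoid_scheme \<Rightarrow> (('g, 'h) biset_class \<Rightarrow> rat) \<Rightarrow> bool"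
  where "additive_on G H f \<longleftrightarrow> (\<forall>(X :: ('g, 'h, nat) biset) (Y :: ('g, 'h, nat) biset).
    fin_free_biset G H X \<longrightarrow> fin_free_biset G H Y \<longrightarrow>
    f (iso_class G H (biset_sum X Y)) = f (iso_class G H X) + f (iso_class G H Y))"

lemma lin_sum_relations:
  assumes "additive_on G H f" "z \<in> sum_relations p G H"
  shows "lin f z = 0"
  using assms(2)
proof induction
  case (add z r X Y)
  then have "f (iso_class G H (biset_sum X Y)) = f (iso_class G H X) + f (iso_class G H Y)"
    using assms(1) unfolding additive_on_def by blast
  then show ?case using add by (simp add: lin_add lin_diff distrib_left)
qed simp

lemma additive_mark:
  assumes "group G" "group H" "\<alpha> \<in> P \<rightarrow> carrier G" "\<beta> \<in> P \<rightarrow> carrier H"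
  shows "additive_on G H (\<lambda>c. mark c P \<alpha> \<beta>)"
  unfolding additive_on_def
  by (auto simp: mark_iso_class[OF assms(1,2) _ assms(3,4)] fin_free_biset_sum card_fixpts_sum fin_free_bisetD(2)[of G H])

text \<open>The union over representatives in \<open>class_prod\<close> is a union of equal sets,
  and it is not over the empty set because classes are nonempty.\<close>

lemma class_prod_iso_class:
  assumes "biset_product G H K X Y"
  shows "class_prod G H K (iso_class H K X) (iso_class G H Y) = iso_class G K (biset_prod H X Y)"
proof -
  interpret biset_product G H K X Y by fact
  have "iso_class G K (biset_prod H X' Y') = iso_class G K (biset_prod H X Y)"
    if "X' \<in> iso_class H K X" "Y' \<in> iso_class G H Y" for X' Y'
  proof (rule iso_class_eq[symmetric])
    show "is_biset G K (biset_prod H X Y)" using fin_free_biset_prod by (rule fin_free_bisetD)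
    have "biset_product G H K X' Y'"
      using that grpG grpH grpK finH by (intro biset_product.intro) (auto simp: iso_class_def)
    then show "biset_isomorphic G K (biset_prod H X Y) (biset_prod H X' Y')"
      using that by (intro biset_prod_iso[OF assms]) (auto simp: iso_class_def)
  qed
  moreover have "iso_class H K X \<noteq> {}" "iso_class G H Y \<noteq> {}"
    using ex_nat_biset[OF X grpH grpK] ex_nat_biset[OF Y grpG grpH] by (auto simp: iso_class_def)
  ultimately show ?thesis unfolding class_prod_def by auto
qed

text \<open>Keeping the factor |H| on the left leaves a count of pairs on the right, with no
  quotient to handle; |H| is cancelled by each user.\<close>

lemma mark_class_prod:
  assumes "biset_product G H K X Y" "\<alpha> \<in> P \<rightarrow> carrier G" "\<beta> \<in> P \<rightarrow> carrier K"
  shows "of_nat (card (carrier H)) * mark (class_prod G H K (iso_class H K X) (iso_class G H Y)) P \<alpha> \<beta>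
    = of_nat (card (pairset H X Y P \<alpha> \<beta>))"
proof -
  interpret biset_product G H K X Y by fact
  show ?thesis
    unfolding class_prod_iso_class[OF assms(1)] mark_iso_class[OF grpG grpK fin_free_biset_prod assms(2,3)]
    using card_fixpts_prod[OF assms(2,3)] by simp
qed

text \<open>Pairs over a disjoint union split according to the summand, and |H| is nonzero. Together
  with its mirror image this makes the marks of a composite depend only on the Burnside classes of
  the factors.\<close>

lemma additive_mark_prod_left:
  fixes G :: "('a, 'm) monoid_scheme" and H :: "('b, 'n) monoid_scheme" and K :: "('e, 'l) monoid_scheme"
    and Y :: "('a, 'b, 'd) biset"
  assumes "group G" "group H" "group K" "finite (carrier H)" "fin_free_biset G H Y"
    "\<alpha> \<in> P \<rightarrow> carrier G" "\<beta> \<in> P \<rightarrow> carrier K"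
  shows "additive_on H K (\<lambda>c. mark (class_prod G H K c (iso_class G H Y)) P \<alpha> \<beta>)"
  unfolding additive_on_def
proof (intro allI impI)
  fix X X' :: "('b, 'e, nat) biset"
  assume X: "fin_free_biset H K X" and X': "fin_free_biset H K X'"
  let ?f = "\<lambda>c. mark (class_prod G H K c (iso_class G H Y)) P \<alpha> \<beta>"
  have f: "of_nat (card (carrier H)) * ?f (iso_class H K Z) = of_nat (card (pairset H Z Y P \<alpha> \<beta>))"
    if "fin_free_biset H K Z" for Z :: "('b, 'e, 'z) biset"
    using mark_class_prod[OF biset_product.intro[OF assms(1-3) that assms(5,4)] assms(6,7)] .
  \<comment> \<open>The tag of the disjoint union moves from the first coordinate to the whole
    pair.\<close>
  define m where "m = (\<lambda>(z :: nat + nat, y :: 'd). case z of Inl x \<Rightarrow> Inl (x, y) | Inr x \<Rightarrow> Inr (x, y))"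
  have "bij_betw m (pairset H (biset_sum X X') Y P \<alpha> \<beta>) (pairset H X Y P \<alpha> \<beta> <+> pairset H X' Y P \<alpha> \<beta>)"
    by (rule bij_betw_byWitness[where f' = "case_sum (\<lambda>(x, y). (Inl x, y)) (\<lambda>(x, y). (Inr x, y))"])
       (auto simp: m_def pairset_def biset_sum_def split: sum.splits)
  then have "card (pairset H (biset_sum X X') Y P \<alpha> \<beta>) = card (pairset H X Y P \<alpha> \<beta> <+> pairset H X' Y P \<alpha> \<beta>)"
    by (rule bij_betw_same_card)
  moreover have "finite (pairset H X Y P \<alpha> \<beta>)" "finite (pairset H X' Y P \<alpha> \<beta>)"
    using fin_free_bisetD(2)[OF X] fin_free_bisetD(2)[OF X'] fin_free_bisetD(2)[OF assms(5)]
    by (auto intro: finite_subset[of _ "points X \<times> points Y"] finite_subset[of _ "points X' \<times> points Y"]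
      simp: pairset_def)
  ultimately have "card (pairset H (biset_sum X X') Y P \<alpha> \<beta>) = card (pairset H X Y P \<alpha> \<beta>) + card (pairset H X' Y P \<alpha> \<beta>)"
    by (simp add: card_Plus)
  then have "of_nat (card (carrier H)) * ?f (iso_class H K (biset_sum X X')) =
     of_nat (card (carrier H)) * (?f (iso_class H K X) + ?f (iso_class H K X'))"
    using f[OF X] f[OF X'] f[OF fin_free_biset_sum[OF X X']] by (simp add: distrib_left)
  moreover have "card (carrier H) \<noteq> 0"
    using assms(2,4) group.is_monoid monoid.one_closed by (metis card_0_eq empty_iff)
  ultimately show "?f (iso_class H K (biset_sum X X')) = ?f (iso_class H K X) + ?f (iso_class H K X')"
    by simp
qed

lemma additive_mark_prod_right:
  fixes G :: "('a, 'm) monoid_scheme" and H :: "('b, 'n) monoid_scheme" and K :: "('e, 'l) monoid_scheme"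
    and X :: "('b, 'e, 'd) biset"
  assumes "group G" "group H" "group K" "finite (carrier H)" "fin_free_biset H K X"
    "\<alpha> \<in> P \<rightarrow> carrier G" "\<beta> \<in> P \<rightarrow> carrier K"
  shows "additive_on G H (\<lambda>d. mark (class_prod G H K (iso_class H K X) d) P \<alpha> \<beta>)"
  unfolding additive_on_def
proof (intro allI impI)
  fix Y Y' :: "('a, 'b, nat) biset"
  assume Y: "fin_free_biset G H Y" and Y': "fin_free_biset G H Y'"
  let ?f = "\<lambda>d. mark (class_prod G H K (iso_class H K X) d) P \<alpha> \<beta>"
  have f: "of_nat (card (carrier H)) * ?f (iso_class G H Z) = of_nat (card (pairset H X Z P \<alpha> \<beta>))"
    if "fin_free_biset G H Z" for Z :: "('a, 'b, 'z) biset"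
    using mark_class_prod[OF biset_product.intro[OF assms(1-3,5) that assms(4)] assms(6,7)] .
  define m where "m = (\<lambda>(x :: 'd, z :: nat + nat). case z of Inl y \<Rightarrow> Inl (x, y) | Inr y \<Rightarrow> Inr (x, y))"
  have "bij_betw m (pairset H X (biset_sum Y Y') P \<alpha> \<beta>) (pairset H X Y P \<alpha> \<beta> <+> pairset H X Y' P \<alpha> \<beta>)"
    by (rule bij_betw_byWitness[where f' = "case_sum (\<lambda>(x, y). (x, Inl y)) (\<lambda>(x, y). (x, Inr y))"])
       (auto simp: m_def pairset_def biset_sum_def split: sum.splits)
  then have "card (pairset H X (biset_sum Y Y') P \<alpha> \<beta>) = card (pairset H X Y P \<alpha> \<beta> <+> pairset H X Y' P \<alpha> \<beta>)"
    by (rule bij_betw_same_card)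
  moreover have "finite (pairset H X Y P \<alpha> \<beta>)" "finite (pairset H X Y' P \<alpha> \<beta>)"
    using fin_free_bisetD(2)[OF Y] fin_free_bisetD(2)[OF Y'] fin_free_bisetD(2)[OF assms(5)]
    by (auto intro: finite_subset[of _ "points X \<times> points Y"] finite_subset[of _ "points X \<times> points Y'"]
      simp: pairset_def)
  ultimately have "card (pairset H X (biset_sum Y Y') P \<alpha> \<beta>) = card (pairset H X Y P \<alpha> \<beta>) + card (pairset H X Y' P \<alpha> \<beta>)"
    by (simp add: card_Plus)
  then have "of_nat (card (carrier H)) * ?f (iso_class G H (biset_sum Y Y')) =
     of_nat (card (carrier H)) * (?f (iso_class G H Y) + ?f (iso_class G H Y'))"
    using f[OF Y] f[OF Y'] f[OF fin_free_biset_sum[OF Y Y']] by (simp add: distrib_left)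
  moreover have "card (carrier H) \<noteq> 0"
    using assms(2,4) group.is_monoid monoid.one_closed by (metis card_0_eq empty_iff)
  ultimately show "?f (iso_class G H (biset_sum Y Y')) = ?f (iso_class G H Y) + ?f (iso_class G H Y')"
    by simp
qed

subsection \<open>The module and its composition\<close>

lemma iso_classesE:
  fixes G :: "('g, 'm) monoid_scheme" and H :: "('h, 'n) monoid_scheme"
  assumes "c \<in> iso_classes G H"
  obtains X :: "('g, 'h, nat) biset" where "fin_free_biset G H X" "c = iso_class G H X"
  using assms unfolding iso_classes_def by blast

lemma formal_combs_0 [simp]: "prime p \<Longrightarrow> 0 \<in> formal_combs p G H"
  by (simp add: formal_combs_def)

lemma formal_combs_single:
  assumes "prime p" "c \<in> iso_classes G H" "r \<in> Z_loc p"
  shows "Poly_Mapping.single c r \<in> formal_combs p G H"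
  using assms by (auto simp: formal_combs_def lookup_single when_def)

lemma formal_combs_add:
  assumes "prime p" "x \<in> formal_combs p G H" "y \<in> formal_combs p G H"
  shows "x + y \<in> formal_combs p G H"
  using assms keys_add[of x y] by (auto simp: formal_combs_def lookup_add Z_loc_add_mult)

lemma formal_combs_sum:
  assumes "prime p" "\<And>i. i \<in> I \<Longrightarrow> x i \<in> formal_combs p G H"
  shows "(\<Sum>i\<in>I. x i) \<in> formal_combs p G H"
  using assms(2) by (induction I rule: infinite_finite_induct) (auto simp: assms(1) formal_combs_add)

lemma formal_combs_scale:
  assumes "prime p" "x \<in> formal_combs p G H" "r \<in> Z_loc p"
  shows "Poly_Mapping.map ((*) r) x \<in> formal_combs p G H"
  using assms keys_scale[of r x] by (auto simp: formal_combs_def lookup_scale Z_loc_add_mult)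

lemma b_class_self: "x \<in> formal_combs p G H \<Longrightarrow> x \<in> b_class p G H x"
  by (simp add: b_class_def burnside_rel_def sum_relations.zero)

lemma b_class_in_burnside: "x \<in> formal_combs p G H \<Longrightarrow> b_class p G H x \<in> burnside p G H"
  unfolding burnside_def b_class_def by (rule quotientI)

lemma b_class_lin:
  assumes "additive_on G H f" "y \<in> b_class p G H x"
  shows "lin f y = lin f x"
  using lin_sum_relations[OF assms(1), of "x - y" p] assms(2)
  by (simp add: b_class_def burnside_rel_def lin_diff)

lemma burnsideE:
  assumes "X \<in> burnside p G H"
  obtains x where "x \<in> formal_combs p G H" "X = b_class p G H x"
  using assms unfolding burnside_def b_class_def by (elim quotientE)

lemma burnside_formal: "X \<in> burnside p G H \<Longrightarrow> x \<in> X \<Longrightarrow> x \<in> formal_combs p G H"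
  by (auto elim!: burnsideE simp: b_class_def burnside_rel_def)

lemma burnside_lin:
  assumes "X \<in> burnside p G H" "x \<in> X" "x' \<in> X" "additive_on G H f"
  shows "lin f x = lin f x'"
  using assms(1-3) b_class_lin[OF assms(4)] by (metis burnsideE)

definition comp_comb :: "('g, 'm) monoid_scheme \<Rightarrow> ('h, 'n) monoid_scheme \<Rightarrow> ('k, 'l) monoid_scheme \<Rightarrow>
    (('h, 'k) biset_class \<Rightarrow>\<^sub>0 rat) \<Rightarrow> (('g, 'h) biset_class \<Rightarrow>\<^sub>0 rat) \<Rightarrow> (('g, 'k) biset_class \<Rightarrow>\<^sub>0 rat)"
  where "comp_comb G H K x y = (\<Sum>c\<in>Poly_Mapping.keys x. \<Sum>d\<in>Poly_Mapping.keys y.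
      Poly_Mapping.single (class_prod G H K c d) (Poly_Mapping.lookup x c * Poly_Mapping.lookup y d))"

lemma lin_comp_comb: "lin f (comp_comb G H K x y) = lin (\<lambda>c. lin (\<lambda>d. f (class_prod G H K c d)) y) x"
  unfolding comp_comb_def lin_sum by (simp only: lin_single) (simp add: lin_def sum_distrib_left mult.assoc)

locale three_groups =
  fixes G :: "('g, 'm) monoid_scheme" and H :: "('h, 'n) monoid_scheme" and K :: "('k, 'l) monoid_scheme"
    and p :: nat
  assumes grpG: "group G" and grpH: "group H" and grpK: "group K" and finH: "finite (carrier H)"
    and p: "prime p"
begin

lemma class_prod_in:
  assumes "c \<in> iso_classes H K" "d \<in> iso_classes G H"
  shows "class_prod G H K c d \<in> iso_classes G K"
proof -
  obtain X :: "('h, 'k, nat) biset" where X: "fin_free_biset H K X" "c = iso_class H K X"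
    using assms(1) by (rule iso_classesE)
  obtain Y :: "('g, 'h, nat) biset" where Y: "fin_free_biset G H Y" "d = iso_class G H Y"
    using assms(2) by (rule iso_classesE)
  have P: "biset_product G H K X Y" by (rule biset_product.intro[OF grpG grpH grpK X(1) Y(1) finH])
  show ?thesis unfolding X(2) Y(2) class_prod_iso_class[OF P]
    using biset_product.fin_free_biset_prod[OF P] grpG grpK by (rule iso_class_in_iso_classes)
qed

lemma comp_comb_formal:
  assumes "x \<in> formal_combs p H K" "y \<in> formal_combs p G H"
  shows "comp_comb G H K x y \<in> formal_combs p G K"
  unfolding comp_comb_def using assms
  by (intro formal_combs_sum formal_combs_single Z_loc_add_mult class_prod_in p) (auto simp: formal_combs_def)

text \<open>One argument is replaced at a time: additivity of the mark of a product in the second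
  factor changes y, and after an interchange of sums additivity in the first factor changes
  x.\<close>

lemma comp_mark_invariant:
  assumes X: "X \<in> burnside p H K" "x \<in> X" "x' \<in> X" and Y: "Y \<in> burnside p G H" "y \<in> Y" "y' \<in> Y"
    and \<alpha>: "\<alpha> \<in> P \<rightarrow> carrier G" and \<beta>: "\<beta> \<in> P \<rightarrow> carrier K"
  shows "lin (\<lambda>c. lin (\<lambda>d. mark (class_prod G H K c d) P \<alpha> \<beta>) y) x =
    lin (\<lambda>c. lin (\<lambda>d. mark (class_prod G H K c d) P \<alpha> \<beta>) y') x'"
proof -
  have x: "Poly_Mapping.keys x \<subseteq> iso_classes H K" "Poly_Mapping.keys x' \<subseteq> iso_classes H K"
    using burnside_formal[OF X(1)] X by (auto simp: formal_combs_def)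
  have y: "Poly_Mapping.keys y' \<subseteq> iso_classes G H"
    using burnside_formal[OF Y(1)] Y by (auto simp: formal_combs_def)
  have "lin (\<lambda>c. lin (\<lambda>d. mark (class_prod G H K c d) P \<alpha> \<beta>) y) x =
     lin (\<lambda>c. lin (\<lambda>d. mark (class_prod G H K c d) P \<alpha> \<beta>) y') x"
  proof (rule lin_cong)
    fix c assume "c \<in> Poly_Mapping.keys x"
    then obtain Z :: "('h, 'k, nat) biset" where Z: "fin_free_biset H K Z" "c = iso_class H K Z"
      using x by (auto elim: iso_classesE)
    show "lin (\<lambda>d. mark (class_prod G H K c d) P \<alpha> \<beta>) y = lin (\<lambda>d. mark (class_prod G H K c d) P \<alpha> \<beta>) y'"
      unfolding Z(2) by (rule burnside_lin[OF Y additive_mark_prod_right[OF grpG grpH grpK finH Z(1) \<alpha> \<beta>]])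
  qed
  also have "\<dots> = lin (\<lambda>d. lin (\<lambda>c. mark (class_prod G H K c d) P \<alpha> \<beta>) x) y'" by (rule lin_swap)
  also have "\<dots> = lin (\<lambda>d. lin (\<lambda>c. mark (class_prod G H K c d) P \<alpha> \<beta>) x') y'"
  proof (rule lin_cong)
    fix d assume "d \<in> Poly_Mapping.keys y'"
    then obtain Z :: "('g, 'h, nat) biset" where Z: "fin_free_biset G H Z" "d = iso_class G H Z"
      using y by (auto elim: iso_classesE)
    show "lin (\<lambda>c. mark (class_prod G H K c d) P \<alpha> \<beta>) x = lin (\<lambda>c. mark (class_prod G H K c d) P \<alpha> \<beta>) x'"
      unfolding Z(2) by (rule burnside_lin[OF X additive_mark_prod_left[OF grpG grpH grpK finH Z(1) \<alpha> \<beta>]])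
  qed
  also have "\<dots> = lin (\<lambda>c. lin (\<lambda>d. mark (class_prod G H K c d) P \<alpha> \<beta>) y') x'" by (rule lin_swap)
  finally show ?thesis .
qed

text \<open>\<open>b_comp\<close> unites the classes obtained from all representatives. It is enough
  that all members of this union have the same marks, computed from any two chosen
  representatives.\<close>

lemma b_comp_mark:
  assumes X: "X \<in> burnside p H K" "x \<in> X" and Y: "Y \<in> burnside p G H" "y \<in> Y"
    and \<alpha>: "\<alpha> \<in> P \<rightarrow> carrier G" and \<beta>: "\<beta> \<in> P \<rightarrow> carrier K"
    and z: "z \<in> b_comp p G H K X Y"
  shows "lin (\<lambda>c. mark c P \<alpha> \<beta>) z = lin (\<lambda>c. lin (\<lambda>d. mark (class_prod G H K c d) P \<alpha> \<beta>) y) x"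
proof -
  obtain x' y' where xy': "x' \<in> X" "y' \<in> Y" "z \<in> b_class p G K (comp_comb G H K x' y')"
    using z unfolding b_comp_def comp_comb_def by auto
  have "lin (\<lambda>c. mark c P \<alpha> \<beta>) z = lin (\<lambda>c. mark c P \<alpha> \<beta>) (comp_comb G H K x' y')"
    using additive_mark[OF grpG grpK \<alpha> \<beta>] xy'(3) by (rule b_class_lin)
  also have "\<dots> = lin (\<lambda>c. lin (\<lambda>d. mark (class_prod G H K c d) P \<alpha> \<beta>) y) x"
    unfolding lin_comp_comb by (rule comp_mark_invariant[OF X(1) xy'(1) X(2) Y(1) xy'(2) Y(2) \<alpha> \<beta>])
  finally show ?thesis .
qed

text \<open>Supplies the member on which both sides of a stability equation are evaluated.\<close>

lemma b_comp_nonempty: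
  assumes X: "X \<in> burnside p H K" "x \<in> X" and Y: "Y \<in> burnside p G H" "y \<in> Y"
  shows "comp_comb G H K x y \<in> b_comp p G H K X Y"
  using b_class_self[OF comp_comb_formal[OF burnside_formal[OF X] burnside_formal[OF Y]]] X(2) Y(2)
  unfolding b_comp_def comp_comb_def by blast

end

subsection \<open>Addition and scalar multiplication\<close>

lemma sum_relations_add:
  assumes "z \<in> sum_relations p G H" "z' \<in> sum_relations p G H"
  shows "z + z' \<in> sum_relations p G H"
  using assms(2)
proof induction
  case (add z'' r X Y)
  from sum_relations.add[OF add.IH add.hyps(2-4)] show ?case by (simp only: add.assoc)
qed (simp add: assms)

lemma scale_zero: "Poly_Mapping.map ((*) r) 0 = 0" for r :: rat
  by (rule poly_mapping_eqI) (simp add: lookup_scale)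

lemma sum_relations_scale:
  assumes "prime p" "z \<in> sum_relations p G H" "r \<in> Z_loc p"
  shows "Poly_Mapping.map ((*) r) z \<in> sum_relations p G H"
  using assms(2)
proof induction
  case zero
  show ?case by (simp add: scale_zero sum_relations.zero)
next
  case (add z s X Y)
  have "Poly_Mapping.map ((*) r) (z + (Poly_Mapping.single (iso_class G H (biset_sum X Y)) s
           - Poly_Mapping.single (iso_class G H X) s - Poly_Mapping.single (iso_class G H Y) s)) =
     Poly_Mapping.map ((*) r) z + (Poly_Mapping.single (iso_class G H (biset_sum X Y)) (r * s)
           - Poly_Mapping.single (iso_class G H X) (r * s) - Poly_Mapping.single (iso_class G H Y) (r * s))"
    by (rule poly_mapping_eqI)
       (simp add: lookup_scale lookup_add lookup_minus lookup_single when_def algebra_simps)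
  then show ?case using sum_relations.add[OF add.IH Z_loc_add_mult(2)[OF assms(1,3) add.hyps(2)] add.hyps(3,4)]
    by simp
qed

lemma sum_relations_uminus:
  assumes "prime p" "z \<in> sum_relations p G H"
  shows "- z \<in> sum_relations p G H"
proof -
  have "Poly_Mapping.map ((*) (- 1)) z = - z" by (rule poly_mapping_eqI) (simp add: lookup_scale)
  then show ?thesis using sum_relations_scale[OF assms, of "- 1"] Z_loc_uminus[OF assms(1), of 1] assms(1) by simp
qed

lemma b_class_eqI:
  assumes "prime p" "x \<in> formal_combs p G H" "y \<in> formal_combs p G H" "x - y \<in> sum_relations p G H"
  shows "b_class p G H x = b_class p G H y"
proof -
  have "y - z \<in> sum_relations p G H" if "x - z \<in> sum_relations p G H" for z
    using sum_relations_add[OF sum_relations_uminus[OF assms(1,4)] that] by simp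
  moreover have "x - z \<in> sum_relations p G H" if "y - z \<in> sum_relations p G H" for z
    using sum_relations_add[OF assms(4) that] by simp
  ultimately show ?thesis using assms(2,3) by (auto simp: b_class_def burnside_rel_def)
qed

lemma b_class_memD: "y \<in> b_class p G H x \<Longrightarrow> y \<in> formal_combs p G H \<and> x - y \<in> sum_relations p G H"
  by (simp add: b_class_def burnside_rel_def)

lemma b_add_b_class:
  assumes "prime p" "x \<in> formal_combs p G H" "y \<in> formal_combs p G H"
  shows "b_add p G H (b_class p G H x) (b_class p G H y) = b_class p G H (x + y)"
proof -
  have "b_class p G H (x' + y') = b_class p G H (x + y)"
    if "x' \<in> b_class p G H x" "y' \<in> b_class p G H y" for x' y'
  proof (rule b_class_eqI[symmetric])
    have "x + y - (x' + y') = (x - x') + (y - y')" by simp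
    then show "x + y - (x' + y') \<in> sum_relations p G H"
      using sum_relations_add that[THEN b_class_memD] by metis
  qed (use assms(1) formal_combs_add[OF assms] formal_combs_add[OF assms(1)
      b_class_memD[OF that(1), THEN conjunct1] b_class_memD[OF that(2), THEN conjunct1]] in simp_all)
  then have "b_add p G H (b_class p G H x) (b_class p G H y) =
      (\<Union>x'\<in>b_class p G H x. \<Union>y'\<in>b_class p G H y. b_class p G H (x + y))"
    unfolding b_add_def by (simp cong: SUP_cong)
  also have "\<dots> = b_class p G H (x + y)"
    using b_class_self[OF assms(2)] b_class_self[OF assms(3)] by (subst (1 2) UN_constant) auto
  finally show ?thesis .
qed

lemma b_smult_b_class:
  assumes "prime p" "x \<in> formal_combs p G H" "r \<in> Z_loc p"
  shows "b_smult p G H r (b_class p G H x) = b_class p G H (Poly_Mapping.map ((*) r) x)"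
proof -
  have "b_class p G H (Poly_Mapping.map ((*) r) x') = b_class p G H (Poly_Mapping.map ((*) r) x)"
    if "x' \<in> b_class p G H x" for x'
  proof (rule b_class_eqI[symmetric])
    have "Poly_Mapping.map ((*) r) x - Poly_Mapping.map ((*) r) x' = Poly_Mapping.map ((*) r) (x - x')"
      by (rule poly_mapping_eqI) (simp add: lookup_scale lookup_minus algebra_simps)
    then show "Poly_Mapping.map ((*) r) x - Poly_Mapping.map ((*) r) x' \<in> sum_relations p G H"
      using sum_relations_scale that[THEN b_class_memD] assms by metis
  qed (use assms(1) formal_combs_scale[OF assms]
      formal_combs_scale[OF assms(1) b_class_memD[OF that, THEN conjunct1] assms(3)] in simp_all)
  then have "b_smult p G H r (b_class p G H x) =
      (\<Union>x'\<in>b_class p G H x. b_class p G H (Poly_Mapping.map ((*) r) x))"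
    unfolding b_smult_def by (simp cong: SUP_cong)
  also have "\<dots> = b_class p G H (Poly_Mapping.map ((*) r) x)"
    using b_class_self[OF assms(2)] by (subst UN_constant) auto
  finally show ?thesis .
qed

lemma sum_single_lookup: "(\<Sum>c\<in>Poly_Mapping.keys x. Poly_Mapping.single c (Poly_Mapping.lookup x c)) = x"
  by (rule poly_mapping_eqI) (simp add: lookup_sum lookup_single when_def in_keys_iff)

lemma b_class_single_sum:
  fixes X Y :: "('g, 'h, nat) biset"
  assumes "prime p" "group G" "group H" "fin_free_biset G H X" "fin_free_biset G H Y"
  shows "b_class p G H (Poly_Mapping.single (iso_class G H (biset_sum X Y)) 1) =
    b_add p G H (b_class p G H (Poly_Mapping.single (iso_class G H X) 1))
      (b_class p G H (Poly_Mapping.single (iso_class G H Y) 1))"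
proof -
  have f: "Poly_Mapping.single (iso_class G H Z) 1 \<in> formal_combs p G H" if "fin_free_biset G H Z"
    for Z :: "('g, 'h, 'z) biset"
    using assms(1-3) that by (intro formal_combs_single iso_class_in_iso_classes) auto
  have "0 + (Poly_Mapping.single (iso_class G H (biset_sum X Y)) 1 - Poly_Mapping.single (iso_class G H X) 1
      - Poly_Mapping.single (iso_class G H Y) 1) \<in> sum_relations p G H"
    using assms by (intro sum_relations.add sum_relations.zero) auto
  then show ?thesis
    unfolding b_add_b_class[OF assms(1) f[OF assms(4)] f[OF assms(5)]]
    using f[OF fin_free_biset_sum[OF assms(4,5)]] f[OF assms(4)] f[OF assms(5)] formal_combs_add assms(1)
    by (intro b_class_eqI) (auto simp: diff_diff_eq)
qed

subsection \<open>The augmentation\<close>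

text \<open>This is |X| / |H|, the number of left orbits, since the mark over an empty index set
  counts all points. Writing it as a mark hands additivity down.\<close>

definition degree_class :: "('g, 'm) monoid_scheme \<Rightarrow> ('h, 'n) monoid_scheme \<Rightarrow> ('g, 'h) biset_class \<Rightarrow> rat"
  where "degree_class G H c = mark c ({} :: unit set) undefined undefined / of_nat (card (carrier H))"

lemma degree_iso_class:
  assumes "group G" "group H" "fin_free_biset G H X"
  shows "degree_class G H (iso_class G H X) = of_nat (card (points X)) / of_nat (card (carrier H))"
  unfolding degree_class_def
  by (subst mark_iso_class[OF assms]) (auto simp: fixpts_def)

lemma additive_degree:
  assumes "group G" "group H"
  shows "additive_on G H (degree_class G H)"
  using additive_mark[OF assms, of undefined "{} :: unit set" undefined]
  by (auto simp: additive_on_def degree_class_def add_divide_distrib)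

lemma (in standard_biset) degree_std:
  "degree_class G H (iso_class G H (std_biset G H K \<phi>)) = of_nat (card (rcosets\<^bsub>G\<^esub> K))"
proof -
  have "card (rcosets\<^bsub>G\<^esub> K) * card K = card (carrier G)" using group.lagrange[OF grpG K] by (simp add: order_def)
  then have "card K * card (points (std_biset G H K \<phi>)) = card K * (card (carrier H) * card (rcosets\<^bsub>G\<^esub> K))"
    using card_points_std by (simp add: mult_ac)
  moreover have "card K \<noteq> 0" using finK subgroup.one_closed[OF K] by auto
  ultimately have "card (points (std_biset G H K \<phi>)) = card (carrier H) * card (rcosets\<^bsub>G\<^esub> K)" by simp
  moreover have "card (carrier H) \<noteq> 0" using finH monoid.one_closed[OF group.is_monoid[OF grpH]] by auto
  ultimately show ?thesis by (simp add: degree_iso_class[OF grpG grpH fin_free_std])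
qed

locale finite_group_pair =
  fixes G :: "('g, 'm) monoid_scheme" and H :: "('h, 'n) monoid_scheme"
  assumes grpG: "group G" and grpH: "group H" and finG: "finite (carrier G)" and finH: "finite (carrier H)"
begin

lemma standard_bisetI: "subgroup K G \<Longrightarrow> \<phi> \<in> hom (sub_group G K) H \<Longrightarrow> standard_biset G H K \<phi>"
  using grpG grpH finG finH by (intro standard_biset.intro)

text \<open>The spanning half of the standard basis: a biset is exhausted orbit by orbit, each orbit
  being isomorphic to some H \<times>_{K,\<phi>} G.\<close>

lemma biset_induct [consumes 1, case_names empty split]:
  fixes X :: "('g, 'h, nat) biset"
  assumes X: "fin_free_biset G H X"
    and empty: "\<And>X :: ('g, 'h, nat) biset. fin_free_biset G H X \<Longrightarrow> points X = {} \<Longrightarrow> Q X"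
    and split: "\<And>(X :: ('g, 'h, nat) biset) (O' :: ('g, 'h, nat) biset) (Y :: ('g, 'h, nat) biset) K \<phi>.
      \<lbrakk>standard_biset G H K \<phi>; fin_free_biset G H X; fin_free_biset G H Y; fin_free_biset G H O';
       biset_isomorphic G H (std_biset G H K \<phi>) O'; biset_isomorphic G H X (biset_sum O' Y); Q Y\<rbrakk> \<Longrightarrow> Q X"
  shows "Q X"
  using X
proof (induction "card (points X)" arbitrary: X rule: less_induct)
  case less
  show ?case
  proof (cases "points X = {}")
    case False
    then obtain x where x: "x \<in> points X" by auto
    obtain K \<phi> and Y :: "('g, 'h, nat) biset" and O' :: "('g, 'h, nat) biset" where
      "standard_biset G H K \<phi>" "fin_free_biset G H Y" "fin_free_biset G H O'"
      "card (points Y) < card (points X)"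
      "biset_isomorphic G H (std_biset G H K \<phi>) O'"
      "biset_isomorphic G H X (biset_sum O' Y)"
      by (rule split_off_orbit[OF grpG grpH finG finH less.prems x])
    then show ?thesis using split less.prems less.hyps by blast
  qed (use less.prems empty in blast)
qed

text \<open>Integrality of |X| / |H| is needed for the augmentation to take values in the local
  integers; each orbit contributes an index.\<close>

lemma degree_nat:
  assumes "c \<in> iso_classes G H"
  shows "\<exists>n :: nat. degree_class G H c = of_nat n"
proof -
  obtain X :: "('g, 'h, nat) biset" where X: "fin_free_biset G H X" "c = iso_class G H X"
    using assms by (rule iso_classesE)
  have "\<exists>n :: nat. degree_class G H (iso_class G H X) = of_nat n"
    using X(1)
  proof (induction rule: biset_induct)
    case (empty X)
    then show ?case by (intro exI[of _ 0]) (simp add: degree_iso_class[OF grpG grpH])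
  next
    case (split X O' Y K \<phi>)
    have "iso_class G H (std_biset G H K \<phi>) = iso_class G H O'"
      using split(1,5) by (intro iso_class_eq fin_free_bisetD(1) standard_biset.fin_free_std)
    moreover have "iso_class G H X = iso_class G H (biset_sum O' Y)"
      using split(2,6) by (intro iso_class_eq fin_free_bisetD(1))
    ultimately have "degree_class G H (iso_class G H X) =
        of_nat (card (rcosets\<^bsub>G\<^esub> K)) + degree_class G H (iso_class G H Y)"
      using additive_degree[OF grpG grpH] split(3,4) standard_biset.degree_std[OF split(1)]
      by (simp add: additive_on_def)
    then show ?case using split.IH by (metis of_nat_add)
  qed
  then show ?thesis using X(2) by simp
qed

end

text \<open>The predicate under the definite description of \<open>augmentation\<close>, named so
  that existence and uniqueness can be treated separately.\<close>

definition is_augmentation :: "nat \<Rightarrow> ('a, 'm) monoid_scheme \<Rightarrow> (('a, 'a) burnside_elt \<Rightarrow> rat) \<Rightarrow> bool"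
  where "is_augmentation p S e \<longleftrightarrow> e \<in> burnside p S S \<rightarrow>\<^sub>E Z_loc p \<and>
    (\<forall>X\<in>burnside p S S. \<forall>Y\<in>burnside p S S. e (b_add p S S X Y) = e X + e Y) \<and>
    (\<forall>r\<in>Z_loc p. \<forall>X\<in>burnside p S S. e (b_smult p S S r X) = r * e X) \<and>
    (\<forall>P \<phi>. subgroup P S \<and> \<phi> \<in> hom (sub_group S P) S \<longrightarrow>
      e (bracket p S S P \<phi>) = of_nat (card (rcosets\<^bsub>S\<^esub> P)))"

text \<open>The uniqueness half: the prescribed values on the brackets determine \<open>e\<close> on
  every biset, one orbit at a time, and linearity does the rest.\<close>

lemma is_augmentation_b_class:
  fixes S :: "('a, 'm) monoid_scheme"
  assumes p: "prime p" and S: "group S" "finite (carrier S)" and e: "is_augmentation p S e"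
    and x: "x \<in> formal_combs p S S"
  shows "e (b_class p S S x) = lin (degree_class S S) x"
proof -
  interpret finite_group_pair S S using S by (intro finite_group_pair.intro)
  have eadd: "e (b_class p S S (x + y)) = e (b_class p S S x) + e (b_class p S S y)"
    if "x \<in> formal_combs p S S" "y \<in> formal_combs p S S" for x y
    using e b_add_b_class[OF p that] that[THEN b_class_in_burnside] unfolding is_augmentation_def by metis
  have esmult: "e (b_class p S S (Poly_Mapping.map ((*) r) x)) = r * e (b_class p S S x)"
    if "x \<in> formal_combs p S S" "r \<in> Z_loc p" for x r
    using e b_smult_b_class[OF p that] b_class_in_burnside[OF that(1)] that(2) unfolding is_augmentation_def by metis
  have f: "Poly_Mapping.single (iso_class S S Z) 1 \<in> formal_combs p S S" if "fin_free_biset S S Z"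
    for Z :: "('a, 'a, 'z) biset"
    using p S that by (intro formal_combs_single iso_class_in_iso_classes) auto
  have base: "e (b_class p S S (Poly_Mapping.single (iso_class S S X) 1)) = degree_class S S (iso_class S S X)"
    if "fin_free_biset S S X" for X :: "('a, 'a, nat) biset"
    using that
  proof (induction rule: biset_induct)
    case (empty X)
    \<comment> \<open>The empty biset is its own double, so additivity forces the value 0.\<close>
    have "biset_isomorphic S S X (biset_sum X X)"
      unfolding biset_isomorphic_def using empty(2) by (auto simp: bij_betw_def biset_sum_def)
    then have "iso_class S S X = iso_class S S (biset_sum X X)"
      using empty(1) by (intro iso_class_eq fin_free_bisetD(1))
    then have "b_class p S S (Poly_Mapping.single (iso_class S S X) 1) =
      b_class p S S (Poly_Mapping.single (iso_class S S X) 1 + Poly_Mapping.single (iso_class S S X) 1)"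
      using b_class_single_sum[OF p S(1) S(1) empty(1) empty(1)] b_add_b_class[OF p f[OF empty(1)] f[OF empty(1)]]
      by simp
    then show ?case using eadd[OF f[OF empty(1)] f[OF empty(1)]] empty(2)
      by (simp add: degree_iso_class[OF S(1) S(1) empty(1)])
  next
    case (split X O' Y K \<phi>)
    have 1: "iso_class S S (std_biset S S K \<phi>) = iso_class S S O'"
      using split(1,5) by (intro iso_class_eq fin_free_bisetD(1) standard_biset.fin_free_std)
    have 2: "iso_class S S X = iso_class S S (biset_sum O' Y)"
      using split(2,6) by (intro iso_class_eq fin_free_bisetD(1))
    have "e (bracket p S S K \<phi>) = of_nat (card (rcosets\<^bsub>S\<^esub> K))"
      using e standard_biset.K[OF split(1)] standard_biset.\<phi>[OF split(1)] unfolding is_augmentation_def by blast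
    then have "e (b_class p S S (Poly_Mapping.single (iso_class S S O') 1)) = degree_class S S (iso_class S S O')"
      unfolding bracket_def 1 using standard_biset.degree_std[OF split(1)] 1 by simp
    moreover have "e (b_class p S S (Poly_Mapping.single (iso_class S S X) 1)) =
      e (b_class p S S (Poly_Mapping.single (iso_class S S O') 1)) + e (b_class p S S (Poly_Mapping.single (iso_class S S Y) 1))"
      unfolding 2 b_class_single_sum[OF p S(1) S(1) split(4,3)] b_add_b_class[OF p f[OF split(4)] f[OF split(3)]]
      using eadd[OF f[OF split(4)] f[OF split(3)]] .
    moreover have "degree_class S S (iso_class S S X) = degree_class S S (iso_class S S O') + degree_class S S (iso_class S S Y)"
      unfolding 2 using additive_degree[OF S(1) S(1)] split(3,4) by (simp add: additive_on_def)
    ultimately show ?case using split.IH by simp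
  qed
  have single: "e (b_class p S S (Poly_Mapping.single c r)) = r * degree_class S S c"
    if c: "c \<in> iso_classes S S" and r: "r \<in> Z_loc p" for c r
  proof -
    obtain X :: "('a, 'a, nat) biset" where X: "fin_free_biset S S X" "c = iso_class S S X"
      using c by (rule iso_classesE)
    have "Poly_Mapping.single c r = Poly_Mapping.map ((*) r) (Poly_Mapping.single c 1)"
      by (rule poly_mapping_eqI) (simp add: lookup_scale lookup_single when_def)
    then show ?thesis using esmult[OF f[OF X(1)] r] base[OF X(1)] X(2) by simp
  qed
  have zero: "e (b_class p S S 0) = 0" using eadd[of 0 0] p by simp
  have fc: "(\<Sum>c\<in>A. Poly_Mapping.single c (Poly_Mapping.lookup x c)) \<in> formal_combs p S S"
    if "A \<subseteq> Poly_Mapping.keys x" for A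
    using x that p by (intro formal_combs_sum formal_combs_single) (auto simp: formal_combs_def)
  have "e (b_class p S S (\<Sum>c\<in>A. Poly_Mapping.single c (Poly_Mapping.lookup x c))) =
      (\<Sum>c\<in>A. Poly_Mapping.lookup x c * degree_class S S c)" if "finite A" "A \<subseteq> Poly_Mapping.keys x" for A
    using that
  proof (induction A)
    case (insert c A)
    have "c \<in> iso_classes S S" "Poly_Mapping.lookup x c \<in> Z_loc p" using insert.prems x by (auto simp: formal_combs_def)
    then show ?case
      using insert fc[of A] eadd[OF formal_combs_single[OF p, of c] fc[of A]] single by simp
  qed (simp add: zero)
  from this[of "Poly_Mapping.keys x"] show ?thesis by (simp add: sum_single_lookup lin_def)
qed

text \<open>The linear extension of the orbit count satisfies the defining conditions, and by
  uniqueness it is the only such function; this evaluates the definite description.\<close>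

lemma augmentation_eq:
  fixes S :: "('a, 'm) monoid_scheme"
  assumes p: "prime p" and S: "group S" "finite (carrier S)" and X: "X \<in> burnside p S S" "x \<in> X"
  shows "augmentation p S X = lin (degree_class S S) x"
proof -
  interpret finite_group_pair S S using S by (intro finite_group_pair.intro)
  define e0 where "e0 = (\<lambda>X\<in>burnside p S S. lin (degree_class S S) (SOME x. x \<in> X))"
  note ad = additive_degree[OF S(1) S(1)]
  have e0: "e0 (b_class p S S x) = lin (degree_class S S) x" if "x \<in> formal_combs p S S" for x
  proof -
    have "(SOME y. y \<in> b_class p S S x) \<in> b_class p S S x" using b_class_self[OF that] by (rule someI)
    then show ?thesis using b_class_in_burnside[OF that] b_class_lin[OF ad] by (simp add: e0_def)
  qed
  have in_Z: "lin (degree_class S S) x \<in> Z_loc p" if "x \<in> formal_combs p S S" for x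
    unfolding lin_def
  proof (rule Z_loc_sum[OF p])
    fix c assume "c \<in> Poly_Mapping.keys x"
    then have "c \<in> iso_classes S S" "Poly_Mapping.lookup x c \<in> Z_loc p" using that by (auto simp: formal_combs_def)
    then show "Poly_Mapping.lookup x c * degree_class S S c \<in> Z_loc p"
      using degree_nat Z_loc_add_mult(2)[OF p] Z_loc_of_nat[OF p] by metis
  qed
  have "is_augmentation p S e0"
    unfolding is_augmentation_def
  proof (intro conjI ballI allI impI)
    show "e0 \<in> burnside p S S \<rightarrow>\<^sub>E Z_loc p"
    proof (rule PiE_I)
      show "e0 X \<in> Z_loc p" if "X \<in> burnside p S S" for X
        using that by (rule burnsideE) (simp add: e0 in_Z)
    qed (simp add: e0_def)
    show "e0 (b_add p S S X Y) = e0 X + e0 Y" if X: "X \<in> burnside p S S" and Y: "Y \<in> burnside p S S" for X Y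
    proof -
      obtain x where x: "x \<in> formal_combs p S S" "X = b_class p S S x" using X by (rule burnsideE)
      obtain y where y: "y \<in> formal_combs p S S" "Y = b_class p S S y" using Y by (rule burnsideE)
      show ?thesis using x y e0 by (simp add: b_add_b_class p formal_combs_add lin_add)
    qed
    show "e0 (b_smult p S S r X) = r * e0 X" if r: "r \<in> Z_loc p" and X: "X \<in> burnside p S S" for r X
    proof -
      obtain x where x: "x \<in> formal_combs p S S" "X = b_class p S S x" using X by (rule burnsideE)
      show ?thesis using x r e0 by (simp add: b_smult_b_class p formal_combs_scale lin_scale)
    qed
    show "e0 (bracket p S S P \<phi>) = of_nat (card (rcosets\<^bsub>S\<^esub> P))" if P: "subgroup P S \<and> \<phi> \<in> hom (sub_group S P) S" for P \<phi>
    proof -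
      interpret standard_biset S S P \<phi> using P by (intro standard_bisetI) auto
      have "Poly_Mapping.single (iso_class S S (std_biset S S P \<phi>)) 1 \<in> formal_combs p S S"
        using p S(1) fin_free_std by (intro formal_combs_single iso_class_in_iso_classes) auto
      then show ?thesis unfolding bracket_def by (simp add: e0 degree_std)
    qed
  qed
  moreover have "e = e0" if "is_augmentation p S e" for e
  proof (rule extensionalityI[of _ "burnside p S S"])
    show "e \<in> extensional (burnside p S S)" using that by (auto simp: is_augmentation_def PiE_def)
    show "e0 \<in> extensional (burnside p S S)" by (simp add: e0_def)
    show "e X = e0 X" if "X \<in> burnside p S S" for X
      using that by (rule burnsideE) (simp add: e0 is_augmentation_b_class[OF p S \<open>is_augmentation p S e\<close>])
  qed
  ultimately have "(THE e. is_augmentation p S e) = e0" by (rule the_equality)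
  then have "augmentation p S = e0" unfolding augmentation_def is_augmentation_def by simp
  moreover obtain x0 where "x0 \<in> formal_combs p S S" "X = b_class p S S x0" using X(1) by (rule burnsideE)
  ultimately show ?thesis using e0 b_class_lin[OF ad] X(2) by simp
qed

subsection \<open>Marks separate standard bases\<close>

context finite_group_pair
begin

lemma mark_std_nonzero_iff:
  assumes "standard_biset G H K' \<phi>'" "\<alpha> \<in> P \<rightarrow> carrier G" "\<beta> \<in> P \<rightarrow> carrier H"
  shows "mark (iso_class G H (std_biset G H K' \<phi>')) P \<alpha> \<beta> \<noteq> 0 \<longleftrightarrow> fixpts (std_biset G H K' \<phi>') P \<alpha> \<beta> \<noteq> {}"
proof -
  note ff = standard_biset.fin_free_std[OF assms(1)]
  have "finite (fixpts (std_biset G H K' \<phi>') P \<alpha> \<beta>)"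
    using fin_free_bisetD(2)[OF ff] by (simp add: fixpts_def)
  then show ?thesis using mark_iso_class[OF grpG grpH ff assms(2,3)] by simp
qed

text \<open>Take K of largest order in the support of d. By triangularity no other key has a nonzero
  mark at (K, \<phi>), so the mark of d there is a nonzero coefficient times a nonzero diagonal
  entry. The predicate \<open>R\<close> restricts the admissible representatives and is handed back
  for the pair that is found.\<close>

lemma maximal_key_mark:
  assumes "d \<noteq> 0"
    and keys: "\<And>c. c \<in> Poly_Mapping.keys d \<Longrightarrow> \<exists>K \<phi>. R K \<phi> \<and> c = iso_class G H (std_biset G H K \<phi>)"
    and R: "\<And>K \<phi>. R K \<phi> \<Longrightarrow> standard_biset G H K \<phi>"
  shows "\<exists>K \<phi>. R K \<phi> \<and> lin (\<lambda>c. mark c K (\<lambda>x. x) \<phi>) d \<noteq> 0"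
proof -
  let ?cl = "\<lambda>K \<phi>. iso_class G H (std_biset G H K \<phi>)"
  define Q where "Q = (\<lambda>(K, \<phi>). R K \<phi> \<and> ?cl K \<phi> \<in> Poly_Mapping.keys d)"
  obtain c0 where "c0 \<in> Poly_Mapping.keys d" using assms(1) by (metis equals0I keys_eq_empty)
  then obtain K0 \<phi>0 where "Q (K0, \<phi>0)" using keys unfolding Q_def by force
  moreover have "\<forall>y. Q y \<longrightarrow> card (fst y) \<le> card (carrier G)"
  proof (intro allI impI)
    fix y assume "Q y"
    then have "standard_biset G H (fst y) (snd y)" using R unfolding Q_def by (cases y) auto
    then have "subgroup (fst y) G" by (rule standard_biset.K)
    then show "card (fst y) \<le> card (carrier G)" by (intro card_mono finG subgroup.subset)
  qed
  \<comment> \<open>The principle for a greatest value wants a strict bound, hence the successor of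
    |G|.\<close>
  ultimately obtain y where y: "Q y" "\<And>z. Q z \<Longrightarrow> card (fst z) \<le> card (fst y)"
    using ex_has_greatest_nat[of Q "(K0, \<phi>0)" "\<lambda>y. card (fst y)" "Suc (card (carrier G))"]
    by (metis le_imp_less_Suc)
  obtain K \<phi> where yK: "y = (K, \<phi>)" by force
  then have RK: "R K \<phi>" "?cl K \<phi> \<in> Poly_Mapping.keys d" using y(1) by (auto simp: Q_def)
  interpret standard_biset G H K \<phi> using R[OF RK(1)] .
  have fn: "(\<lambda>x. x) \<in> K \<rightarrow> carrier G" "\<phi> \<in> K \<rightarrow> carrier H" using K_sub \<phi>_closed by auto
  have "mark c K (\<lambda>x. x) \<phi> = 0" if c: "c \<in> Poly_Mapping.keys d" "c \<noteq> ?cl K \<phi>" for c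
  proof (rule ccontr)
    assume nz: "mark c K (\<lambda>x. x) \<phi> \<noteq> 0"
    obtain K' \<phi>' where K': "R K' \<phi>'" "c = ?cl K' \<phi>'" using keys[OF c(1)] by blast
    have "card K' \<le> card K" using y(2)[of "(K', \<phi>')"] K' c(1) yK by (simp add: Q_def)
    then have "?cl K \<phi> = ?cl K' \<phi>'"
      using nz mark_std_nonzero_iff[OF R[OF K'(1)] fn] K'(2)
      by (intro iso_class_std_eq[OF R[OF RK(1)] R[OF K'(1)]]) auto
    then show False using c(2) K'(2) by simp
  qed
  then have "lin (\<lambda>c. mark c K (\<lambda>x. x) \<phi>) d =
     (\<Sum>c\<in>{?cl K \<phi>}. Poly_Mapping.lookup d c * mark c K (\<lambda>x. x) \<phi>)"
    unfolding lin_def using RK(2) by (intro sum.mono_neutral_right) auto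
  moreover have "mark (?cl K \<phi>) K (\<lambda>x. x) \<phi> \<noteq> 0"
    using mark_std_nonzero_iff[OF R[OF RK(1)] fn] std_biset_fixpt_self[OF R[OF RK(1)]] by simp
  ultimately show ?thesis using RK by (intro exI[of _ K] exI[of _ \<phi>]) (simp add: in_keys_iff)
qed

text \<open>The independence half of the standard basis: marks are invariants of the Burnside class,
  so they vanish on the difference of two expansions, and \<open>maximal_key_mark\<close> excludes a
  nonzero difference.\<close>

lemma std_expansion_unique:
  assumes X: "X \<in> burnside p G H" "x \<in> X" "x' \<in> X"
    and k: "Poly_Mapping.keys x \<subseteq> std_classes G H" "Poly_Mapping.keys x' \<subseteq> std_classes G H"
  shows "x = x'"
proof (rule ccontr)
  assume "x \<noteq> x'"
  then have "x - x' \<noteq> 0" by simp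
  moreover have "\<exists>K \<phi>. standard_biset G H K \<phi> \<and> c = iso_class G H (std_biset G H K \<phi>)"
    if "c \<in> Poly_Mapping.keys (x - x')" for c
  proof -
    have "c \<in> Poly_Mapping.keys x \<union> Poly_Mapping.keys x'" using that by (auto simp: in_keys_iff lookup_minus)
    then have "c \<in> std_classes G H" using k by auto
    then show ?thesis unfolding std_classes_def using standard_bisetI by blast
  qed
  ultimately obtain K \<phi> where std: "standard_biset G H K \<phi>" and nz: "lin (\<lambda>c. mark c K (\<lambda>x. x) \<phi>) (x - x') \<noteq> 0"
    using maximal_key_mark[of "x - x'" "standard_biset G H"] by blast
  interpret standard_biset G H K \<phi> by fact
  have "lin (\<lambda>c. mark c K (\<lambda>x. x) \<phi>) x = lin (\<lambda>c. mark c K (\<lambda>x. x) \<phi>) x'"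
    using K_sub \<phi>_closed by (intro burnside_lin[OF X] additive_mark grpG grpH) auto
  then show False using nz by (simp add: lin_diff)
qed

text \<open>Uniqueness replaces the definite description in \<open>chi\<close> by whichever
  expansion is at hand.\<close>

lemma chi_eq:
  assumes "X \<in> burnside p G H" "x \<in> X" "Poly_Mapping.keys x \<subseteq> std_classes G H"
  shows "chi G H K \<phi> X = Poly_Mapping.lookup x (iso_class G H (std_biset G H K \<phi>))"
proof -
  have "(THE x. x \<in> X \<and> Poly_Mapping.keys x \<subseteq> std_classes G H) = x"
    using assms std_expansion_unique[OF assms(1)] by (intro the_equality) auto
  then show ?thesis by (simp add: chi_def)
qed

end

subsection \<open>Points fixed up to the left action\<close>

text \<open>The points whose left orbit is fixed by G, that is, the preimage of the G-fixed points
  in the set of left orbits.\<close>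

definition left_fixed :: "('g, 'm) monoid_scheme \<Rightarrow> ('h, 'n) monoid_scheme \<Rightarrow> ('g, 'h, 'x) biset \<Rightarrow> 'x set"
  where "left_fixed G H X = {x \<in> points X. \<forall>g\<in>carrier G. \<exists>h\<in>carrier H. ract X x g = lact X h x}"

lemma card_left_fixed_iso:
  assumes "is_biset G H X" "biset_isomorphic G H X Y"
  shows "card (left_fixed G H X) = card (left_fixed G H Y)"
proof -
  obtain f where f: "bij_betw f (points X) (points Y)"
    "\<And>x h. x \<in> points X \<Longrightarrow> h \<in> carrier H \<Longrightarrow> f (lact X h x) = lact Y h (f x)"
    "\<And>x g. x \<in> points X \<Longrightarrow> g \<in> carrier G \<Longrightarrow> f (ract X x g) = ract Y (f x) g"
    using assms(2) unfolding biset_isomorphic_def by blast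
  have inj: "inj_on f (points X)" and im: "points Y = f ` points X" using f(1) by (auto simp: bij_betw_def)
  have "ract Y (f x) g = lact Y h (f x) \<longleftrightarrow> ract X x g = lact X h x"
    if x: "x \<in> points X" and "g \<in> carrier G" "h \<in> carrier H" for x g h
    using f(2)[OF x that(3)] f(3)[OF x that(2)] inj is_bisetD(1,4)[OF assms(1) x] that(2,3)
    by (metis inj_on_eq_iff)
  then have "f x \<in> left_fixed G H Y \<longleftrightarrow> x \<in> left_fixed G H X" if "x \<in> points X" for x
    using that im unfolding left_fixed_def by auto
  then have "left_fixed G H Y = f ` left_fixed G H X" using im unfolding left_fixed_def by auto
  moreover have "inj_on f (left_fixed G H X)" using inj by (rule inj_on_subset) (auto simp: left_fixed_def)
  ultimately show ?thesis by (simp add: card_image)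
qed

lemma card_left_fixed_sum:
  assumes "finite (points X)" "finite (points Y)"
  shows "card (left_fixed G H (biset_sum X Y)) = card (left_fixed G H X) + card (left_fixed G H Y)"
proof -
  have "left_fixed G H (biset_sum X Y) = left_fixed G H X <+> left_fixed G H Y"
    by (auto simp: left_fixed_def biset_sum_def)
  moreover have "finite (left_fixed G H X)" "finite (left_fixed G H Y)"
    using assms by (auto simp: left_fixed_def)
  ultimately show ?thesis by (simp add: card_Plus)
qed

lemma biset_isomorphic_card: "biset_isomorphic G H X Y \<Longrightarrow> card (points X) = card (points Y)"
  unfolding biset_isomorphic_def by (auto dest: bij_betw_same_card)

text \<open>Modulo the left action this is the fixed point congruence for the action of a \<open>p\<close>-group.\<close>

lemma (in finite_group_pair) left_fixed_congruence:
  fixes X :: "('g, 'h, nat) biset"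
  assumes p: "prime p" and ord: "card (carrier G) = p ^ n" and X: "fin_free_biset G H X"
  shows "\<exists>k. card (points X) = card (left_fixed G H X) + p * card (carrier H) * k"
  using X
proof (induction rule: biset_induct)
  case (empty X)
  then show ?case by (simp add: left_fixed_def)
next
  case (split X O' Y K \<phi>)
  interpret standard_biset G H K \<phi> by (rule split(1))
  interpret G: group G by (rule grpG)
  interpret H: group H by (rule grpH)
  let ?B = "std_biset G H K \<phi>"
  have K0: "card K > 0" using finK subgroup.one_closed[OF K] by (auto simp: card_gt_0_iff)
  \<comment> \<open>If K is all of G, then every point is fixed up to the left action. Otherwise
    none is, and the number of points is |H| times the index of K, a nontrivial power of p.\<close>
  have "\<exists>k. card (points ?B) = card (left_fixed G H ?B) + p * card (carrier H) * k"
  proof (cases "K = carrier G")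
    case True
    have "x \<in> left_fixed G H ?B" if x: "x \<in> points ?B" for x
    proof -
      obtain h g where hg: "h \<in> carrier H" "g \<in> carrier G" "x = std_pt G H K \<phi> h g" using x by (rule std_ptE)
      have "\<exists>v\<in>carrier H. ract ?B x u = lact ?B v x" if "u \<in> carrier G" for u
      proof (intro bexI)
        show "ract ?B x u = lact ?B (h \<otimes>\<^bsub>H\<^esub> \<phi> (g \<otimes>\<^bsub>G\<^esub> u \<otimes>\<^bsub>G\<^esub> inv\<^bsub>G\<^esub> g) \<otimes>\<^bsub>H\<^esub> inv\<^bsub>H\<^esub> h) x"
          unfolding hg(3) using hg(1,2) that True \<phi>_closed by (subst std_pt_ract_eq_lact_iff) auto
      qed (use hg that True \<phi>_closed in auto)
      then show ?thesis using x by (simp add: left_fixed_def)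
    qed
    then have "left_fixed G H ?B = points ?B" by (auto simp: left_fixed_def)
    then show ?thesis by (intro exI[of _ 0]) simp
  next
    case False
    have "left_fixed G H ?B = {}"
    proof (rule ccontr)
      assume "left_fixed G H ?B \<noteq> {}"
      then obtain x where x: "x \<in> points ?B" "\<forall>u\<in>carrier G. \<exists>v\<in>carrier H. ract ?B x u = lact ?B v x"
        by (auto simp: left_fixed_def)
      obtain h g where hg: "h \<in> carrier H" "g \<in> carrier G" "x = std_pt G H K \<phi> h g" using x(1) by (rule std_ptE)
      have "k \<in> K" if k: "k \<in> carrier G" for k
      proof -
        have u: "inv\<^bsub>G\<^esub> g \<otimes>\<^bsub>G\<^esub> k \<otimes>\<^bsub>G\<^esub> g \<in> carrier G" using k hg by simp
        then obtain v where "v \<in> carrier H" "ract ?B x (inv\<^bsub>G\<^esub> g \<otimes>\<^bsub>G\<^esub> k \<otimes>\<^bsub>G\<^esub> g) = lact ?B v x" using x(2) by blast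
        then have "g \<otimes>\<^bsub>G\<^esub> (inv\<^bsub>G\<^esub> g \<otimes>\<^bsub>G\<^esub> k \<otimes>\<^bsub>G\<^esub> g) \<otimes>\<^bsub>G\<^esub> inv\<^bsub>G\<^esub> g \<in> K"
          using std_pt_ract_eq_lact_iff[OF hg(1,2) u] hg(3) by simp
        moreover have "g \<otimes>\<^bsub>G\<^esub> (inv\<^bsub>G\<^esub> g \<otimes>\<^bsub>G\<^esub> k \<otimes>\<^bsub>G\<^esub> g) \<otimes>\<^bsub>G\<^esub> inv\<^bsub>G\<^esub> g = k"
        proof -
          have "g \<otimes>\<^bsub>G\<^esub> (inv\<^bsub>G\<^esub> g \<otimes>\<^bsub>G\<^esub> k \<otimes>\<^bsub>G\<^esub> g) \<otimes>\<^bsub>G\<^esub> inv\<^bsub>G\<^esub> g =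
             (g \<otimes>\<^bsub>G\<^esub> inv\<^bsub>G\<^esub> g) \<otimes>\<^bsub>G\<^esub> k \<otimes>\<^bsub>G\<^esub> (g \<otimes>\<^bsub>G\<^esub> inv\<^bsub>G\<^esub> g)"
            using hg k by (simp only: G.m_assoc G.m_closed G.inv_closed)
          then show ?thesis using hg k by simp
        qed
        ultimately show ?thesis by simp
      qed
      then show False using False K_sub by blast
    qed
    moreover have "\<exists>k. card (points ?B) = p * card (carrier H) * k"
    proof -
      have lag: "card (rcosets\<^bsub>G\<^esub> K) * card K = p ^ n" using G.lagrange[OF K] ord by (simp add: order_def)
      have "card (rcosets\<^bsub>G\<^esub> K) dvd p ^ n" using lag by (metis dvd_triv_left)
      then obtain j where j: "card (rcosets\<^bsub>G\<^esub> K) = p ^ j" using p by (meson divides_primepow_nat)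
      have "j \<noteq> 0"
      proof
        assume "j = 0"
        then have "card K = card (carrier G)" using j lag ord by simp
        then show False using False finG K subgroup.subset card_subset_eq by metis
      qed
      then obtain i where i: "j = Suc i" by (cases j) auto
      have "card K * card (points ?B) = card K * (p * card (carrier H) * p ^ i)"
      proof -
        have "card K * card (points ?B) = card (carrier H) * (p ^ Suc i * card K)"
          using card_points_std lag j i ord by simp
        then show ?thesis by (simp add: algebra_simps)
      qed
      then have "card (points ?B) = p * card (carrier H) * p ^ i" using K0 by simp
      then show ?thesis by blast
    qed
    ultimately show ?thesis by simp
  qed
  then obtain k where k: "card (points O') = card (left_fixed G H O') + p * card (carrier H) * k"
    using card_left_fixed_iso[OF fin_free_bisetD(1)[OF fin_free_std] split(5)] biset_isomorphic_card[OF split(5)]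
    by auto
  obtain k' where k': "card (points Y) = card (left_fixed G H Y) + p * card (carrier H) * k'" using split.IH by blast
  have fin: "finite (points O')" "finite (points Y)" using split(3,4) by (auto dest: fin_free_bisetD(2))
  have "card (points X) = card (points O') + card (points Y)"
    using biset_isomorphic_card[OF split(6)] fin by (simp add: biset_sum_def card_Plus)
  moreover have "card (left_fixed G H X) = card (left_fixed G H O') + card (left_fixed G H Y)"
    using card_left_fixed_iso[OF fin_free_bisetD(1)[OF split(2)] split(6)] card_left_fixed_sum[OF fin] by metis
  ultimately show ?case using k k' by (intro exI[of _ "k + k'"]) (simp add: algebra_simps)
qed

section \<open>Fusion systems\<close>

lemma card_pairset_fibres:
  assumes "finite (points X)" "finite (points Y)"
  shows "card (pairset H X Y P \<alpha> \<beta>) = (\<Sum>y\<in>points Y. card {x \<in> points X. (x, y) \<in> pairset H X Y P \<alpha> \<beta>})"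
    and "card (pairset H X Y P \<alpha> \<beta>) = (\<Sum>x\<in>points X. card {y \<in> points Y. (x, y) \<in> pairset H X Y P \<alpha> \<beta>})"
proof -
  let ?A = "SIGMA y:points Y. {x \<in> points X. (x, y) \<in> pairset H X Y P \<alpha> \<beta>}"
  have "pairset H X Y P \<alpha> \<beta> = prod.swap ` ?A"
    by (force simp: pairset_def)
  moreover have "card (prod.swap ` ?A) = card ?A" by (rule card_image) simp
  ultimately have "card (pairset H X Y P \<alpha> \<beta>) = card ?A" by simp
  then show "card (pairset H X Y P \<alpha> \<beta>) = (\<Sum>y\<in>points Y. card {x \<in> points X. (x, y) \<in> pairset H X Y P \<alpha> \<beta>})"
    using assms by simp
  have "pairset H X Y P \<alpha> \<beta> = (SIGMA x:points X. {y \<in> points Y. (x, y) \<in> pairset H X Y P \<alpha> \<beta>})"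
    by (auto simp: pairset_def)
  then have "card (pairset H X Y P \<alpha> \<beta>) = card (SIGMA x:points X. {y \<in> points Y. (x, y) \<in> pairset H X Y P \<alpha> \<beta>})"
    by simp
  then show "card (pairset H X Y P \<alpha> \<beta>) = (\<Sum>x\<in>points X. card {y \<in> points Y. (x, y) \<in> pairset H X Y P \<alpha> \<beta>})"
    using assms by simp
qed

text \<open>A point carries only one homomorphism, by freeness. Extensionality on P turns agreement
  on P into equality of functions.\<close>

lemma disjoint_fixpts:
  assumes "group H" "fin_free_biset G H X" "\<psi> \<in> P \<rightarrow>\<^sub>E carrier H" "\<psi>' \<in> P \<rightarrow>\<^sub>E carrier H" "\<psi> \<noteq> \<psi>'"
  shows "fixpts X P \<alpha> \<psi> \<inter> fixpts X P \<alpha> \<psi>' = {}"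
proof (rule ccontr)
  assume "\<not> ?thesis"
  then obtain x where x: "x \<in> fixpts X P \<alpha> \<psi>" "x \<in> fixpts X P \<alpha> \<psi>'" by auto
  have "\<psi> q = \<psi>' q" if q: "q \<in> P" for q
  proof (rule lact_inj[OF assms(1,2), of x])
    show "\<psi> q \<in> carrier H" "\<psi>' q \<in> carrier H" using assms(3,4) q by auto
    show "lact X (\<psi> q) x = lact X (\<psi>' q) x" using x q by (simp add: fixpts_def)
  qed (use x in \<open>simp add: fixpts_def\<close>)
  then have "\<psi> = \<psi>'" using PiE_ext[OF assms(3,4)] by blast
  then show False using assms(5) by simp
qed

locale finite_fusion_system =
  fixes S :: "('a, 'm) monoid_scheme" (structure) and F :: "'a homsets"
  assumes grp: "group S" and fin: "finite (carrier S)" and fus: "fusion_system S F"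
begin

sublocale group S by (rule grp)
sublocale SS: finite_group_pair S S using grp fin by (intro finite_group_pair.intro)

abbreviation C where "C \<equiv> carrier S"
abbreviation cls where "cls P \<phi> \<equiv> iso_class S S (std_biset S S P \<phi>)"

lemma F_subgroup: "\<phi> \<in> F P Q \<Longrightarrow> subgroup P S" "\<phi> \<in> F P Q \<Longrightarrow> subgroup Q S"
  using fus unfolding fusion_system_def by blast+

lemma F_Inj: "\<phi> \<in> F P Q \<Longrightarrow> \<phi> \<in> Inj S P Q"
  using fus F_subgroup unfolding fusion_system_def by blast

lemma F_ext: "\<phi> \<in> F P Q \<Longrightarrow> \<phi> \<in> extensional P"
  and F_inj: "\<phi> \<in> F P Q \<Longrightarrow> inj_on \<phi> P"
  and F_into: "\<phi> \<in> F P Q \<Longrightarrow> q \<in> P \<Longrightarrow> \<phi> q \<in> Q"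
  and F_mult: "\<phi> \<in> F P Q \<Longrightarrow> q \<in> P \<Longrightarrow> r \<in> P \<Longrightarrow> \<phi> (q \<otimes> r) = \<phi> q \<otimes> \<phi> r"
  by (auto dest!: F_Inj simp: Inj_def mon_def hom_def)

lemma F_hom: "\<phi> \<in> F P C \<Longrightarrow> \<phi> \<in> hom (sub_group S P) S"
  by (auto simp: hom_def F_into F_mult)

lemma F_PiE: "\<phi> \<in> F P C \<Longrightarrow> \<phi> \<in> P \<rightarrow>\<^sub>E C"
  by (auto simp: PiE_def F_into F_ext)

lemma F_Homs: "\<phi> \<in> F P C \<Longrightarrow> \<phi> \<in> Homs S P C"
  by (auto simp: Homs_def hom_def F_into F_mult F_ext)

lemma F_std: "\<phi> \<in> F P C \<Longrightarrow> standard_biset S S P \<phi>"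
  by (intro SS.standard_bisetI F_subgroup(1) F_hom)

lemma subgroup_finite: "subgroup P S \<Longrightarrow> finite P"
  using fin subgroup.subset finite_subset by metis

lemma finite_F: "finite (F P C)"
proof (cases "F P C = {}")
  case False
  then have "finite P" using F_subgroup(1) subgroup_finite by blast
  then have "finite (P \<rightarrow>\<^sub>E C)" using fin by (intro finite_PiE) auto
  then show ?thesis using F_PiE by (auto intro: finite_subset)
qed simp

lemma F_comp: "\<phi> \<in> F P Q \<Longrightarrow> \<psi> \<in> F Q R \<Longrightarrow> compose P \<psi> \<phi> \<in> F P R"
  using fus unfolding fusion_system_def by blast

lemma F_image: "\<phi> \<in> F P Q \<Longrightarrow> \<phi> \<in> F P (\<phi> ` P)"
  and F_inverse: "\<phi> \<in> F P Q \<Longrightarrow> inv_map P \<phi> \<in> F (\<phi> ` P) P"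
  using fus unfolding fusion_system_def by blast+

lemma F_conj_map:
  assumes "subgroup P S" "subgroup Q S" "g \<in> C" "\<And>x. x \<in> P \<Longrightarrow> g \<otimes> x \<otimes> inv g \<in> Q"
  shows "conj_map S P g \<in> F P Q"
proof -
  have "conj_map S P g \<in> Hom_conj S P Q"
    unfolding Hom_conj_def using assms by (auto simp: conj_map_def)
  then show ?thesis using fus assms(1,2) unfolding fusion_system_def by blast
qed

lemma F_incl:
  assumes "subgroup P S" "subgroup Q S" "P \<subseteq> Q"
  shows "(\<lambda>x\<in>P. x) \<in> F P Q"
proof -
  have "conj_map S P \<one> = (\<lambda>x\<in>P. x)"
    using subgroup.mem_carrier[OF assms(1)] by (auto simp: conj_map_def)
  moreover have "conj_map S P \<one> \<in> F P Q"
    using assms subgroup.mem_carrier[OF assms(1)] by (intro F_conj_map) auto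
  ultimately show ?thesis by simp
qed

lemma F_mono:
  assumes "\<phi> \<in> F P Q" "subgroup R S" "\<phi> ` P \<subseteq> R"
  shows "\<phi> \<in> F P R"
proof -
  have "compose P (\<lambda>x\<in>\<phi> ` P. x) \<phi> \<in> F P R"
    using F_image[OF assms(1)] F_subgroup assms(2,3) by (intro F_comp[of _ P "\<phi> ` P"] F_incl) blast+
  moreover have "compose P (\<lambda>x\<in>\<phi> ` P. x) \<phi> = \<phi>"
    using F_ext[OF assms(1)] by (auto simp: compose_def extensional_def fun_eq_iff)
  ultimately show ?thesis by simp
qed

lemma F_restrict:
  assumes "\<phi> \<in> F P Q" "subgroup P' S" "P' \<subseteq> P"
  shows "restrict \<phi> P' \<in> F P' Q"
proof -
  have "compose P' \<phi> (\<lambda>x\<in>P'. x) \<in> F P' Q"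
    using assms F_subgroup by (intro F_comp[of _ P' P] F_incl) auto
  moreover have "compose P' \<phi> (\<lambda>x\<in>P'. x) = restrict \<phi> P'"
    by (auto simp: compose_def fun_eq_iff)
  ultimately show ?thesis by simp
qed

text \<open>These are the maps carried by the point (h, g) of [Q, \<psi>]; they lie in F because
  conjugations by elements of S do.\<close>

lemma F_twist:
  assumes "\<psi> \<in> F Q C" "h \<in> C" "g \<in> C" "subgroup P S" "\<And>q. q \<in> P \<Longrightarrow> g \<otimes> q \<otimes> inv g \<in> Q"
  shows "(\<lambda>q\<in>P. h \<otimes> \<psi> (g \<otimes> q \<otimes> inv g) \<otimes> inv h) \<in> F P C"
proof -
  have "conj_map S P g \<in> F P Q" using assms F_subgroup by (intro F_conj_map) auto
  moreover have "conj_map S C h \<in> F C C" using assms subgroup_self by (intro F_conj_map) auto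
  ultimately have "compose P (conj_map S C h) (compose P \<psi> (conj_map S P g)) \<in> F P C"
    using assms(1) F_comp by blast
  moreover have "compose P (conj_map S C h) (compose P \<psi> (conj_map S P g)) =
     (\<lambda>q\<in>P. h \<otimes> \<psi> (g \<otimes> q \<otimes> inv g) \<otimes> inv h)"
    using assms(5) F_into[OF assms(1)] by (auto simp: compose_def conj_map_def fun_eq_iff)
  ultimately show ?thesis by simp
qed

lemma mark_std_nonzeroE:
  assumes "standard_biset S S Q \<psi>" "subgroup P S" "\<phi> \<in> P \<rightarrow> C" "mark (cls Q \<psi>) P (\<lambda>x. x) \<phi> \<noteq> 0"
  obtains h g where "h \<in> C" "g \<in> C" "\<And>q. q \<in> P \<Longrightarrow> g \<otimes> q \<otimes> inv g \<in> Q"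
    "\<And>q. q \<in> P \<Longrightarrow> \<phi> q = h \<otimes> \<psi> (g \<otimes> q \<otimes> inv g) \<otimes> inv h"
proof -
  interpret Q: standard_biset S S Q \<psi> by fact
  have id: "(\<lambda>x. x) \<in> P \<rightarrow> C" using subgroup.mem_carrier[OF assms(2)] by auto
  obtain y where y: "y \<in> fixpts (std_biset S S Q \<psi>) P (\<lambda>x. x) \<phi>"
    using assms(4) SS.mark_std_nonzero_iff[OF assms(1) id assms(3)] by auto
  then have "y \<in> points (std_biset S S Q \<psi>)" by (simp add: fixpts_def)
  then obtain h g where hg: "h \<in> C" "g \<in> C" "y = std_pt S S Q \<psi> h g" by (rule Q.std_ptE)
  then show ?thesis using that y Q.std_pt_fixed_iff[OF hg(1,2) id assms(3)] by blast
qed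

text \<open>A nonzero mark exhibits \<open>\<phi>\<close> as a twist of a restriction of
  \<open>\<psi>\<close>. This is how generation by F confines the marks to F.\<close>

lemma mark_in_F:
  assumes "\<psi> \<in> F Q C" "subgroup P S" "\<phi> \<in> P \<rightarrow>\<^sub>E C" "mark (cls Q \<psi>) P (\<lambda>x. x) \<phi> \<noteq> 0"
  shows "\<phi> \<in> F P C"
proof -
  obtain h g where hg: "h \<in> C" "g \<in> C" "\<And>q. q \<in> P \<Longrightarrow> g \<otimes> q \<otimes> inv g \<in> Q"
    "\<And>q. q \<in> P \<Longrightarrow> \<phi> q = h \<otimes> \<psi> (g \<otimes> q \<otimes> inv g) \<otimes> inv h"
    using mark_std_nonzeroE[OF F_std[OF assms(1)] assms(2) _ assms(4)] assms(3) by blast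
  have "\<phi> = (\<lambda>q\<in>P. h \<otimes> \<psi> (g \<otimes> q \<otimes> inv g) \<otimes> inv h)"
    using hg(4) assms(3) by (auto simp: fun_eq_iff PiE_def extensional_def)
  then show ?thesis using F_twist[OF assms(1) hg(1,2) assms(2) hg(3)] by simp
qed

text \<open>The homomorphism carried by such a point could be any map from P to S; on a basis
  element coming from F it is a twist of a morphism, so the union may run over F alone.\<close>

lemma left_fixed_std:
  assumes "\<psi> \<in> F Q C" "subgroup P S"
  shows "left_fixed (sub_group S P) S (std_biset S S Q \<psi>) = (\<Union>\<phi>\<in>F P C. fixpts (std_biset S S Q \<psi>) P (\<lambda>x. x) \<phi>)"
proof -
  interpret Q: standard_biset S S Q \<psi> using F_std[OF assms(1)] .
  let ?B = "std_biset S S Q \<psi>"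
  note Pc = subgroup.mem_carrier[OF assms(2)]
  have "y \<in> (\<Union>\<phi>\<in>F P C. fixpts ?B P (\<lambda>x. x) \<phi>)" if y: "y \<in> left_fixed (sub_group S P) S ?B" for y
  proof -
    have yp: "y \<in> points ?B" and yq: "\<And>q. q \<in> P \<Longrightarrow> \<exists>h\<in>C. ract ?B y q = lact ?B h y"
      using y by (auto simp: left_fixed_def)
    obtain h g where hg: "h \<in> C" "g \<in> C" "y = std_pt S S Q \<psi> h g" using yp by (rule Q.std_ptE)
    have 1: "g \<otimes> q \<otimes> inv g \<in> Q" if "q \<in> P" for q
      using yq[OF that] Q.std_pt_ract_eq_lact_iff[OF hg(1,2) Pc[OF that]] hg(3) by blast
    let ?\<phi> = "\<lambda>q\<in>P. h \<otimes> \<psi> (g \<otimes> q \<otimes> inv g) \<otimes> inv h"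
    have \<phi>: "?\<phi> \<in> F P C" by (rule F_twist[OF assms(1) hg(1,2) assms(2) 1])
    have "?\<phi> \<in> P \<rightarrow> C" by (intro Pi_I F_into[OF \<phi>])
    then have "y \<in> fixpts ?B P (\<lambda>x. x) ?\<phi>"
      unfolding hg(3) using Pc 1 hg(1,2) by (subst Q.std_pt_fixed_iff) auto
    then show ?thesis using \<phi> by blast
  qed
  moreover have "y \<in> left_fixed (sub_group S P) S ?B" if "\<phi> \<in> F P C" "y \<in> fixpts ?B P (\<lambda>x. x) \<phi>" for y \<phi>
    using that F_into[OF that(1)] by (auto simp: left_fixed_def fixpts_def)
  ultimately show ?thesis by blast
qed

lemma card_left_fixed_std:
  assumes "\<psi> \<in> F Q C" "subgroup P S"
  shows "of_nat (card (left_fixed (sub_group S P) S (std_biset S S Q \<psi>))) = (\<Sum>\<phi>\<in>F P C. mark (cls Q \<psi>) P (\<lambda>x. x) \<phi>)"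
proof -
  interpret Q: standard_biset S S Q \<psi> using F_std[OF assms(1)] .
  let ?B = "std_biset S S Q \<psi>"
  have "card (left_fixed (sub_group S P) S ?B) = (\<Sum>\<phi>\<in>F P C. card (fixpts ?B P (\<lambda>x. x) \<phi>))"
    unfolding left_fixed_std[OF assms]
  proof (rule card_UN_disjoint[OF finite_F])
    show "\<forall>\<phi>\<in>F P C. finite (fixpts ?B P (\<lambda>x. x) \<phi>)"
      using fin_free_bisetD(2)[OF Q.fin_free_std] by (simp add: fixpts_def)
    show "\<forall>\<phi>\<in>F P C. \<forall>\<phi>'\<in>F P C. \<phi> \<noteq> \<phi>' \<longrightarrow> fixpts ?B P (\<lambda>x. x) \<phi> \<inter> fixpts ?B P (\<lambda>x. x) \<phi>' = {}"
      by (intro ballI impI disjoint_fixpts[OF grp Q.fin_free_std] F_PiE)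
  qed
  moreover have "mark (cls Q \<psi>) P (\<lambda>x. x) \<phi> = of_nat (card (fixpts ?B P (\<lambda>x. x) \<phi>))" if "\<phi> \<in> F P C" for \<phi>
    using F_into[OF that] subgroup.mem_carrier[OF assms(2)]
    by (intro mark_iso_class[OF grp grp Q.fin_free_std]) auto
  ultimately show ?thesis by simp
qed

end

section \<open>Marks of a characteristic idempotent\<close>

text \<open>The representative \<open>w\<close> witnesses that \<open>\<omega>\<close> is generated
  by F. Fixing it turns statements about the class into finite sums over keys that all come from
  F.\<close>

locale char_idempotent = finite_fusion_system S F
  for S :: "('a, 'm) monoid_scheme" (structure) and F :: "'a homsets" +
  fixes p n :: nat and \<omega> :: "('a, 'a) burnside_elt" and w :: "('a, 'a) biset_class \<Rightarrow>\<^sub>0 rat"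
  assumes p: "prime p" and ord: "card (carrier S) = p ^ n"
    and ci: "characteristic_idempotent p S F \<omega>"
    and w: "w \<in> \<omega>"
    and keys_w: "Poly_Mapping.keys w \<subseteq> {iso_class S S (std_biset S S P \<phi>) | P \<phi>. subgroup P S \<and> \<phi> \<in> F P (carrier S)}"
begin

abbreviation mk :: "'a set \<Rightarrow> ('a \<Rightarrow> 'a) \<Rightarrow> rat"
  where "mk P \<phi> \<equiv> lin (\<lambda>c. mark c P (\<lambda>x. x) \<phi>) w"

lemma \<omega>: "\<omega> \<in> burnside p S S" using ci by (simp add: characteristic_idempotent_def)

lemma keyE:
  assumes "c \<in> Poly_Mapping.keys w"
  obtains Q \<psi> where "\<psi> \<in> F Q C" "c = cls Q \<psi>"
  using assms keys_w by blast

lemma key_natE: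
  assumes "c \<in> Poly_Mapping.keys w"
  obtains X :: "('a, 'a, nat) biset" where "fin_free_biset S S X" "c = iso_class S S X"
  using burnside_formal[OF \<omega> w] assms unfolding formal_combs_def by (blast elim: iso_classesE)

lemma card_C: "card C > 0" "(of_nat (card C) :: rat) \<noteq> 0"
  using fin one_closed by (auto simp: card_gt_0_iff)

section \<open>Stability as an identity of marks\<close>

text \<open>The composite with [P, \<phi>] is counted over the second factor. Each of its |S| points
  carries a conjugate of \<open>\<phi>\<close>, so each fibre has the size of the mark in which P
  acts on the right through \<open>\<phi>\<close>, and |S| cancels.\<close>

lemma stable_right_mark:
  assumes \<phi>: "\<phi> \<in> F P C" and \<chi>: "\<chi> \<in> P \<rightarrow> C"
    and z: "z \<in> b_comp p (sub_group S P) S S \<omega> (bracket p (sub_group S P) S P \<phi>)"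
  shows "lin (\<lambda>c. mark c P (\<lambda>x. x) \<chi>) z = lin (\<lambda>c. mark c P \<phi> \<chi>) w"
proof -
  let ?P = "sub_group S P" and ?Y = "std_biset (sub_group S P) S P \<phi>"
  note subP = F_subgroup(1)[OF \<phi>]
  note Pc = subgroup.mem_carrier[OF subP]
  have grpP: "group ?P" using subP grp by (rule subgroup.subgroup_is_group)
  interpret T: three_groups ?P S S p using grpP grp fin p by (intro three_groups.intro)
  interpret PS: finite_group_pair ?P S
    using grpP grp fin subgroup_finite[OF subP] by (intro finite_group_pair.intro) auto
  interpret Y: standard_biset ?P S P \<phi>
    using F_hom[OF \<phi>] group.subgroup_self[OF grpP] by (intro PS.standard_bisetI) auto
  have \<phi>C: "\<phi> \<in> P \<rightarrow> C" using F_into[OF \<phi>] by auto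
  have sf: "Poly_Mapping.single (iso_class ?P S ?Y) 1 \<in> formal_combs p ?P S"
    using p grpP grp Y.fin_free_std by (intro formal_combs_single iso_class_in_iso_classes) auto
  have "lin (\<lambda>c. mark c P (\<lambda>x. x) \<chi>) z =
      lin (\<lambda>c. lin (\<lambda>d. mark (class_prod ?P S S c d) P (\<lambda>x. x) \<chi>) (Poly_Mapping.single (iso_class ?P S ?Y) 1)) w"
    using T.b_comp_mark[OF \<omega> w b_class_in_burnside[OF sf] b_class_self[OF sf] _ \<chi>] z by (simp add: bracket_def)
  also have "\<dots> = lin (\<lambda>c. mark (class_prod ?P S S c (iso_class ?P S ?Y)) P (\<lambda>x. x) \<chi>) w" by simp
  also have "\<dots> = lin (\<lambda>c. mark c P \<phi> \<chi>) w"
  proof (rule lin_cong)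
    fix c assume "c \<in> Poly_Mapping.keys w"
    then obtain X :: "('a, 'a, nat) biset" where X: "fin_free_biset S S X" "c = iso_class S S X" by (rule key_natE)
    have bp: "biset_product ?P S S X ?Y"
      using grpP grp fin X(1) Y.fin_free_std by (intro biset_product.intro)
    have fibre: "card {x \<in> points X. (x, y) \<in> pairset S X ?Y P (\<lambda>x. x) \<chi>} = card (fixpts X P \<phi> \<chi>)"
      if y: "y \<in> points ?Y" for y
    proof -
      obtain h g where hg: "h \<in> C" "g \<in> P" "y = std_pt ?P S P \<phi> h g" using y by (rule Y.std_ptE) simp
      \<comment> \<open>(h, g) q equals (h \<phi>(g q g^-1), g), so on the left q acts through
        \<phi>(q) conjugated by h \<phi>(g).\<close>
      let ?t = "h \<otimes> \<phi> g"
      have t: "?t \<in> C" using hg F_into[OF \<phi>] by simp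
      have act: "?t \<otimes> \<phi> q \<otimes> inv ?t \<in> C \<and> ract ?Y y q = lact ?Y (?t \<otimes> \<phi> q \<otimes> inv ?t) y"
        if q: "q \<in> P" for q
      proof -
        have inP: "inv g \<in> P" "g \<otimes> q \<in> P" "g \<otimes> q \<otimes> inv g \<in> P"
          using subP hg q by (auto intro: subgroup.m_closed subgroup.m_inv_closed)
        have invg: "inv\<^bsub>?P\<^esub> g = inv g" using subP hg(2) by (rule m_inv_consistent)
        have \<phi>inv: "\<phi> (inv g) = inv \<phi> g" using Y.\<phi>_inv[OF hg(2)] invg by simp
        have "\<phi> (g \<otimes> q \<otimes> inv g) = \<phi> g \<otimes> \<phi> q \<otimes> inv \<phi> g"
          using inP hg q by (simp add: F_mult[OF \<phi>] \<phi>inv)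
        then have e: "h \<otimes> \<phi> (g \<otimes> q \<otimes> inv g) \<otimes> inv h = ?t \<otimes> \<phi> q \<otimes> inv ?t"
          using hg q F_into[OF \<phi>] by (simp add: inv_mult_group m_assoc)
        have c: "?t \<otimes> \<phi> q \<otimes> inv ?t \<in> C" using t q F_into[OF \<phi>] by simp
        show ?thesis
          using Y.std_pt_ract_eq_lact_iff[of h g q "?t \<otimes> \<phi> q \<otimes> inv ?t"] hg q c e inP invg by simp
      qed
      have "{x \<in> points X. (x, y) \<in> pairset S X ?Y P (\<lambda>x. x) \<chi>} = fixpts X P (\<lambda>q. ?t \<otimes> \<phi> q \<otimes> inv ?t) \<chi>"
        using pairset_fibre[OF grp Y.fin_free_std _ y, of _ X P "\<lambda>q. ?t \<otimes> \<phi> q \<otimes> inv ?t" "\<lambda>x. x" \<chi>] act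
        by (auto simp: fixpts_def)
      then show ?thesis
        using card_fixpts_conj_right[OF grp fin_free_bisetD(1)[OF X(1)] \<phi>C \<chi> t] by simp
    qed
    have "card (pairset S X ?Y P (\<lambda>x. x) \<chi>) = card (points ?Y) * card (fixpts X P \<phi> \<chi>)"
      unfolding card_pairset_fibres(1)[OF fin_free_bisetD(2)[OF X(1)] fin_free_bisetD(2)[OF Y.fin_free_std]]
      by (simp add: fibre)
    moreover have "card (points ?Y) = card C"
      using Y.card_points_std Y.finK subgroup.one_closed[OF subP] by (auto simp: mult.commute)
    ultimately have "of_nat (card C) * mark (class_prod ?P S S c (iso_class ?P S ?Y)) P (\<lambda>x. x) \<chi> =
        of_nat (card C) * mark c P \<phi> \<chi>"
      using mark_class_prod[OF bp _ \<chi>, of "\<lambda>x. x"] mark_iso_class[OF grp grp X(1) \<phi>C \<chi>] X(2) by simp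
    then show "mark (class_prod ?P S S c (iso_class ?P S ?Y)) P (\<lambda>x. x) \<chi> = mark c P \<phi> \<chi>"
      using card_C(2) by simp
  qed
  finally show ?thesis .
qed

lemma bracket_in_burnside:
  assumes "finite_group_pair G H" "standard_biset G H K \<phi>"
  shows "bracket p G H K \<phi> \<in> burnside p G H"
    and "Poly_Mapping.single (iso_class G H (std_biset G H K \<phi>)) 1 \<in> bracket p G H K \<phi>"
proof -
  interpret finite_group_pair G H by fact
  have "Poly_Mapping.single (iso_class G H (std_biset G H K \<phi>)) 1 \<in> formal_combs p G H"
    using p grpG grpH standard_biset.fin_free_std[OF assms(2)]
    by (intro formal_combs_single iso_class_in_iso_classes) auto
  then show "bracket p G H K \<phi> \<in> burnside p G H"
    "Poly_Mapping.single (iso_class G H (std_biset G H K \<phi>)) 1 \<in> bracket p G H K \<phi>"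
    unfolding bracket_def by (auto intro: b_class_in_burnside b_class_self)
qed

text \<open>Right stability equates the composites with [P, \<phi>] and with the inclusion. A single
  member z of this common set is evaluated in both ways.\<close>

lemma right_stability:
  assumes \<phi>: "\<phi> \<in> F P C" and \<chi>: "\<chi> \<in> P \<rightarrow> C"
  shows "lin (\<lambda>c. mark c P \<phi> \<chi>) w = mk P \<chi>"
proof -
  let ?P = "sub_group S P"
  note subP = F_subgroup(1)[OF \<phi>]
  have grpP: "group ?P" using subP grp by (rule subgroup.subgroup_is_group)
  interpret T: three_groups ?P S S p using grpP grp fin p by (intro three_groups.intro)
  have PS: "finite_group_pair ?P S"
    using grpP grp fin subgroup_finite[OF subP] by (intro finite_group_pair.intro) auto
  have Y: "standard_biset ?P S P \<phi>"
    using F_hom[OF \<phi>] group.subgroup_self[OF grpP] by (intro finite_group_pair.standard_bisetI[OF PS]) auto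
  note bb = bracket_in_burnside[OF PS Y]
  obtain z where z: "z \<in> b_comp p ?P S S \<omega> (bracket p ?P S P \<phi>)"
    using T.b_comp_nonempty[OF \<omega> w bb] by blast
  have incl: "(\<lambda>x\<in>P. x) \<in> F P C" using subP subgroup_self subgroup.subset by (intro F_incl) auto
  have "z \<in> b_comp p ?P S S \<omega> (bracket p ?P S P (\<lambda>x\<in>P. x))"
    using z ci \<phi> subP unfolding characteristic_idempotent_def right_stable_def by blast
  then have "lin (\<lambda>c. mark c P (\<lambda>x. x) \<chi>) z = lin (\<lambda>c. mark c P (\<lambda>x\<in>P. x) \<chi>) w"
    by (rule stable_right_mark[OF incl \<chi>])
  moreover have "lin (\<lambda>c. mark c P (\<lambda>x. x) \<chi>) z = lin (\<lambda>c. mark c P \<phi> \<chi>) w"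
    using z by (rule stable_right_mark[OF \<phi> \<chi>])
  moreover have "mark c P (\<lambda>x\<in>P. x) \<chi> = mark c P (\<lambda>x. x) \<chi>" for c :: "('a, 'a) biset_class"
    by (simp add: mark_def fixpts_def)
  ultimately show ?thesis by simp
qed

lemma left_pair_std:
  assumes \<phi>: "\<phi> \<in> F P C"
  shows "finite_group_pair S (sub_group S P)"
    and "standard_biset S (sub_group S P) (\<phi> ` P) (inv_map P \<phi>)"
proof -
  note subP = F_subgroup(1)[OF \<phi>]
  have grpP: "group (sub_group S P)" using subP grp by (rule subgroup.subgroup_is_group)
  show PS: "finite_group_pair S (sub_group S P)"
    using grpP grp fin subgroup_finite[OF subP] by (intro finite_group_pair.intro) auto
  have inv: "inv_map P \<phi> \<in> F (\<phi> ` P) P" by (rule F_inverse[OF \<phi>])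
  have "inv_map P \<phi> \<in> hom (sub_group S (\<phi> ` P)) (sub_group S P)"
    by (rule homI) (simp_all add: F_into[OF inv] F_mult[OF inv])
  then show "standard_biset S (sub_group S P) (\<phi> ` P) (inv_map P \<phi>)"
    using F_subgroup(1)[OF inv] by (intro finite_group_pair.standard_bisetI[OF PS])
qed

text \<open>This time the count runs over the points x of the first factor, and h in x h = q x must
  be recovered from q. Injectivity of \<open>\<phi>\<close> makes this possible, where freeness
  served on the other side.\<close>

lemma stable_left_mark:
  assumes \<phi>: "\<phi> \<in> F P C"
    and z: "z \<in> b_comp p S S (sub_group S P) (bracket p S (sub_group S P) (\<phi> ` P) (inv_map P \<phi>)) \<omega>"
  shows "lin (\<lambda>c. mark c P (\<lambda>x. x) (\<lambda>x. x)) z = mk P \<phi>"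
proof -
  let ?P = "sub_group S P" and ?X = "std_biset S (sub_group S P) (\<phi> ` P) (inv_map P \<phi>)"
  note subP = F_subgroup(1)[OF \<phi>]
  note Pc = subgroup.mem_carrier[OF subP]
  have grpP: "group ?P" using subP grp by (rule subgroup.subgroup_is_group)
  interpret T: three_groups S S ?P p using grpP grp fin p by (intro three_groups.intro)
  interpret X: standard_biset S ?P "\<phi> ` P" "inv_map P \<phi>" by (rule left_pair_std[OF \<phi>])
  note bb = bracket_in_burnside[OF left_pair_std[OF \<phi>]]
  have \<phi>C: "\<phi> \<in> P \<rightarrow> C" using F_into[OF \<phi>] by auto
  have id: "(\<lambda>x. x) \<in> P \<rightarrow> C" "(\<lambda>x. x) \<in> P \<rightarrow> carrier ?P" using Pc by auto
  have "lin (\<lambda>c. mark c P (\<lambda>x. x) (\<lambda>x. x)) z =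
      lin (\<lambda>c. lin (\<lambda>d. mark (class_prod S S ?P c d) P (\<lambda>x. x) (\<lambda>x. x)) w) (Poly_Mapping.single (iso_class S ?P ?X) 1)"
    by (rule T.b_comp_mark[OF bb \<omega> w id z])
  also have "\<dots> = lin (\<lambda>d. mark (class_prod S S ?P (iso_class S ?P ?X) d) P (\<lambda>x. x) (\<lambda>x. x)) w" by simp
  also have "\<dots> = mk P \<phi>"
  proof (rule lin_cong)
    fix d assume "d \<in> Poly_Mapping.keys w"
    then obtain Y :: "('a, 'a, nat) biset" where Y: "fin_free_biset S S Y" "d = iso_class S S Y" by (rule key_natE)
    have bp: "biset_product S S ?P ?X Y"
      using grpP grp fin Y(1) X.fin_free_std by (intro biset_product.intro)
    have fibre: "card {y \<in> points Y. (x, y) \<in> pairset S ?X Y P (\<lambda>x. x) (\<lambda>x. x)} = card (fixpts Y P (\<lambda>x. x) \<phi>)"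
      if x: "x \<in> points ?X" for x
    proof -
      \<comment> \<open>At x = (a, g) the equation x h = q x says g h g^-1 = \<phi>(a^-1 q a).
        Solving for h gives \<phi>(q) conjugated by t = g^-1 \<phi>(a)^-1.\<close>
      obtain a g where ag: "a \<in> P" "g \<in> C" "x = std_pt S ?P (\<phi> ` P) (inv_map P \<phi>) a g" using x by (rule X.std_ptE) simp
      have \<phi>a: "\<phi> a \<in> C" using F_into[OF \<phi> ag(1)] .
      define t where "t = inv g \<otimes> inv (\<phi> a)"
      have t: "t \<in> C" using ag \<phi>a by (simp add: t_def)
      have act: "ract ?X x h = lact ?X q x \<longleftrightarrow> h = t \<otimes> \<phi> q \<otimes> inv t" if q: "q \<in> P" and h: "h \<in> C" for q h
      proof -
        have inva: "inv\<^bsub>?P\<^esub> a = inv a" using subP ag(1) by (rule m_inv_consistent)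
        have iP: "inv a \<in> P" using subP ag(1) by (rule subgroup.m_inv_closed)
        have \<phi>inv: "\<phi> (inv a) = inv \<phi> a"
          using standard_biset.\<phi>_inv[OF F_std[OF \<phi>] ag(1)] .
        have \<phi>q: "\<phi> q \<in> C" using F_into[OF \<phi> q] .
        have m: "inv a \<otimes> q \<in> P" "inv a \<otimes> q \<otimes> a \<in> P"
          using subgroup.m_closed[OF subP] iP q ag(1) by auto
        have \<phi>m: "\<phi> (inv a \<otimes> q \<otimes> a) = inv \<phi> a \<otimes> \<phi> q \<otimes> \<phi> a"
          using m iP q ag(1) by (simp add: F_mult[OF \<phi>] \<phi>inv)
        have iff1: "b = inv a \<otimes> q \<otimes> a \<longleftrightarrow> q = a \<otimes> b \<otimes> inv a" if "b \<in> C" for b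
        proof
          assume "b = inv a \<otimes> q \<otimes> a"
          then have "a \<otimes> b \<otimes> inv a = (a \<otimes> inv a) \<otimes> q \<otimes> (a \<otimes> inv a)"
            using Pc[OF ag(1)] Pc[OF q] by (simp only: m_assoc m_closed inv_closed)
          then show "q = a \<otimes> b \<otimes> inv a" using Pc[OF ag(1)] Pc[OF q] by simp
        next
          assume "q = a \<otimes> b \<otimes> inv a"
          then have "inv a \<otimes> q \<otimes> a = (inv a \<otimes> a) \<otimes> b \<otimes> (inv a \<otimes> a)"
            using Pc[OF ag(1)] that by (simp only: m_assoc m_closed inv_closed)
          then show "b = inv a \<otimes> q \<otimes> a" using Pc[OF ag(1)] that by simp
        qed
        have iff2: "g \<otimes> h \<otimes> inv g = \<phi> (inv a \<otimes> q \<otimes> a) \<longleftrightarrow> h = t \<otimes> \<phi> q \<otimes> inv t"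
        proof -
          have "h = t \<otimes> \<phi> q \<otimes> inv t \<longleftrightarrow> h = inv g \<otimes> \<phi> (inv a \<otimes> q \<otimes> a) \<otimes> g"
            unfolding t_def \<phi>m using ag(2) \<phi>a \<phi>q by (simp add: inv_mult_group m_assoc)
          also have "\<dots> \<longleftrightarrow> g \<otimes> h \<otimes> inv g = \<phi> (inv a \<otimes> q \<otimes> a)"
            using ag(2) h F_into[OF \<phi> m(2)]
            by (metis inv_closed inv_solve_left inv_solve_right m_assoc m_closed)
          finally show ?thesis by blast
        qed
        have invq: "inv_map P \<phi> (\<phi> b) = b" if "b \<in> P" for b
          using that F_inj[OF \<phi>] by (simp add: inv_map_def)
        have "ract ?X x h = lact ?X q x \<longleftrightarrow> g \<otimes> h \<otimes> inv g \<in> \<phi> ` P \<and>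
            q = a \<otimes> inv_map P \<phi> (g \<otimes> h \<otimes> inv g) \<otimes> inv a"
          using X.std_pt_ract_eq_lact_iff[of a g h q] ag q h inva by simp
        also have "\<dots> \<longleftrightarrow> (\<exists>b\<in>P. g \<otimes> h \<otimes> inv g = \<phi> b \<and> q = a \<otimes> b \<otimes> inv a)"
          using invq by auto
        also have "\<dots> \<longleftrightarrow> g \<otimes> h \<otimes> inv g = \<phi> (inv a \<otimes> q \<otimes> a)"
        proof
          assume "\<exists>b\<in>P. g \<otimes> h \<otimes> inv g = \<phi> b \<and> q = a \<otimes> b \<otimes> inv a"
          then obtain b where "b \<in> P" "g \<otimes> h \<otimes> inv g = \<phi> b" "q = a \<otimes> b \<otimes> inv a" by blast
          then show "g \<otimes> h \<otimes> inv g = \<phi> (inv a \<otimes> q \<otimes> a)"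
            using iff1[OF Pc, of b] by metis
        next
          assume "g \<otimes> h \<otimes> inv g = \<phi> (inv a \<otimes> q \<otimes> a)"
          moreover have "q = a \<otimes> (inv a \<otimes> q \<otimes> a) \<otimes> inv a" using iff1[OF Pc[OF m(2)]] by simp
          ultimately show "\<exists>b\<in>P. g \<otimes> h \<otimes> inv g = \<phi> b \<and> q = a \<otimes> b \<otimes> inv a"
            using m(2) by (rule_tac bexI) auto
        qed
        finally show ?thesis using iff2 by simp
      qed
      have tq: "t \<otimes> \<phi> q \<otimes> inv t \<in> C" if "q \<in> P" for q using t F_into[OF \<phi> that] by simp
      have "(x, y) \<in> pairset S ?X Y P (\<lambda>x. x) (\<lambda>x. x) \<longleftrightarrow> y \<in> fixpts Y P (\<lambda>x. x) (\<lambda>q. t \<otimes> \<phi> q \<otimes> inv t)"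
        if "y \<in> points Y" for y
        using that x act tq unfolding pairset_def fixpts_def by auto
      then have "{y \<in> points Y. (x, y) \<in> pairset S ?X Y P (\<lambda>x. x) (\<lambda>x. x)} =
          fixpts Y P (\<lambda>x. x) (\<lambda>q. t \<otimes> \<phi> q \<otimes> inv t)"
        by (auto simp: fixpts_def)
      then show ?thesis
        using card_fixpts_conj_left[OF grp fin_free_bisetD(1)[OF Y(1)] id(1) \<phi>C t] by simp
    qed
    have "card (pairset S ?X Y P (\<lambda>x. x) (\<lambda>x. x)) = card (points ?X) * card (fixpts Y P (\<lambda>x. x) \<phi>)"
      unfolding card_pairset_fibres(2)[OF fin_free_bisetD(2)[OF X.fin_free_std] fin_free_bisetD(2)[OF Y(1)]]
      by (simp add: fibre)
    moreover have "card (points ?X) = card C"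
      using X.card_points_std card_image[OF F_inj[OF \<phi>]] subgroup_finite[OF subP] subgroup.one_closed[OF subP] by auto
    ultimately have "of_nat (card C) * mark (class_prod S S ?P (iso_class S ?P ?X) d) P (\<lambda>x. x) (\<lambda>x. x) =
        of_nat (card C) * mark d P (\<lambda>x. x) \<phi>"
      using mark_class_prod[OF bp id] mark_iso_class[OF grp grp Y(1) id(1) \<phi>C] Y(2) by simp
    then show "mark (class_prod S S ?P (iso_class S ?P ?X) d) P (\<lambda>x. x) (\<lambda>x. x) = mark d P (\<lambda>x. x) \<phi>"
      using card_C(2) by simp
  qed
  finally show ?thesis .
qed

text \<open>The same comparison on the left: both brackets give one composite, and the inclusion is
  its own inverse map on P.\<close>

lemma left_stability:
  assumes \<phi>: "\<phi> \<in> F P C"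
  shows "mk P \<phi> = mk P (\<lambda>x\<in>P. x)"
proof -
  let ?P = "sub_group S P"
  note subP = F_subgroup(1)[OF \<phi>]
  have grpP: "group ?P" using subP grp by (rule subgroup.subgroup_is_group)
  interpret T: three_groups S S ?P p using grpP grp fin p by (intro three_groups.intro)
  obtain z where z: "z \<in> b_comp p S S ?P (bracket p S ?P (\<phi> ` P) (inv_map P \<phi>)) \<omega>"
    using T.b_comp_nonempty[OF bracket_in_burnside[OF left_pair_std[OF \<phi>]] \<omega> w] by blast
  have incl: "(\<lambda>x\<in>P. x) \<in> F P C" using subP subgroup_self subgroup.subset by (intro F_incl) auto
  have "inv_map P (\<lambda>x\<in>P. x) = (\<lambda>x\<in>P. x)"
  proof -
    have "inv_into P (\<lambda>x\<in>P. x) y = y" if "y \<in> P" for y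
      using inv_into_f_f[of "\<lambda>x\<in>P. x" P y] that by (simp add: inj_on_def)
    then show ?thesis by (auto simp: inv_map_def fun_eq_iff)
  qed
  moreover have "(\<lambda>x\<in>P. x) ` P = P" by auto
  moreover have "z \<in> b_comp p S S ?P (bracket p S ?P P (\<lambda>x\<in>P. x)) \<omega>"
    using z ci \<phi> subP unfolding characteristic_idempotent_def left_stable_def by blast
  ultimately have "lin (\<lambda>c. mark c P (\<lambda>x. x) (\<lambda>x. x)) z = mk P (\<lambda>x\<in>P. x)"
    by (intro stable_left_mark[OF incl]) simp
  then show ?thesis using stable_left_mark[OF \<phi> z] by simp
qed

end

section \<open>Idempotence, the augmentation and the values of the marks\<close>

context char_idempotent
begin

text \<open>The functional on the left is T_P, a sum of marks whose values at \<open>w\<close> all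
  agree by left stability.\<close>

lemma left_fixed_total: "lin (\<lambda>c. \<Sum>\<psi>\<in>F P C. mark c P (\<lambda>x. x) \<psi>) w = of_nat (card (F P C)) * mk P (\<lambda>x\<in>P. x)"
proof -
  have "lin (\<lambda>c. \<Sum>\<psi>\<in>F P C. mark c P (\<lambda>x. x) \<psi>) w = (\<Sum>\<psi>\<in>F P C. mk P \<psi>)" by (rule lin_sum_fun)
  also have "\<dots> = (\<Sum>\<psi>\<in>F P C. mk P (\<lambda>x\<in>P. x))" by (intro sum.cong refl left_stability)
  finally show ?thesis by simp
qed

text \<open>Pairs for the product of two keys are counted over the second one: y contributes only if
  P fixes it up to the left action, and a y carrying \<psi> contributes the mark of the first key
  twisted by \<psi>. Summing the first key over \<open>w\<close> removes the twist.\<close>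

lemma idempotent_mark:
  assumes P: "subgroup P S" and \<chi>: "\<chi> \<in> P \<rightarrow> C"
  shows "of_nat (card C) * mk P \<chi> = lin (\<lambda>c. \<Sum>\<psi>\<in>F P C. mark c P (\<lambda>x. x) \<psi>) w * mk P \<chi>"
proof -
  note Pc = subgroup.mem_carrier[OF P]
  have id: "(\<lambda>x. x) \<in> P \<rightarrow> C" using Pc by auto
  interpret T: three_groups S S S p using grp fin p by (intro three_groups.intro)
  have key: "of_nat (card C) * lin (\<lambda>c. mark (class_prod S S S c d) P (\<lambda>x. x) \<chi>) w =
      (\<Sum>\<psi>\<in>F P C. mark d P (\<lambda>x. x) \<psi>) * mk P \<chi>" if d: "d \<in> Poly_Mapping.keys w" for d
  proof -
    obtain Q \<psi>0 where Q: "\<psi>0 \<in> F Q C" "d = cls Q \<psi>0" using d by (rule keyE)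
    let ?Y = "std_biset S S Q \<psi>0"
    interpret Y: standard_biset S S Q \<psi>0 using F_std[OF Q(1)] .
    note finY = fin_free_bisetD(2)[OF Y.fin_free_std]
    have "of_nat (card C) * mark (class_prod S S S c d) P (\<lambda>x. x) \<chi> =
        (\<Sum>\<psi>\<in>F P C. mark d P (\<lambda>x. x) \<psi> * mark c P \<psi> \<chi>)" if c: "c \<in> Poly_Mapping.keys w" for c
    proof -
      obtain X :: "('a, 'a, nat) biset" where X: "fin_free_biset S S X" "c = iso_class S S X" using c by (rule key_natE)
      let ?f = "\<lambda>y. card {x \<in> points X. (x, y) \<in> pairset S X ?Y P (\<lambda>x. x) \<chi>}"
      let ?L = "left_fixed (sub_group S P) S ?Y"
      have bp: "biset_product S S S X ?Y" using grp fin X(1) Y.fin_free_std by (intro biset_product.intro)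
      have zero: "?f y = 0" if y: "y \<in> points ?Y - ?L" for y
      proof -
        have "{x \<in> points X. (x, y) \<in> pairset S X ?Y P (\<lambda>x. x) \<chi>} = {}"
          using y by (auto simp: left_fixed_def pairset_def)
        then show ?thesis by (metis card.empty)
      qed
      have val: "?f y = card (fixpts X P \<psi> \<chi>)" if \<psi>: "\<psi> \<in> F P C" and y: "y \<in> fixpts ?Y P (\<lambda>x. x) \<psi>" for y \<psi>
      proof -
        have "(x, y) \<in> pairset S X ?Y P (\<lambda>x. x) \<chi> \<longleftrightarrow> x \<in> fixpts X P \<psi> \<chi>" if "x \<in> points X" for x
          using y F_into[OF \<psi>] that by (intro pairset_fibre[OF grp Y.fin_free_std]) (auto simp: fixpts_def)
        then have "{x \<in> points X. (x, y) \<in> pairset S X ?Y P (\<lambda>x. x) \<chi>} = fixpts X P \<psi> \<chi>"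
          by (auto simp: fixpts_def)
        then show ?thesis by simp
      qed
      have "card (pairset S X ?Y P (\<lambda>x. x) \<chi>) = sum ?f (points ?Y)"
        by (rule card_pairset_fibres(1)[OF fin_free_bisetD(2)[OF X(1)] finY])
      also have "\<dots> = sum ?f ?L"
        using zero finY by (intro sum.mono_neutral_right) (auto simp: left_fixed_def)
      also have "\<dots> = (\<Sum>\<psi>\<in>F P C. sum ?f (fixpts ?Y P (\<lambda>x. x) \<psi>))"
        unfolding left_fixed_std[OF Q(1) P]
      proof (rule sum.UNION_disjoint[OF finite_F])
        show "\<forall>\<psi>\<in>F P C. finite (fixpts ?Y P (\<lambda>x. x) \<psi>)" using finY by (simp add: fixpts_def)
        show "\<forall>\<psi>\<in>F P C. \<forall>\<psi>'\<in>F P C. \<psi> \<noteq> \<psi>' \<longrightarrow> fixpts ?Y P (\<lambda>x. x) \<psi> \<inter> fixpts ?Y P (\<lambda>x. x) \<psi>' = {}"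
          by (intro ballI impI disjoint_fixpts[OF grp Y.fin_free_std] F_PiE)
      qed
      also have "\<dots> = (\<Sum>\<psi>\<in>F P C. card (fixpts ?Y P (\<lambda>x. x) \<psi>) * card (fixpts X P \<psi> \<chi>))"
        by (intro sum.cong refl) (simp add: val)
      finally have "of_nat (card C) * mark (class_prod S S S c d) P (\<lambda>x. x) \<chi> =
          of_nat (\<Sum>\<psi>\<in>F P C. card (fixpts ?Y P (\<lambda>x. x) \<psi>) * card (fixpts X P \<psi> \<chi>))"
        using mark_class_prod[OF bp id \<chi>] X(2) Q(2) by simp
      also have "\<dots> = (\<Sum>\<psi>\<in>F P C. mark d P (\<lambda>x. x) \<psi> * mark c P \<psi> \<chi>)"
      proof -
        have "mark d P (\<lambda>x. x) \<psi> = of_nat (card (fixpts ?Y P (\<lambda>x. x) \<psi>))" "mark c P \<psi> \<chi> = of_nat (card (fixpts X P \<psi> \<chi>))"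
          if \<psi>: "\<psi> \<in> F P C" for \<psi>
          using F_into[OF \<psi>] unfolding Q(2) X(2)
          by (auto intro!: mark_iso_class[OF grp grp Y.fin_free_std id] mark_iso_class[OF grp grp X(1) _ \<chi>])
        then show ?thesis by simp
      qed
      finally show ?thesis .
    qed
    then have "lin (\<lambda>c. mark (class_prod S S S c d) P (\<lambda>x. x) \<chi> * of_nat (card C)) w =
        lin (\<lambda>c. \<Sum>\<psi>\<in>F P C. mark c P \<psi> \<chi> * mark d P (\<lambda>x. x) \<psi>) w"
      by (intro lin_cong) (simp add: mult.commute)
    also have "\<dots> = (\<Sum>\<psi>\<in>F P C. lin (\<lambda>c. mark c P \<psi> \<chi>) w * mark d P (\<lambda>x. x) \<psi>)"
      by (simp add: lin_sum_fun lin_mult_const)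
    \<comment> \<open>Right stability: the twisted mark of \<open>w\<close> does not depend on
      \<psi>, so it leaves the sum as a common factor.\<close>
    also have "\<dots> = (\<Sum>\<psi>\<in>F P C. mk P \<chi> * mark d P (\<lambda>x. x) \<psi>)"
      by (intro sum.cong refl) (simp add: right_stability[OF _ \<chi>])
    also have "\<dots> = (\<Sum>\<psi>\<in>F P C. mark d P (\<lambda>x. x) \<psi>) * mk P \<chi>"
      by (simp add: sum_distrib_left mult.commute)
    finally show ?thesis unfolding lin_mult_const by (simp only: mult.commute[of "of_nat (card C)"])
  qed
  \<comment> \<open>Idempotence enters here: \<open>w\<close> is itself a member of the composite,
    so its marks are those of the product.\<close>
  have "w \<in> b_comp p S S S \<omega> \<omega>" using w ci by (simp add: characteristic_idempotent_def)
  then have "mk P \<chi> = lin (\<lambda>c. lin (\<lambda>d. mark (class_prod S S S c d) P (\<lambda>x. x) \<chi>) w) w"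
    by (rule T.b_comp_mark[OF \<omega> w \<omega> w id \<chi>])
  also have "\<dots> = lin (\<lambda>d. lin (\<lambda>c. mark (class_prod S S S c d) P (\<lambda>x. x) \<chi>) w) w" by (rule lin_swap)
  finally have "mk P \<chi> * of_nat (card C) = lin (\<lambda>d. lin (\<lambda>c. mark (class_prod S S S c d) P (\<lambda>x. x) \<chi>) w * of_nat (card C)) w"
    by (simp add: lin_mult_const)
  also have "\<dots> = lin (\<lambda>d. (\<Sum>\<psi>\<in>F P C. mark d P (\<lambda>x. x) \<psi>) * mk P \<chi>) w"
    by (intro lin_cong) (metis key mult.commute)
  finally show ?thesis unfolding lin_mult_const by (simp only: mult.commute[of "of_nat (card C)"])
qed

text \<open>On each key the number of left orbits differs from T_P / |S| by a multiple of p. If T_P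
  vanished at \<open>w\<close>, the augmentation of \<open>\<omega>\<close> would be p times a local
  integer.\<close>

lemma left_fixed_total_nonzero:
  assumes P: "subgroup P S"
  shows "lin (\<lambda>c. \<Sum>\<psi>\<in>F P C. mark c P (\<lambda>x. x) \<psi>) w \<noteq> 0"
proof
  let ?T = "\<lambda>c. \<Sum>\<psi>\<in>F P C. mark c P (\<lambda>x. x) \<psi>"
  assume zero: "lin ?T w = 0"
  let ?P = "sub_group S P"
  have grpP: "group ?P" using P grp by (rule subgroup.subgroup_is_group)
  interpret PS: finite_group_pair ?P S
    using grpP grp fin subgroup_finite[OF P] by (intro finite_group_pair.intro) auto
  have "card P dvd p ^ n" using lagrange[OF P] ord by (metis dvd_triv_right order_def)
  then obtain m where m: "card P = p ^ m" using p by (meson divides_primepow_nat)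
  have "\<exists>k :: nat. degree_class S S c = ?T c / of_nat (card C) + of_nat p * of_nat k"
    if c: "c \<in> Poly_Mapping.keys w" for c
  proof -
    obtain Q \<psi> where Q: "\<psi> \<in> F Q C" "c = cls Q \<psi>" using c by (rule keyE)
    let ?B = "std_biset S S Q \<psi>"
    interpret B: standard_biset S S Q \<psi> using F_std[OF Q(1)] .
    obtain Y :: "('a, 'a, nat) biset" where Y: "fin_free_biset S S Y" "biset_isomorphic S S ?B Y"
      using ex_nat_biset[OF B.fin_free_std grp grp] by blast
    \<comment> \<open>Only the right action is restricted to P. Points and left action stay, so the
      count of left orbits is still the degree over S.\<close>
    have "fin_free_biset ?P S Y"
      using Y(1) subgroup.mem_carrier[OF P] by (auto simp: fin_free_biset_def is_biset_def)
    then obtain k where k: "card (points Y) = card (left_fixed ?P S Y) + p * card C * k"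
      using PS.left_fixed_congruence[OF p, of m Y] m by auto
    have iso: "biset_isomorphic ?P S ?B Y"
      using Y(2) subgroup.mem_carrier[OF P] unfolding biset_isomorphic_def by auto
    have "is_biset ?P S ?B"
      using fin_free_bisetD(1)[OF B.fin_free_std] subgroup.mem_carrier[OF P] by (auto simp: is_biset_def)
    then have "card (points ?B) = card (left_fixed ?P S ?B) + p * card C * k"
      using k card_left_fixed_iso[OF _ iso] biset_isomorphic_card[OF iso] by simp
    then have "(of_nat (card (points ?B)) :: rat) = ?T c + of_nat p * of_nat (card C) * of_nat k"
      using card_left_fixed_std[OF Q(1) P] Q(2) by (metis of_nat_add of_nat_mult)
    then have "degree_class S S c = ?T c / of_nat (card C) + of_nat p * of_nat k"
      using degree_iso_class[OF grp grp B.fin_free_std] Q(2) card_C(2) by (simp add: field_simps)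
    then show ?thesis by blast
  qed
  then obtain k :: "('a, 'a) biset_class \<Rightarrow> nat" where
    k: "\<And>c. c \<in> Poly_Mapping.keys w \<Longrightarrow> degree_class S S c = ?T c / of_nat (card C) + of_nat p * of_nat (k c)"
    by metis
  have "augmentation p S \<omega> = lin (degree_class S S) w" by (rule augmentation_eq[OF p grp fin \<omega> w])
  also have "\<dots> = lin (\<lambda>c. ?T c * (1 / of_nat (card C)) + of_nat (k c) * of_nat p) w"
    by (intro lin_cong) (simp add: k mult.commute)
  also have "\<dots> = lin ?T w * (1 / of_nat (card C)) + lin (\<lambda>c. of_nat (k c)) w * of_nat p"
    by (simp only: lin_mult_const[symmetric]) (simp add: lin_def distrib_left sum.distrib)
  finally have "augmentation p S \<omega> = of_nat p * lin (\<lambda>c. of_nat (k c)) w" using zero by simp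
  moreover have "lin (\<lambda>c. of_nat (k c)) w \<in> Z_loc p"
    unfolding lin_def using burnside_formal[OF \<omega> w] p
    by (intro Z_loc_sum Z_loc_add_mult(2) Z_loc_of_nat) (auto simp: formal_combs_def)
  ultimately show False using ci by (auto simp: characteristic_idempotent_def)
qed

text \<open>In particular the marks, hence \<open>\<omega>\<close> itself, are determined by the fusion system.\<close>

theorem mark_formula:
  assumes "\<phi> \<in> F P C"
  shows "mk P \<phi> = of_nat (card C) / of_nat (card (F P C))"
proof -
  note P = F_subgroup(1)[OF assms]
  let ?i = "\<lambda>x\<in>P. x"
  have i: "?i \<in> P \<rightarrow> C" using subgroup.mem_carrier[OF P] by auto
  have nz: "of_nat (card (F P C)) * mk P ?i \<noteq> 0"
    using left_fixed_total_nonzero[OF P] by (simp only: left_fixed_total) simp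
  \<comment> \<open>With m the mark at the inclusion this reads |S| m = (|F(P,S)| m) m. As |F(P,S)|
    m is T_P and nonzero, so is m, and one factor m cancels.\<close>
  have "of_nat (card C) * mk P ?i = of_nat (card (F P C)) * mk P ?i * mk P ?i"
    using idempotent_mark[OF P i] by (simp only: left_fixed_total)
  then have "of_nat (card C) = of_nat (card (F P C)) * mk P ?i" using nz by simp
  then show ?thesis unfolding left_stability[OF assms] using nz by (simp add: field_simps)
qed

lemma mark_F_nonzero:
  assumes "\<phi> \<in> F P C"
  shows "mk P \<phi> \<noteq> 0"
proof -
  have "card (F P C) > 0" using finite_F assms by (auto simp: card_gt_0_iff)
  then show ?thesis using mark_formula[OF assms] card_C(2) by simp
qed

text \<open>Basis elements coming from F are standard basis elements, so \<open>w\<close> is already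
  the standard expansion and \<open>chi\<close> reads its coefficients.\<close>

lemma chi_w: "chi S S P \<phi> \<omega> = Poly_Mapping.lookup w (cls P \<phi>)"
proof (rule SS.chi_eq[OF \<omega> w])
  show "Poly_Mapping.keys w \<subseteq> std_classes S S"
    using keys_w F_hom unfolding std_classes_def by blast
qed

lemma F_factors_through_key:
  assumes "\<phi> \<in> F P C"
  obtains Q \<psi> h g where "\<psi> \<in> F Q C" "cls Q \<psi> \<in> Poly_Mapping.keys w" "h \<in> C" "g \<in> C"
    "\<And>q. q \<in> P \<Longrightarrow> g \<otimes> q \<otimes> inv g \<in> Q"
    "\<And>q. q \<in> P \<Longrightarrow> \<phi> q = h \<otimes> \<psi> (g \<otimes> q \<otimes> inv g) \<otimes> inv h"
proof -
  obtain c where c: "c \<in> Poly_Mapping.keys w" "mark c P (\<lambda>x. x) \<phi> \<noteq> 0"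
    using mark_F_nonzero[OF assms] unfolding lin_def by (metis (no_types, lifting) mult_eq_0_iff sum.neutral)
  obtain Q \<psi> where Q: "\<psi> \<in> F Q C" "c = cls Q \<psi>" using c(1) by (rule keyE)
  have "\<phi> \<in> P \<rightarrow> C" using F_into[OF assms] by auto
  then obtain h g where "h \<in> C" "g \<in> C" "\<And>q. q \<in> P \<Longrightarrow> g \<otimes> q \<otimes> inv g \<in> Q"
    "\<And>q. q \<in> P \<Longrightarrow> \<phi> q = h \<otimes> \<psi> (g \<otimes> q \<otimes> inv g) \<otimes> inv h"
    using mark_std_nonzeroE[OF F_std[OF Q(1)] F_subgroup(1)[OF assms]] c(2) Q(2) by metis
  then show ?thesis using that Q c(1) by blast
qed

end

section \<open>Normal subgroups of the fusion system\<close>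

context finite_fusion_system
begin

lemma normalizer_conj:
  assumes "subgroup U S" "normalizer S U = C" "g \<in> C" "u \<in> U"
  shows "g \<otimes> u \<otimes> inv g \<in> U"
proof -
  have "g <# U #> inv g = U"
    using assms subgroup.subset[OF assms(1)] by (auto simp: normalizer_def stabilizer_def)
  then show ?thesis using assms(4) by (auto simp: l_coset_def r_coset_def)
qed

lemma set_mult_subgroup:
  assumes U: "subgroup U S" and norm: "\<And>g u. g \<in> C \<Longrightarrow> u \<in> U \<Longrightarrow> g \<otimes> u \<otimes> inv g \<in> U"
    and P: "subgroup P S"
  shows "subgroup (P <#> U) S" and "P \<subseteq> P <#> U" and "U \<subseteq> P <#> U"
proof -
  note Uc = subgroup.mem_carrier[OF U] and Pc = subgroup.mem_carrier[OF P]
  have mem: "x \<in> P <#> U \<longleftrightarrow> (\<exists>a\<in>P. \<exists>u\<in>U. x = a \<otimes> u)" for x by (auto simp: set_mult_def)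
  have norm': "inv g \<otimes> u \<otimes> g \<in> U" if "g \<in> C" "u \<in> U" for g u
    using norm[of "inv g" u] that by simp
  show PPU: "P \<subseteq> P <#> U"
  proof
    fix x assume x: "x \<in> P"
    then have "x = x \<otimes> \<one>" using Pc by simp
    then show "x \<in> P <#> U" unfolding mem using x subgroup.one_closed[OF U] by blast
  qed
  show "U \<subseteq> P <#> U"
  proof
    fix x assume x: "x \<in> U"
    then have "x = \<one> \<otimes> x" using Uc by simp
    then show "x \<in> P <#> U" unfolding mem using x subgroup.one_closed[OF P] by blast
  qed
  show "subgroup (P <#> U) S"
  proof (rule subgroupI)
    show "P <#> U \<subseteq> C" using Pc Uc by (auto simp: mem)
    show "P <#> U \<noteq> {}" using PPU subgroup.one_closed[OF P] by blast
    fix x assume "x \<in> P <#> U"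
    then obtain a u where x: "a \<in> P" "u \<in> U" "x = a \<otimes> u" by (auto simp: mem)
    have ac: "a \<in> C" "u \<in> C" using Pc Uc x by auto
    have "inv x = inv a \<otimes> (a \<otimes> inv u \<otimes> inv a)"
      using x(3) ac by (simp add: inv_mult_group m_assoc[symmetric])
    moreover have "a \<otimes> inv u \<otimes> inv a \<in> U" using norm[OF ac(1)] subgroup.m_inv_closed[OF U x(2)] .
    ultimately show "inv x \<in> P <#> U" using subgroup.m_inv_closed[OF P x(1)] by (auto simp: mem)
    fix y assume "y \<in> P <#> U"
    then obtain b v where y: "b \<in> P" "v \<in> U" "y = b \<otimes> v" by (auto simp: mem)
    have bc: "b \<in> C" "v \<in> C" using Pc Uc y by auto
    have "x \<otimes> y = (a \<otimes> b) \<otimes> ((inv b \<otimes> u \<otimes> b) \<otimes> v)"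
    proof -
      have "(a \<otimes> b) \<otimes> ((inv b \<otimes> u \<otimes> b) \<otimes> v) = a \<otimes> (b \<otimes> inv b) \<otimes> u \<otimes> (b \<otimes> v)"
        using ac bc by (simp only: m_assoc m_closed inv_closed)
      then show ?thesis using ac bc x(3) y(3) by simp
    qed
    moreover have "(inv b \<otimes> u \<otimes> b) \<otimes> v \<in> U"
      using subgroup.m_closed[OF U norm'[OF bc(1) x(2)] y(2)] .
    ultimately show "x \<otimes> y \<in> P <#> U" using subgroup.m_closed[OF P x(1) y(1)] by (auto simp: mem)
  qed
qed

text \<open>When U lies in P, the required extension to PU agrees with \<open>\<phi>\<close> on U,
  so \<open>\<phi>\<close> itself preserves U.\<close>

lemma normalizer_systemD:
  assumes "\<phi> \<in> normalizer_system S F U P Q" "subgroup U S" "U \<subseteq> P"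
  shows "\<phi> \<in> F P Q" "\<phi> ` U = U" "P \<subseteq> normalizer S U"
proof -
  have PN: "subgroup P (sub_group S (normalizer S U))"
    and 1: "\<phi> \<in> F P Q" "\<exists>\<psi>\<in>F (P <#> U) (Q <#> U). restrict \<psi> P = \<phi> \<and> \<psi> ` U = U"
    using assms(1) by (auto simp: normalizer_system_def split: if_splits)
  then obtain \<psi> where \<psi>: "restrict \<psi> P = \<phi>" "\<psi> ` U = U" by blast
  have "\<phi> ` U = \<psi> ` U" using assms(3) unfolding \<psi>(1)[symmetric] by (intro image_cong) auto
  then show "\<phi> \<in> F P Q" "\<phi> ` U = U" "P \<subseteq> normalizer S U" using 1 \<psi> subgroup.subset[OF PN] by auto
qed

end

section \<open>From the support of the idempotent to normality of U\<close>

context char_idempotent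
begin

text \<open>Each morphism is a twist of a restriction of some occurring \<psi>, which is defined on
  a group containing U and preserves U. The same twist, taken on PU, is the extension
  wanted.\<close>

lemma F_eq_normalizer_systemI:
  assumes U: "subgroup U S"
    and hyp: "\<And>P \<phi>. subgroup P S \<Longrightarrow> \<phi> \<in> Homs S P C \<Longrightarrow>
      \<not> (U \<subseteq> P \<and> (\<exists>Q. \<phi> \<in> normalizer_system S F U P Q)) \<Longrightarrow> chi S S P \<phi> \<omega> = 0"
  shows "normalizer S U = C" and "F = normalizer_system S F U"
proof -
  \<comment> \<open>The hypothesis read backwards: a pair whose class is a key has a nonzero
    coefficient.\<close>
  have key: "U \<subseteq> Q \<and> \<psi> ` U = U \<and> Q \<subseteq> normalizer S U" if \<psi>: "\<psi> \<in> F Q C" "cls Q \<psi> \<in> Poly_Mapping.keys w" for Q \<psi>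
  proof -
    have "chi S S Q \<psi> \<omega> \<noteq> 0" using \<psi>(2) by (simp add: chi_w in_keys_iff)
    then obtain R where R: "U \<subseteq> Q" "\<psi> \<in> normalizer_system S F U Q R"
      using hyp[OF F_subgroup(1)[OF \<psi>(1)] F_Homs[OF \<psi>(1)]] by blast
    show ?thesis using normalizer_systemD[OF R(2) U R(1)] R(1) by simp
  qed
  \<comment> \<open>Applied to the identity of S, the factorization conjugates all of S into some Q
    with Q contained in the normalizer of U; hence U is normal in S.\<close>
  have Cid: "(\<lambda>x\<in>C. x) \<in> F C C" using subgroup_self by (intro F_incl) auto
  obtain Q \<psi> h g where Q: "\<psi> \<in> F Q C" "cls Q \<psi> \<in> Poly_Mapping.keys w" "g \<in> C"
    "\<And>q. q \<in> C \<Longrightarrow> g \<otimes> q \<otimes> inv g \<in> Q"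
    using F_factors_through_key[OF Cid] by metis
  have "C \<subseteq> Q"
  proof
    fix q assume q: "q \<in> C"
    have "g \<otimes> (inv g \<otimes> q \<otimes> g) \<otimes> inv g = (g \<otimes> inv g) \<otimes> q \<otimes> (g \<otimes> inv g)"
      using q Q(3) by (simp only: m_assoc m_closed inv_closed)
    then show "q \<in> Q" using Q(4)[of "inv g \<otimes> q \<otimes> g"] q Q(3) by simp
  qed
  then show N: "normalizer S U = C" using key[OF Q(1,2)] by (auto simp: normalizer_def stabilizer_def)
  note norm = normalizer_conj[OF U N]
  have sub: "\<phi> \<in> normalizer_system S F U P R" if \<phi>: "\<phi> \<in> F P R" for \<phi> P R
  proof -
    note P = F_subgroup(1)[OF \<phi>] and R = F_subgroup(2)[OF \<phi>]
    note PU = set_mult_subgroup[OF U norm P] and RU = set_mult_subgroup[OF U norm R]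
    have \<phi>C: "\<phi> \<in> F P C" using \<phi> subgroup_self subgroup.subset[OF R] F_into[OF \<phi>] by (intro F_mono[OF \<phi>]) auto
    obtain Q \<psi> h g where Q: "\<psi> \<in> F Q C" "cls Q \<psi> \<in> Poly_Mapping.keys w" "h \<in> C" "g \<in> C"
      "\<And>q. q \<in> P \<Longrightarrow> g \<otimes> q \<otimes> inv g \<in> Q"
      "\<And>q. q \<in> P \<Longrightarrow> \<phi> q = h \<otimes> \<psi> (g \<otimes> q \<otimes> inv g) \<otimes> inv h"
      by (rule F_factors_through_key[OF \<phi>C]) (rule that)
    note kQ = key[OF Q(1,2)]
    note Uc = subgroup.mem_carrier[OF U] and Pc = subgroup.mem_carrier[OF P]
    \<comment> \<open>Conjugation by g sends P into Q by choice of g, and U into U, hence into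
      Q.\<close>
    have gQ: "g \<otimes> q \<otimes> inv g \<in> Q" if q: "q \<in> P <#> U" for q
    proof -
      obtain a u where au: "a \<in> P" "u \<in> U" "q = a \<otimes> u" using q by (auto simp: set_mult_def)
      have "(g \<otimes> a \<otimes> inv g) \<otimes> (g \<otimes> u \<otimes> inv g) = g \<otimes> a \<otimes> (inv g \<otimes> g) \<otimes> u \<otimes> inv g"
        using Pc[OF au(1)] Uc[OF au(2)] Q(4) by (simp only: m_assoc m_closed inv_closed)
      also have "\<dots> = g \<otimes> q \<otimes> inv g"
        using Pc[OF au(1)] Uc[OF au(2)] Q(4) au(3) by (simp add: m_assoc)
      finally show ?thesis
        using subgroup.m_closed[OF F_subgroup(1)[OF Q(1)] Q(5)[OF au(1)]] norm[OF Q(4) au(2)] kQ by (metis subsetD)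
    qed
    define \<theta> where "\<theta> = (\<lambda>q\<in>P <#> U. h \<otimes> \<psi> (g \<otimes> q \<otimes> inv g) \<otimes> inv h)"
    have \<theta>: "\<theta> \<in> F (P <#> U) C" unfolding \<theta>_def by (rule F_twist[OF Q(1,3,4) PU(1) gQ])
    have \<theta>P: "\<theta> q = \<phi> q" if "q \<in> P" for q using that PU(2) Q(6) by (auto simp: \<theta>_def)
    have \<theta>U: "\<theta> u \<in> U" if u: "u \<in> U" for u
    proof -
      have "\<psi> (g \<otimes> u \<otimes> inv g) \<in> U" using norm[OF Q(4) u] kQ by blast
      then show ?thesis using norm[OF Q(3)] u PU(3) by (auto simp: \<theta>_def)
    qed
    \<comment> \<open>On PU the map is the product of \<open>\<phi>\<close> on P and a map of U into
      itself, so it lands in RU and not merely in S.\<close>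
    have "\<theta> ` (P <#> U) \<subseteq> R <#> U"
    proof clarify
      fix q assume "q \<in> P <#> U"
      then obtain a u where au: "a \<in> P" "u \<in> U" "q = a \<otimes> u" by (auto simp: set_mult_def)
      have "\<theta> q = \<phi> a \<otimes> \<theta> u"
        unfolding au(3) using F_mult[OF \<theta>, of a u] PU(2,3) au \<theta>P by auto
      then show "\<theta> q \<in> R <#> U" using F_into[OF \<phi> au(1)] \<theta>U[OF au(2)] by (auto simp: set_mult_def)
    qed
    then have \<theta>R: "\<theta> \<in> F (P <#> U) (R <#> U)" using RU(1) by (intro F_mono[OF \<theta>])
    have "\<theta> ` U = U"
    proof (rule card_subset_eq)
      show "finite U" by (rule subgroup_finite[OF U])
      show "\<theta> ` U \<subseteq> U" using \<theta>U by auto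
      show "card (\<theta> ` U) = card U" by (rule card_image[OF inj_on_subset[OF F_inj[OF \<theta>] PU(3)]])
    qed
    moreover have "restrict \<theta> P = \<phi>" using \<theta>P F_ext[OF \<phi>] by (auto simp: fun_eq_iff extensional_def)
    ultimately show ?thesis unfolding normalizer_system_def using P R \<phi> \<theta>R N by auto
  qed
  have "F P R = normalizer_system S F U P R" for P R
  proof
    show "F P R \<subseteq> normalizer_system S F U P R" using sub by blast
    show "normalizer_system S F U P R \<subseteq> F P R" by (auto simp: normalizer_system_def)
  qed
  then show "F = normalizer_system S F U" by blast
qed

end

section \<open>From normality of U to the support of the idempotent\<close>

locale normal_in_fusion = char_idempotent S F p n \<omega> w
  for S :: "('a, 'm) monoid_scheme" (structure) and F :: "'a homsets" and p n \<omega> w +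
  fixes U :: "'a set"
  assumes U: "subgroup U S" and N: "normalizer S U = carrier S" and FN: "F = normalizer_system S F U"
begin

lemmas norm = normalizer_conj[OF U N]

abbreviation PU where "PU P \<equiv> P <#> U"

lemma F_preserves_U: "\<phi> \<in> F R C \<Longrightarrow> U \<subseteq> R \<Longrightarrow> \<phi> ` U = U"
  using normalizer_systemD(2)[of \<phi> U R C] FN U by metis

lemma F_extends:
  assumes "\<phi> \<in> F P C"
  obtains \<theta> where "\<theta> \<in> F (PU P) C" "restrict \<theta> P = \<phi>"
proof -
  have "\<phi> \<in> normalizer_system S F U P C" using assms FN by metis
  then obtain \<theta> where \<theta>: "\<theta> \<in> F (PU P) (PU C)" "restrict \<theta> P = \<phi>"
    by (auto simp: normalizer_system_def split: if_splits)
  have "\<theta> \<in> F (PU P) C"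
    using F_into[OF \<theta>(1)] subgroup.subset[OF F_subgroup(2)[OF \<theta>(1)]] subgroup_self by (intro F_mono[OF \<theta>(1)]) auto
  then show ?thesis using that \<theta>(2) by blast
qed

text \<open>Composition with one fixed extension \<open>\<theta>0\<close> carries the extensions of
  the identity of P bijectively to the extensions of \<open>\<phi>\<close>.\<close>

lemma card_extensions_eq:
  assumes \<phi>: "\<phi> \<in> F P C"
  shows "card {\<theta> \<in> F (PU P) C. restrict \<theta> P = \<phi>} = card {\<theta> \<in> F (PU P) C. restrict \<theta> P = (\<lambda>x\<in>P. x)}"
proof -
  note P = F_subgroup(1)[OF \<phi>]
  note PU = set_mult_subgroup[OF U norm P]
  obtain \<theta>0 where \<theta>0: "\<theta>0 \<in> F (PU P) C" "restrict \<theta>0 P = \<phi>" using \<phi> by (rule F_extends)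
  let ?inv = "inv_map (PU P) \<theta>0"
  have inv: "?inv \<in> F (\<theta>0 ` PU P) (PU P)" by (rule F_inverse[OF \<theta>0(1)])
  have inv1: "?inv (\<theta>0 x) = x" if "x \<in> PU P" for x using that F_inj[OF \<theta>0(1)] by (simp add: inv_map_def)
  \<comment> \<open>Both maps agree on P and send U onto U, so a value \<theta>(u) is also attained
    by \<theta>' on U. Equality of images is what allows composition with the inverse of
    \<open>\<theta>0\<close>.\<close>
  have img: "\<theta> ` PU P \<subseteq> \<theta>' ` PU P" if \<theta>: "\<theta> \<in> F (PU P) C" and \<theta>': "\<theta>' \<in> F (PU P) C" and eq: "restrict \<theta> P = restrict \<theta>' P" for \<theta> \<theta>'
  proof clarify
    fix x assume "x \<in> PU P"
    then obtain a u where au: "a \<in> P" "u \<in> U" "x = a \<otimes> u" by (auto simp: set_mult_def)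
    have "\<theta> u \<in> \<theta>' ` U" using F_preserves_U[OF \<theta> PU(3)] F_preserves_U[OF \<theta>' PU(3)] au(2) by blast
    then obtain v where v: "v \<in> U" "\<theta> u = \<theta>' v" by blast
    have "\<theta> a = \<theta>' a" using eq au(1) by (metis restrict_apply')
    then have "\<theta> x = \<theta>' (a \<otimes> v)"
      using F_mult[OF \<theta> subsetD[OF PU(2) au(1)] subsetD[OF PU(3) au(2)]]
        F_mult[OF \<theta>' subsetD[OF PU(2) au(1)] subsetD[OF PU(3) v(1)]] au(3) v(2) by simp
    then show "\<theta> x \<in> \<theta>' ` PU P" using au v by (auto simp: set_mult_def)
  qed
  have PUC: "PU P \<subseteq> C" using subgroup.subset[OF PU(1)] .
  have incl: "(\<lambda>x\<in>PU P. x) \<in> F (PU P) C" using PU(1) PUC subgroup_self by (intro F_incl)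
  have "bij_betw (\<lambda>\<alpha>. compose (PU P) \<theta>0 \<alpha>) {\<theta> \<in> F (PU P) C. restrict \<theta> P = (\<lambda>x\<in>P. x)} {\<theta> \<in> F (PU P) C. restrict \<theta> P = \<phi>}"
  proof (rule bij_betw_byWitness[where f' = "\<lambda>\<theta>. compose (PU P) ?inv \<theta>"])
    have into: "\<alpha> ` PU P \<subseteq> PU P" if "\<alpha> \<in> F (PU P) C" "restrict \<alpha> P = (\<lambda>x\<in>P. x)" for \<alpha>
    proof -
      have "restrict \<alpha> P = restrict (\<lambda>x\<in>PU P. x) P" using that(2) PU(2) by (auto simp: fun_eq_iff)
      from img[OF that(1) incl this] show ?thesis by simp
    qed
    have into0: "\<theta> ` PU P \<subseteq> \<theta>0 ` PU P" if "\<theta> \<in> F (PU P) C" "restrict \<theta> P = \<phi>" for \<theta>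
      using img[OF that(1) \<theta>0(1)] that(2) \<theta>0(2) by simp
    show "\<forall>\<alpha>\<in>{\<theta> \<in> F (PU P) C. restrict \<theta> P = (\<lambda>x\<in>P. x)}. compose (PU P) ?inv (compose (PU P) \<theta>0 \<alpha>) = \<alpha>"
    proof clarify
      fix \<alpha> assume \<alpha>: "\<alpha> \<in> F (PU P) C" "restrict \<alpha> P = (\<lambda>x\<in>P. x)"
      show "compose (PU P) ?inv (compose (PU P) \<theta>0 \<alpha>) = \<alpha>"
      proof (rule extensionalityI[of _ "PU P"])
        show "compose (PU P) ?inv (compose (PU P) \<theta>0 \<alpha>) x = \<alpha> x" if "x \<in> PU P" for x
          using that into[OF \<alpha>] by (simp add: compose_def inv1 image_subset_iff)
      qed (simp_all add: F_ext[OF \<alpha>(1)])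
    qed
    show "\<forall>\<theta>\<in>{\<theta> \<in> F (PU P) C. restrict \<theta> P = \<phi>}. compose (PU P) \<theta>0 (compose (PU P) ?inv \<theta>) = \<theta>"
    proof clarify
      fix \<theta> assume \<theta>: "\<theta> \<in> F (PU P) C" "\<phi> = restrict \<theta> P"
      show "compose (PU P) \<theta>0 (compose (PU P) ?inv \<theta>) = \<theta>"
      proof (rule extensionalityI[of _ "PU P"])
        show "compose (PU P) \<theta>0 (compose (PU P) ?inv \<theta>) x = \<theta> x" if x: "x \<in> PU P" for x
        proof -
          obtain y where "y \<in> PU P" "\<theta> x = \<theta>0 y" using into0[OF \<theta>(1)] \<theta>(2) x by blast
          then show ?thesis using x by (simp add: compose_def inv1)
        qed
      qed (simp_all add: F_ext[OF \<theta>(1)])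
    qed
    show "(\<lambda>\<alpha>. compose (PU P) \<theta>0 \<alpha>) ` {\<theta> \<in> F (PU P) C. restrict \<theta> P = (\<lambda>x\<in>P. x)} \<subseteq> {\<theta> \<in> F (PU P) C. restrict \<theta> P = \<phi>}"
    proof (rule image_subsetI)
      fix \<alpha> assume "\<alpha> \<in> {\<theta> \<in> F (PU P) C. restrict \<theta> P = (\<lambda>x\<in>P. x)}"
      then have \<alpha>: "\<alpha> \<in> F (PU P) C" "restrict \<alpha> P = (\<lambda>x\<in>P. x)" by auto
      have "\<alpha> \<in> F (PU P) (PU P)" using into[OF \<alpha>] PU(1) by (intro F_mono[OF \<alpha>(1)])
      then have "compose (PU P) \<theta>0 \<alpha> \<in> F (PU P) C" using \<theta>0(1) by (rule F_comp)
      moreover have "compose (PU P) \<theta>0 \<alpha> x = \<phi> x" if "x \<in> P" for x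
      proof -
        have "\<alpha> x = x" using \<alpha>(2) that by (metis restrict_apply')
        moreover have "\<theta>0 x = \<phi> x" using \<theta>0(2) that by (metis restrict_apply')
        ultimately show ?thesis using that PU(2) by (auto simp: compose_def)
      qed
      ultimately show "compose (PU P) \<theta>0 \<alpha> \<in> {\<theta> \<in> F (PU P) C. restrict \<theta> P = \<phi>}"
        using F_ext[OF \<phi>] by (auto simp: fun_eq_iff extensional_def)
    qed
    show "(\<lambda>\<theta>. compose (PU P) ?inv \<theta>) ` {\<theta> \<in> F (PU P) C. restrict \<theta> P = \<phi>} \<subseteq> {\<theta> \<in> F (PU P) C. restrict \<theta> P = (\<lambda>x\<in>P. x)}"
    proof (rule image_subsetI)
      fix \<theta> assume "\<theta> \<in> {\<theta> \<in> F (PU P) C. restrict \<theta> P = \<phi>}"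
      then have \<theta>: "\<theta> \<in> F (PU P) C" "restrict \<theta> P = \<phi>" by auto
      have "\<theta> \<in> F (PU P) (\<theta>0 ` PU P)" using into0[OF \<theta>] F_subgroup(1)[OF inv] by (intro F_mono[OF \<theta>(1)])
      then have 1: "compose (PU P) ?inv \<theta> \<in> F (PU P) (PU P)" using inv by (rule F_comp)
      then have "compose (PU P) ?inv \<theta> \<in> F (PU P) C"
        using F_into[OF 1] PUC subgroup_self by (intro F_mono[OF 1]) auto
      moreover have "compose (PU P) ?inv \<theta> x = x" if "x \<in> P" for x
      proof -
        have "\<theta> x = \<theta>0 x" using \<theta>(2) \<theta>0(2) that by (metis restrict_apply')
        then show ?thesis using that PU(2) inv1 by (auto simp: compose_def)
      qed
      ultimately show "compose (PU P) ?inv \<theta> \<in> {\<theta> \<in> F (PU P) C. restrict \<theta> P = (\<lambda>x\<in>P. x)}"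
        by (auto simp: fun_eq_iff)
    qed
  qed
  then show ?thesis by (rule bij_betw_same_card[symmetric])
qed

text \<open>Restriction from F(PU,S) to F(P,S) has fibres of equal size, so |F(PU,S)| is this size
  times |F(P,S)|.\<close>

lemma card_extensions:
  assumes \<phi>: "\<phi> \<in> F P C"
  shows "card {\<theta> \<in> F (PU P) C. restrict \<theta> P = \<phi>} * card (F P C) = card (F (PU P) C)"
proof -
  note P = F_subgroup(1)[OF \<phi>]
  note PU = set_mult_subgroup[OF U norm P]
  have "F (PU P) C = (\<Union>\<psi>\<in>F P C. {\<theta> \<in> F (PU P) C. restrict \<theta> P = \<psi>})"
    using F_restrict[OF _ P PU(2)] by auto
  then have "card (F (PU P) C) = card (\<Union>\<psi>\<in>F P C. {\<theta> \<in> F (PU P) C. restrict \<theta> P = \<psi>})" by simp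
  also have "\<dots> = (\<Sum>\<psi>\<in>F P C. card {\<theta> \<in> F (PU P) C. restrict \<theta> P = \<psi>})"
    using finite_F by (intro card_UN_disjoint) auto
  also have "\<dots> = (\<Sum>\<psi>\<in>F P C. card {\<theta> \<in> F (PU P) C. restrict \<theta> P = \<phi>})"
    by (intro sum.cong refl) (simp add: card_extensions_eq \<phi>)
  finally show ?thesis by simp
qed

text \<open>If the point (h, g) is fixed by P along \<open>\<phi>\<close>, then g conjugates P into
  Q, and also U because U is normal and contained in Q. The point is then fixed by PU along an
  extension of \<open>\<phi>\<close>, unique by freeness.\<close>

lemma mark_extend:
  assumes \<psi>: "\<psi> \<in> F Q C" and UQ: "U \<subseteq> Q" and \<phi>: "\<phi> \<in> F P C"
  shows "mark (cls Q \<psi>) P (\<lambda>x. x) \<phi> = (\<Sum>\<theta>\<in>{\<theta> \<in> F (PU P) C. restrict \<theta> P = \<phi>}. mark (cls Q \<psi>) (PU P) (\<lambda>x. x) \<theta>)"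
proof -
  note P = F_subgroup(1)[OF \<phi>]
  note PU = set_mult_subgroup[OF U norm P]
  note Pc = subgroup.mem_carrier[OF P] and PUc = subgroup.mem_carrier[OF PU(1)] and Uc = subgroup.mem_carrier[OF U]
  interpret Q: standard_biset S S Q \<psi> using F_std[OF \<psi>] .
  let ?B = "std_biset S S Q \<psi>" and ?E = "{\<theta> \<in> F (PU P) C. restrict \<theta> P = \<phi>}"
  have id: "(\<lambda>x. x) \<in> P \<rightarrow> C" "(\<lambda>x. x) \<in> PU P \<rightarrow> C" using Pc PUc by auto
  have \<phi>C: "\<phi> \<in> P \<rightarrow> C" using F_into[OF \<phi>] by auto
  have "fixpts ?B P (\<lambda>x. x) \<phi> = (\<Union>\<theta>\<in>?E. fixpts ?B (PU P) (\<lambda>x. x) \<theta>)"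
  proof
    show "(\<Union>\<theta>\<in>?E. fixpts ?B (PU P) (\<lambda>x. x) \<theta>) \<subseteq> fixpts ?B P (\<lambda>x. x) \<phi>"
      using PU(2) by (auto simp: fixpts_def)
    show "fixpts ?B P (\<lambda>x. x) \<phi> \<subseteq> (\<Union>\<theta>\<in>?E. fixpts ?B (PU P) (\<lambda>x. x) \<theta>)"
    proof
      fix y assume y: "y \<in> fixpts ?B P (\<lambda>x. x) \<phi>"
      then have "y \<in> points ?B" by (simp add: fixpts_def)
      then obtain h g where hg: "h \<in> C" "g \<in> C" "y = std_pt S S Q \<psi> h g" by (rule Q.std_ptE)
      have fx: "g \<otimes> q \<otimes> inv g \<in> Q" "\<phi> q = h \<otimes> \<psi> (g \<otimes> q \<otimes> inv g) \<otimes> inv h" if "q \<in> P" for q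
        using y Q.std_pt_fixed_iff[OF hg(1,2) id(1) \<phi>C] hg(3) that by auto
      have gQ: "g \<otimes> q \<otimes> inv g \<in> Q" if q: "q \<in> PU P" for q
      proof -
        obtain a u where au: "a \<in> P" "u \<in> U" "q = a \<otimes> u" using q by (auto simp: set_mult_def)
        have "(g \<otimes> a \<otimes> inv g) \<otimes> (g \<otimes> u \<otimes> inv g) = g \<otimes> a \<otimes> (inv g \<otimes> g) \<otimes> u \<otimes> inv g"
          using Pc[OF au(1)] Uc[OF au(2)] hg(2) by (simp only: m_assoc m_closed inv_closed)
        also have "\<dots> = g \<otimes> q \<otimes> inv g"
          using Pc[OF au(1)] Uc[OF au(2)] hg(2) au(3) by (simp add: m_assoc)
        finally show ?thesis
          using subgroup.m_closed[OF F_subgroup(1)[OF \<psi>] fx(1)[OF au(1)]] norm[OF hg(2) au(2)] UQ by (metis subsetD)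
      qed
      \<comment> \<open>The extension is dictated by the point: it is the map that (h, g) carries on
        the larger group.\<close>
      let ?\<theta> = "\<lambda>q\<in>PU P. h \<otimes> \<psi> (g \<otimes> q \<otimes> inv g) \<otimes> inv h"
      have \<theta>: "?\<theta> \<in> F (PU P) C" by (rule F_twist[OF \<psi> hg(1,2) PU(1) gQ])
      have \<theta>C: "?\<theta> \<in> PU P \<rightarrow> C" by (intro Pi_I F_into[OF \<theta>])
      have "?\<theta> q = \<phi> q" if "q \<in> P" for q using that PU(2) fx(2)[OF that] by auto
      then have "restrict ?\<theta> P = \<phi>" using F_ext[OF \<phi>] by (intro extensionalityI[of _ P]) auto
      moreover have "y \<in> fixpts ?B (PU P) (\<lambda>x. x) ?\<theta>"
        unfolding hg(3) Q.std_pt_fixed_iff[OF hg(1,2) id(2) \<theta>C] using gQ by auto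
      ultimately show "y \<in> (\<Union>\<theta>\<in>?E. fixpts ?B (PU P) (\<lambda>x. x) \<theta>)" using \<theta> by blast
    qed
  qed
  then have "card (fixpts ?B P (\<lambda>x. x) \<phi>) = card (\<Union>\<theta>\<in>?E. fixpts ?B (PU P) (\<lambda>x. x) \<theta>)" by simp
  also have "\<dots> = (\<Sum>\<theta>\<in>?E. card (fixpts ?B (PU P) (\<lambda>x. x) \<theta>))"
  proof (rule card_UN_disjoint)
    show "finite ?E" using finite_F by simp
    show "\<forall>\<theta>\<in>?E. finite (fixpts ?B (PU P) (\<lambda>x. x) \<theta>)"
      using fin_free_bisetD(2)[OF Q.fin_free_std] by (simp add: fixpts_def)
    show "\<forall>\<theta>\<in>?E. \<forall>\<theta>'\<in>?E. \<theta> \<noteq> \<theta>' \<longrightarrow> fixpts ?B (PU P) (\<lambda>x. x) \<theta> \<inter> fixpts ?B (PU P) (\<lambda>x. x) \<theta>' = {}"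
      by (intro ballI impI disjoint_fixpts[OF grp Q.fin_free_std] F_PiE) auto
  qed
  finally have "of_nat (card (fixpts ?B P (\<lambda>x. x) \<phi>)) = (\<Sum>\<theta>\<in>?E. of_nat (card (fixpts ?B (PU P) (\<lambda>x. x) \<theta>)) :: rat)"
    by simp
  moreover have "mark (cls Q \<psi>) (PU P) (\<lambda>x. x) \<theta> = of_nat (card (fixpts ?B (PU P) (\<lambda>x. x) \<theta>))" if "\<theta> \<in> ?E" for \<theta>
    using F_into that by (intro mark_iso_class[OF grp grp Q.fin_free_std id(2)]) blast
  ultimately show ?thesis using mark_iso_class[OF grp grp Q.fin_free_std id(1) \<phi>C] by simp
qed

text \<open>U equals its own conjugate by g, so it travels along with R into Q.\<close>

lemma conj_invariant_subset:
  assumes "g \<in> C" "U \<subseteq> R" "\<And>q. q \<in> R \<Longrightarrow> g \<otimes> q \<otimes> inv g \<in> Q"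
  shows "U \<subseteq> Q"
proof
  fix u assume u: "u \<in> U"
  note uc = subgroup.mem_carrier[OF U u]
  have "inv g \<otimes> u \<otimes> g \<in> R" using norm[of "inv g" u] assms(1,2) u by auto
  then have "g \<otimes> (inv g \<otimes> u \<otimes> g) \<otimes> inv g \<in> Q" by (rule assms(3))
  moreover have "g \<otimes> (inv g \<otimes> u \<otimes> g) \<otimes> inv g = (g \<otimes> inv g) \<otimes> u \<otimes> (g \<otimes> inv g)"
    using uc assms(1) by (simp only: m_assoc m_closed inv_closed)
  ultimately show "u \<in> Q" using uc assms(1) by simp
qed

text \<open>A nonzero mark would conjugate R, and with it U, into Q.\<close>

lemma mark_bad_zero:
  assumes "\<psi> \<in> F Q C" "\<not> U \<subseteq> Q" "\<theta> \<in> F R C" "U \<subseteq> R"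
  shows "mark (cls Q \<psi>) R (\<lambda>x. x) \<theta> = 0"
proof (rule ccontr)
  assume nz: "mark (cls Q \<psi>) R (\<lambda>x. x) \<theta> \<noteq> 0"
  have "\<theta> \<in> R \<rightarrow> C" using F_into[OF assms(3)] by auto
  then obtain h g where "g \<in> C" "\<And>q. q \<in> R \<Longrightarrow> g \<otimes> q \<otimes> inv g \<in> Q"
    using mark_std_nonzeroE[OF F_std[OF assms(1)] F_subgroup(1)[OF assms(3)] _ nz] by metis
  then show False using conj_invariant_subset assms(2,4) by blast
qed

text \<open>The part of \<open>w\<close> supported on the \<open>[Q, \<psi>]\<close> with \<open>U \<subseteq> Q\<close> already has the marks of \<open>w\<close>.\<close>

lemma key_contains_U:
  assumes c: "c \<in> Poly_Mapping.keys w" and Q: "\<psi> \<in> F Q C" "c = cls Q \<psi>"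
  shows "U \<subseteq> Q"
proof (rule ccontr)
  assume bad: "\<not> U \<subseteq> Q"
  let ?R = "\<lambda>K \<phi>. \<phi> \<in> F K C \<and> \<not> U \<subseteq> K"
  \<comment> \<open>A class is bad if some representative in F does not contain U, so for a good
    class every representative in F contains U.\<close>
  define Bad where "Bad = {c \<in> Poly_Mapping.keys w. \<exists>K \<phi>. ?R K \<phi> \<and> c = cls K \<phi>}"
  define Good where "Good = Poly_Mapping.keys w - Bad"
  define d where "d = (\<Sum>c\<in>Bad. Poly_Mapping.single c (Poly_Mapping.lookup w c))"
  have finB: "finite Bad" and finG: "finite Good" by (auto simp: Bad_def Good_def)
  have lookup_d: "Poly_Mapping.lookup d c = (if c \<in> Bad then Poly_Mapping.lookup w c else 0)" for c
    using finB by (simp add: d_def lookup_sum lookup_single when_def)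
  have lin_d: "lin f d = (\<Sum>c\<in>Bad. Poly_Mapping.lookup w c * f c)" for f by (simp add: d_def lin_sum)
  have lin_w: "lin f w = (\<Sum>c\<in>Good. Poly_Mapping.lookup w c * f c) + lin f d" for f
    unfolding lin_d lin_def[of f w] Good_def by (rule sum.subset_diff) (auto simp: Bad_def)
  have "c \<in> Bad" using c Q bad unfolding Bad_def by blast
  then have "Poly_Mapping.lookup d c \<noteq> 0" using c by (simp add: lookup_d in_keys_iff)
  then have "d \<noteq> 0" by auto
  moreover have "\<exists>K \<phi>. ?R K \<phi> \<and> c = cls K \<phi>" if "c \<in> Poly_Mapping.keys d" for c
    using that by (auto simp: in_keys_iff lookup_d Bad_def split: if_splits)
  moreover have "standard_biset S S K \<phi>" if "?R K \<phi>" for K \<phi> using that F_std by blast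
  \<comment> \<open>The pair found by maximality again belongs to F, so its extensions to PU are at
    hand.\<close>
  ultimately obtain P \<phi> where P: "\<phi> \<in> F P C" "lin (\<lambda>c. mark c P (\<lambda>x. x) \<phi>) d \<noteq> 0"
    using SS.maximal_key_mark[of d ?R] by blast
  note PU = set_mult_subgroup[OF U norm F_subgroup(1)[OF P(1)]]
  let ?E = "{\<theta> \<in> F (PU P) C. restrict \<theta> P = \<phi>}"
  have good: "mark c P (\<lambda>x. x) \<phi> = (\<Sum>\<theta>\<in>?E. mark c (PU P) (\<lambda>x. x) \<theta>)" if c: "c \<in> Good" for c
  proof -
    have "c \<in> Poly_Mapping.keys w" using c by (simp add: Good_def)
    then obtain K \<psi> where K: "\<psi> \<in> F K C" "c = cls K \<psi>" by (rule keyE)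
    then have "U \<subseteq> K" using c unfolding Good_def Bad_def by blast
    then show ?thesis using mark_extend[OF K(1) _ P(1)] K(2) by simp
  qed
  \<comment> \<open>Bad classes have no marks over PU, which contains U. The good part therefore
    carries the whole mark of \<open>w\<close> there, and its value is known.\<close>
  have goodE: "(\<Sum>c\<in>Good. Poly_Mapping.lookup w c * mark c (PU P) (\<lambda>x. x) \<theta>) = of_nat (card C) / of_nat (card (F (PU P) C))"
    if \<theta>: "\<theta> \<in> ?E" for \<theta>
  proof -
    have \<theta>F: "\<theta> \<in> F (PU P) C" using \<theta> by simp
    have "lin (\<lambda>c. mark c (PU P) (\<lambda>x. x) \<theta>) d = 0"
      unfolding lin_d using mark_bad_zero[OF _ _ \<theta>F PU(3)] by (intro sum.neutral) (auto simp: Bad_def)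
    then show ?thesis using lin_w[of "\<lambda>c. mark c (PU P) (\<lambda>x. x) \<theta>"] mark_formula[OF \<theta>F] by simp
  qed
  have "(\<Sum>c\<in>Good. Poly_Mapping.lookup w c * mark c P (\<lambda>x. x) \<phi>) =
      (\<Sum>c\<in>Good. \<Sum>\<theta>\<in>?E. Poly_Mapping.lookup w c * mark c (PU P) (\<lambda>x. x) \<theta>)"
    by (intro sum.cong refl) (simp add: good sum_distrib_left)
  also have "\<dots> = (\<Sum>\<theta>\<in>?E. \<Sum>c\<in>Good. Poly_Mapping.lookup w c * mark c (PU P) (\<lambda>x. x) \<theta>)" by (rule sum.swap)
  also have "\<dots> = (\<Sum>\<theta>\<in>?E. of_nat (card C) / of_nat (card (F (PU P) C)))" by (intro sum.cong refl goodE)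
  also have "\<dots> = of_nat (card ?E) * (of_nat (card C) / of_nat (card (F (PU P) C)))" by simp
  \<comment> \<open>|F(PU,S)| is the number of extensions times |F(P,S)|. An extension exists, so
    the number of extensions cancels.\<close>
  also have "\<dots> = of_nat (card C) / of_nat (card (F P C))"
  proof -
    have "card (F P C) > 0" using finite_F P(1) by (auto simp: card_gt_0_iff)
    moreover obtain \<theta> where "\<theta> \<in> F (PU P) C" "restrict \<theta> P = \<phi>" using P(1) by (rule F_extends)
    then have "card ?E > 0" using finite_F by (auto simp: card_gt_0_iff)
    ultimately show ?thesis unfolding card_extensions[OF P(1), symmetric] by simp
  qed
  also have "\<dots> = mk P \<phi>" by (rule mark_formula[OF P(1), symmetric])
  finally have "lin (\<lambda>c. mark c P (\<lambda>x. x) \<phi>) d = 0" using lin_w[of "\<lambda>c. mark c P (\<lambda>x. x) \<phi>"] by simp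
  then show False using P(2) by simp
qed

text \<open>The key theorem on U concerns representatives in F, whereas (P, \<phi>) is an arbitrary
  pair, known only to share its class with some (Q, \<psi>) in F. Nonzero diagonal marks carry both
  properties over.\<close>

lemma chi_zero:
  assumes P: "subgroup P S" and \<phi>: "\<phi> \<in> Homs S P C"
    and no: "\<not> (U \<subseteq> P \<and> (\<exists>Q. \<phi> \<in> normalizer_system S F U P Q))"
  shows "chi S S P \<phi> \<omega> = 0"
proof (rule ccontr)
  assume "chi S S P \<phi> \<omega> \<noteq> 0"
  then have k: "cls P \<phi> \<in> Poly_Mapping.keys w" by (simp add: chi_w in_keys_iff)
  then obtain Q \<psi> where Q: "\<psi> \<in> F Q C" "cls P \<phi> = cls Q \<psi>" by (rule keyE)
  have UQ: "U \<subseteq> Q" by (rule key_contains_U[OF k Q])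
  have \<phi>E: "\<phi> \<in> P \<rightarrow>\<^sub>E C" using \<phi> by (auto simp: Homs_def hom_def PiE_def)
  have std: "standard_biset S S P \<phi>" using P \<phi> by (intro SS.standard_bisetI) (auto simp: Homs_def hom_def)
  have self: "mark (cls K \<eta>) K (\<lambda>x. x) \<eta> \<noteq> 0" if K: "standard_biset S S K \<eta>" for K \<eta>
    using std_biset_fixpt_self[OF K] standard_biset.K_sub[OF K] standard_biset.\<phi>_closed[OF K]
    by (subst SS.mark_std_nonzero_iff[OF K]) auto
  \<comment> \<open>The diagonal mark at (P, \<phi>) is also the mark of [Q, \<psi>] there, which
    lives on F.\<close>
  have "\<phi> \<in> F P C" using mark_in_F[OF Q(1) P \<phi>E] self[OF std] Q(2) by simp
  then have "\<phi> \<in> normalizer_system S F U P C" using FN by metis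
  \<comment> \<open>In the other direction the diagonal mark at (Q, \<psi>), read on [P, \<phi>],
    conjugates Q into P and brings U along.\<close>
  moreover have "U \<subseteq> P"
  proof -
    have "\<psi> \<in> Q \<rightarrow> C" using F_into[OF Q(1)] by auto
    then obtain h g where "g \<in> C" "\<And>q. q \<in> Q \<Longrightarrow> g \<otimes> q \<otimes> inv g \<in> P"
      using mark_std_nonzeroE[OF std F_subgroup(1)[OF Q(1)]] self[OF F_std[OF Q(1)]] Q(2) by metis
    then show ?thesis using conj_invariant_subset UQ by blast
  qed
  ultimately show False using no by blast
qed

end

theorem lemma4p2:
  fixes p :: nat
    and S :: "('a, 'm) monoid_scheme"
    and F :: "'a homsets"
    and U :: "'a set"
    and \<omega> :: "('a, 'a) burnside_elt"
  assumes "prime p"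
    and "p_group p S"
    and "fusion_system S F"
    and "saturated p S F"
    and "subgroup U S"
    and "characteristic_idempotent p S F \<omega>"
  shows "(normalizer S U = carrier S \<and> F = normalizer_system S F U) \<longleftrightarrow>
    (\<forall>P \<phi>. subgroup P S \<and> \<phi> \<in> Homs S P (carrier S) \<longrightarrow>
      \<not> (U \<subseteq> P \<and> (\<exists>Q. \<phi> \<in> normalizer_system S F U P Q)) \<longrightarrow>
      chi S S P \<phi> \<omega> = 0)"
proof -
  obtain n where S: "group S" "finite (carrier S)" "card (carrier S) = p ^ n"
    using assms(2) by (auto simp: p_group_def order_def)
  \<comment> \<open>The combination that witnesses generation by F is kept as the representative on
    which every mark is evaluated.\<close>
  obtain w where w: "w \<in> \<omega>" "Poly_Mapping.keys w \<subseteq>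
      {iso_class S S (std_biset S S P \<phi>) | P \<phi>. subgroup P S \<and> \<phi> \<in> F P (carrier S)}"
    using assms(6) by (auto simp: characteristic_idempotent_def generated_def)
  have ci: "char_idempotent S F p n \<omega> w"
    using S w assms(1,3,6)
    by (intro char_idempotent.intro finite_fusion_system.intro char_idempotent_axioms.intro)
  show ?thesis
  proof
    assume "normalizer S U = carrier S \<and> F = normalizer_system S F U"
    then have "normal_in_fusion S F p n \<omega> w U"
      using ci assms(5) by (intro normal_in_fusion.intro normal_in_fusion_axioms.intro) auto
    then show "\<forall>P \<phi>. subgroup P S \<and> \<phi> \<in> Homs S P (carrier S) \<longrightarrow>
      \<not> (U \<subseteq> P \<and> (\<exists>Q. \<phi> \<in> normalizer_system S F U P Q)) \<longrightarrow> chi S S P \<phi> \<omega> = 0"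
      using normal_in_fusion.chi_zero by blast
  next
    assume "\<forall>P \<phi>. subgroup P S \<and> \<phi> \<in> Homs S P (carrier S) \<longrightarrow>
      \<not> (U \<subseteq> P \<and> (\<exists>Q. \<phi> \<in> normalizer_system S F U P Q)) \<longrightarrow> chi S S P \<phi> \<omega> = 0"
    then show "normalizer S U = carrier S \<and> F = normalizer_system S F U"
      using char_idempotent.F_eq_normalizer_systemI[OF ci assms(5)] by blast
  qed
qed

end
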